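(* Fix $\frac12<\mu<1$. There exist $r_2>0$ and $C>0$ such that, for all initial data $w_0\in L^2(3)$ with $\|w_0\|_3\le r_2$, the solution $w(\cdot,\tau)$ of the rescaled vorticity equation with $w(\cdot,0)=w_0$ satisfies $$\Bigl\|w(\xi,\tau)-AG(\xi)+\tfrac12(B_1\xi_1+B_2\xi_2)G(\xi)e^{-\tau/2}\Bigr\|_3\le Ce^{-\mu\tau},\qquad\tau\ge0,$$ where the norm is taken in the variable $\xi$, $A=\int_{\mathbb{R}^2}w_0(\xi)\,d\xi$, $B_1=-\int_{\mathbb{R}^2}\xi_1w_0(\xi)\,d\xi$, and $B_2=-\int_{\mathbb{R}^2}\xi_2w_0(\xi)\,d\xi$.
   Context: For $m\ge0$, $L^2(m)=\{f\in L^2(\mathbb{R}^2):\|f\|_m<\infty\}$ with $\|f\|_m=\bigl(\int_{\mathbb{R}^2}(1+|\xi|^2)^m|f(\xi)|^2\,d\xi\bigr)^{1/2}$. $G(\xi)=\frac1{4\pi}e^{-|\xi|^2/4}$ for $\xi=(\xi_1,\xi_2)\in\mathbb{R}^2$. The rescaled vorticity equation on $\mathbb{R}^2$ is $\partial_\tau w=\mathcal{L}w-(\mathbf{v}\cdot\nabla)w$, where $\mathcal{L}w=\Delta w+\frac12\xi\cdot\nabla w+w$ and $\mathbf{v}(\xi,\tau)=\frac1{2\pi}\int_{\mathbb{R}^2}\frac{(\xi-\eta)^\perp}{|\xi-\eta|^2}w(\eta,\tau)\,d\eta$, $(x_1,x_2)^\perp=(-x_2,x_1)$. It is understood in the integral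 form $w(\tau)=e^{\tau\mathcal{L}}w_0-\int_0^\tau e^{-\frac12(\tau-s)}\nabla\cdot e^{(\tau-s)\mathcal{L}}(\mathbf{v}(s)w(s))\,ds$, where $(e^{\tau\mathcal{L}}f)(\xi)=\frac{e^{\tau}}{4\pi a(\tau)}\int_{\mathbb{R}^2}e^{-|\xi-\xi'|^2/(4a(\tau))}f(\xi'e^{\tau/2})\,d\xi'$, $a(\tau)=1-e^{-\tau}$. For $m>1$ and each $w_0\in L^2(m)$ there is a unique global solution $w\in C^0([0,\infty),L^2(m))$. *)

theory Defs
  imports "HOL-Analysis.Analysis"
begin

text \<open>Elements of \<open>L\<^sup>2(m)\<close> are Lebesgue measurable functions on the plane; all notions below are
  invariant under changes on null sets.\<close>

definition L2 :: "real \<Rightarrow> (real^2 \<Rightarrow> real) set" where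
  "L2 m = {f \<in> borel_measurable lebesgue.
      integrable lebesgue (\<lambda>\<xi>. (f \<xi>)\<^sup>2) \<and>
      integrable lebesgue (\<lambda>\<xi>. (1 + (norm \<xi>)\<^sup>2) powr m * (f \<xi>)\<^sup>2)}"

definition norm_L2 :: "real \<Rightarrow> (real^2 \<Rightarrow> real) \<Rightarrow> real" where
  "norm_L2 m f = sqrt (LINT \<xi>|lebesgue. (1 + (norm \<xi>)\<^sup>2) powr m * (f \<xi>)\<^sup>2)"

definition G :: "real^2 \<Rightarrow> real" where
  "G \<xi> = 1 / (4 * pi) * exp (- (norm \<xi>)\<^sup>2 / 4)"

definition perp :: "real^2 \<Rightarrow> real^2" where
  "perp x = vector [- (x $ 2), x $ 1]"

definition biot_savart :: "(real^2 \<Rightarrow> real) \<Rightarrow> real^2 \<Rightarrow> real^2" where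
  "biot_savart w \<xi> =
     (1 / (2 * pi)) *\<^sub>R (LINT \<eta>|lebesgue. (w \<eta> / (norm (\<xi> - \<eta>))\<^sup>2) *\<^sub>R perp (\<xi> - \<eta>))"

text \<open>The semigroup generated by \<open>\<Delta> + \<xi> \<cdot> \<nabla> / 2 + 1\<close>. It acts on scalar functions and,
  componentwise, on vector fields. The kernel degenerates at \<open>\<tau> = 0\<close>, where the semigroup is the
  identity.\<close>

definition semigroup_a :: "real \<Rightarrow> real" where
  "semigroup_a \<tau> = 1 - exp (- \<tau>)"

definition semigroup_L ::
    "real \<Rightarrow> (real^2 \<Rightarrow> 'b::{banach, second_countable_topology}) \<Rightarrow> real^2 \<Rightarrow> 'b" where
  "semigroup_L \<tau> f \<xi> =
     (if \<tau> = 0 then f \<xi>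
      else (exp \<tau> / (4 * pi * semigroup_a \<tau>)) *\<^sub>R
        (LINT \<xi>'|lebesgue.
           exp (- (norm (\<xi> - \<xi>'))\<^sup>2 / (4 * semigroup_a \<tau>)) *\<^sub>R f (exp (\<tau> / 2) *\<^sub>R \<xi>')))"

definition divergence :: "(real^2 \<Rightarrow> real^2) \<Rightarrow> real^2 \<Rightarrow> real" where
  "divergence F \<xi> = (\<Sum>i\<in>UNIV. frechet_derivative F (at \<xi>) (axis i 1) $ i)"

text \<open>A global solution in \<open>C\<^sup>0([0,\<infinity>), L\<^sup>2(m))\<close> of the rescaled vorticity equation in integral form
  with initial value \<open>w0\<close>. The equation is an identity in \<open>L\<^sup>2(m)\<close>, hence required for almost every
  \<open>\<xi>\<close>, the time integral being evaluated pointwise in \<open>\<xi>\<close>. At \<open>\<tau> = 0\<close> it says \<open>w 0 = w0\<close> almost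
  everywhere; the endpoint \<open>s = \<tau>\<close>, where the divergence need not exist, is a null set.\<close>

definition vorticity_solution ::
    "real \<Rightarrow> (real^2 \<Rightarrow> real) \<Rightarrow> (real \<Rightarrow> real^2 \<Rightarrow> real) \<Rightarrow> bool" where
  "vorticity_solution m w0 w \<longleftrightarrow>
     (\<forall>\<tau>\<ge>0. w \<tau> \<in> L2 m) \<and>
     (\<forall>\<tau>\<ge>0. ((\<lambda>s. norm_L2 m (\<lambda>\<xi>. w s \<xi> - w \<tau> \<xi>)) \<longlongrightarrow> 0) (at \<tau> within {0..})) \<and>
     (\<forall>\<tau>\<ge>0. AE \<xi> in lebesgue.
        w \<tau> \<xi> = semigroup_L \<tau> w0 \<xi> -
          (LINT s:{0..\<tau>}|lebesgue. exp (- (\<tau> - s) / 2) *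
             divergence (semigroup_L (\<tau> - s) (\<lambda>\<eta>. w s \<eta> *\<^sub>R biot_savart (w s) \<eta>)) \<xi>))"

end

theory Submission
  imports Defs "HOL-Probability.Distributions"
begin

text \<open>In the variable \<open>y = exp (\<tau> / 2) \<xi>'\<close> the semigroup is convolution with \<open>heat a (\<xi> - e y)\<close>, where
  \<open>e = exp (- \<tau> / 2)\<close> and \<open>a = 1 - e\<^sup>2\<close>. Subtracting Taylor polynomials of this kernel for \<open>e |y| < 1\<close> and
  using the weight for \<open>e |y| \<ge> 1\<close>, it decays like \<open>e powr (2 * \<mu>)\<close> on functions whose mean and first
  moments vanish, and \<open>exp (- \<tau> / 2)\<close> times its divergence decays like \<open>e\<^sup>2\<close> on fluxes \<open>v w\<close>, whose mean
  vanishes because the Biot--Savart kernel is odd. All these bounds follow from the Cauchy--Schwarz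
  inequality and Tonelli's theorem, starting from
  \<open>|v|\<^sup>2 \<le> C \<integral> |f(\<eta>)|\<^sup>2 (1 + |\<eta>|\<^sup>2)\<^sup>2 / |\<xi> - \<eta>| d\<eta>\<close>.

  Let \<open>P\<close> be the Gaussian part of the solution and \<open>R = w - P\<close>. The nonlinearity vanishes on \<open>(G, G)\<close>
  by reflection symmetry, and its polarisation on \<open>G\<close> and a derivative of \<open>G\<close> vanishes because
  translates of \<open>G\<close> are stationary too. Hence only the terms \<open>exp (- s)\<close>, \<open>P R\<close> and \<open>R R\<close> force the
  equation for \<open>R\<close>, and a continuity argument keeps \<open>exp (\<mu> \<tau>) |R|\<close> small for all times when the data
  are small.\<close>

section \<open>Integration on the plane\<close>

text \<open>Weight exponent 3 gives finite moments of every order below 2, so the second Taylor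
  order can be approached as 2\<mu> but not reached; this is the origin of \<mu> < 1. The lower
  bound \<mu> > 1/2 explains the shape of the approximation: the interaction of \<open>G\<close>
  with itself is constant in time, and that of \<open>G\<close> with its derivatives decays only
  like exp(-s/2), both too slow for a remainder of order exp(-\<mu> s). These terms have to vanish
  exactly, which no size estimate could show. What is left is quadratic in the size of the data,
  hence the smallness condition. The Duhamel kernel loses the power 3/4 of the elapsed time, 1/2 for
  the gradient and 1/4 for the singular velocity, and stays integrable. Only the datum is decomposed
  by moments; the nonlinear term owes its decay to the divergence and to the vanishing mean of the
  flux. Bounds are stated for squared weighted norms in the extended nonnegative reals, so that they
  can be written down before anything is known to be finite.\<close>

abbreviation leb2 :: "(real^2) measure" where "leb2 \<equiv> lborel"

lemma Basis_plane: "(Basis :: (real^2) set) = {axis 1 1, axis 2 1}"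
  by (auto simp: Basis_vec_def UNIV_2)

lemma axis_neq_plane: "axis 1 (1::real) \<noteq> (axis 2 1 :: real^2)"
  by (simp add: axis_eq_axis)

lemma norm_plane: "(norm x)\<^sup>2 = (x$1)\<^sup>2 + (x$2)\<^sup>2" for x :: "real^2"
  by (simp add: norm_vec_def L2_set_def sum_2)

lemma inner_plane: "x \<bullet> y = x$1 * y$1 + x$2 * y$2" for x :: "real^2"
  by (simp add: inner_vec_def sum_2)

lemma measurable_vec_nth [measurable]: "(\<lambda>x. x $ i) \<in> borel_measurable (borel :: (real^'n) measure)"
  by (intro borel_measurable_continuous_onI continuous_intros)

lemma nn_integral_plane_prod:
  assumes [measurable]: "f \<in> borel_measurable borel" "g \<in> borel_measurable borel"
  shows "(\<integral>\<^sup>+x. f (x$1) * g (x$2) \<partial>leb2) = (\<integral>\<^sup>+x. f x \<partial>lborel) * (\<integral>\<^sup>+x. g x \<partial>lborel)"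
proof -
  define h where "h b = (if b = axis 1 (1::real) then f else g)" for b :: "real^2"
  have "(\<integral>\<^sup>+x. (\<Prod>b\<in>Basis. h b (x \<bullet> b)) \<partial>leb2) = (\<Prod>b\<in>Basis. (\<integral>\<^sup>+x. h b x \<partial>lborel))"
    by (rule nn_integral_lborel_prod) (auto simp: h_def)
  then show ?thesis
    using axis_neq_plane by (simp add: Basis_plane h_def inner_axis)
qed

section \<open>Affine and orthogonal changes of variables\<close>

lemma nn_integral_affine:
  fixes t :: "'a::euclidean_space"
  assumes [measurable]: "f \<in> borel_measurable borel" and c: "c \<noteq> 0"
  shows "(\<integral>\<^sup>+x. f x \<partial>lborel) = ennreal (\<bar>c\<bar> ^ DIM('a)) * (\<integral>\<^sup>+x. f (t + c *\<^sub>R x) \<partial>lborel)"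
  by (subst lborel_affine[OF c, of t])
     (simp add: nn_integral_density nn_integral_distr nn_integral_cmult)

lemma integrable_affine:
  fixes f :: "'a::euclidean_space \<Rightarrow> 'b :: {banach, second_countable_topology}"
  assumes f: "integrable lborel f" and c: "c \<noteq> 0"
  shows "integrable lborel (\<lambda>x. f (t + c *\<^sub>R x))"
  using f f[THEN borel_measurable_integrable] unfolding integrable_iff_bounded
  by (subst (asm) nn_integral_affine[where c=c and t=t]) (auto simp: ennreal_mult_less_top c)

lemma integrable_affine_iff:
  fixes f :: "'a::euclidean_space \<Rightarrow> 'b :: {banach, second_countable_topology}"
  assumes c: "c \<noteq> 0"
  shows "integrable lborel (\<lambda>x. f (t + c *\<^sub>R x)) \<longleftrightarrow> integrable lborel f"
  using integrable_affine[of f c t]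
    integrable_affine[of "\<lambda>x. f (t + c *\<^sub>R x)" "1/c" "-(1/c) *\<^sub>R t"] c
  by (auto simp: algebra_simps)

lemma integral_affine:
  fixes f :: "'a::euclidean_space \<Rightarrow> 'b :: {banach, second_countable_topology}"
  assumes c: "c \<noteq> 0"
  shows "(\<integral>x. f x \<partial>lborel) = (\<bar>c\<bar> ^ DIM('a)) *\<^sub>R (\<integral>x. f (t + c *\<^sub>R x) \<partial>lborel)"
proof cases
  assume f[measurable]: "integrable lborel f"
  have [measurable]: "(\<lambda>x. f (t + c *\<^sub>R x)) \<in> borel_measurable borel"
    using f[THEN borel_measurable_integrable] by measurable
  show ?thesis
    using c f f[THEN borel_measurable_integrable] f[THEN integrable_affine, of c t]
    by (subst lborel_affine[OF c, of t]) (simp add: integral_density integral_distr)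
next
  \<comment> \<open>Both sides are then the default value 0 of the Bochner integral, so the identity
    holds without integrability.\<close>
  assume "\<not> integrable lborel f" with c show ?thesis
    by (simp add: integrable_affine_iff not_integrable_integral_eq)
qed

text \<open>Lebesgue measure is determined by its values on boxes. The preimage of a box is its
  image under the inverse map, which is again orthogonal, and orthogonal images preserve the measure
  of \<open>lmeasurable\<close> sets. Used below for reflections.\<close>

lemma lborel_distr_orthogonal:
  fixes T :: "real^2 \<Rightarrow> real^2"
  assumes T: "orthogonal_transformation T"
  shows "distr lborel borel T = lborel"
proof (rule lborel_eqI[symmetric])
  have [measurable]: "T \<in> borel_measurable borel"
    using T by (intro borel_measurable_continuous_onI linear_continuous_on)
      (simp add: orthogonal_transformation_def linear_conv_bounded_linear)
  fix l u :: "real^2"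
  assume le: "\<And>b. b \<in> Basis \<Longrightarrow> l \<bullet> b \<le> u \<bullet> b"
  define S where "S = inv T"
  have S: "orthogonal_transformation S"
    using T by (simp add: S_def orthogonal_transformation_inv)
  have eq: "T -` box l u = S ` box l u"
    using orthogonal_transformation_bij[OF T] unfolding S_def
    by (simp add: bij_vimage_eq_inv_image)
  have m: "box l u \<in> lmeasurable" by simp
  have sb: "T -` box l u \<in> sets borel"
    using measurable_sets[of T borel borel "box l u"] by simp
  have "emeasure lborel (T -` box l u) = emeasure lebesgue (S ` box l u)"
    using sb eq by simp
  also have "\<dots> = emeasure lebesgue (box l u)"
    using measurable_orthogonal_image[OF S m] measure_orthogonal_image[OF S m] m
    by (simp add: emeasure_eq_measure2 fmeasurableD2 emeasure_eq_ennreal_measure)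
  finally show "emeasure (distr lborel borel T) (box l u) = (\<Prod>b\<in>Basis. (u - l) \<bullet> b)"
    using le by (simp add: emeasure_distr emeasure_lborel_box_eq)
qed simp

lemma integral_orthogonal:
  fixes T :: "real^2 \<Rightarrow> real^2" and f :: "real^2 \<Rightarrow> 'b :: {banach, second_countable_topology}"
  assumes T: "orthogonal_transformation T" and [measurable]: "f \<in> borel_measurable borel"
  shows "(\<integral>x. f (T x) \<partial>lborel) = (\<integral>x. f x \<partial>lborel)"
proof -
  have [measurable]: "T \<in> borel_measurable borel"
    using T by (intro borel_measurable_continuous_onI linear_continuous_on)
      (simp add: orthogonal_transformation_def linear_conv_bounded_linear)
  show ?thesis
    by (subst (2) lborel_distr_orthogonal[OF T, symmetric]) (simp add: integral_distr)
qed

section \<open>The Gaussian heat kernel of the plane at time \<open>a\<close>\<close>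

definition heat :: "real \<Rightarrow> real^2 \<Rightarrow> real" where
  "heat a x = exp (- (norm x)\<^sup>2 / (4 * a)) / (4 * pi * a)"

lemma heat_measurable [measurable]: "heat a \<in> borel_measurable borel"
  unfolding heat_def by measurable

lemma heat_pos: "a > 0 \<Longrightarrow> heat a x > 0" and heat_nonneg: "a > 0 \<Longrightarrow> heat a x \<ge> 0"
  by (simp_all add: heat_def)

lemma heat_minus [simp]: "heat a (- x) = heat a x"
  by (simp add: heat_def)

lemma G_eq_heat: "G = heat 1"
  by (simp add: fun_eq_iff G_def heat_def)

lemma heat_eq_normal:
  assumes "a > 0"
  shows "heat a x = normal_density 0 (sqrt (2*a)) (x$1) * normal_density 0 (sqrt (2*a)) (x$2)"
  using assms
  by (simp add: heat_def normal_density_def norm_plane exp_add[symmetric] real_sqrt_mult[symmetric] add_divide_distrib diff_divide_distrib)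

lemma nn_integral_normal:
  assumes "\<sigma> > 0"
  shows "(\<integral>\<^sup>+x. ennreal (normal_density \<mu> \<sigma> x) \<partial>lborel) = 1"
  using assms by (subst nn_integral_eq_integral) (auto simp: integrable_normal_density)

lemma nn_integral_heat:
  assumes a: "a > 0"
  shows "(\<integral>\<^sup>+x. ennreal (heat a x) \<partial>lborel) = 1"
  using nn_integral_plane_prod[of "\<lambda>x. ennreal (normal_density 0 (sqrt (2*a)) x)" "\<lambda>x. ennreal (normal_density 0 (sqrt (2*a)) x)"] a
  by (simp add: heat_eq_normal ennreal_mult nn_integral_normal)

lemma integrable_heat: "a > 0 \<Longrightarrow> integrable lborel (heat a)"
  using nn_integral_heat[of a] by (intro integrableI_nonneg) (auto simp: heat_nonneg)

lemma integral_heat: "a > 0 \<Longrightarrow> integral\<^sup>L lborel (heat a) = 1"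
  using nn_integral_heat[of a] integrable_heat[of a]
  by (subst integral_eq_nn_integral) (auto simp: heat_nonneg)

section \<open>Local integrability of 1/|x| in the plane\<close>

text \<open>Splits a planar singularity into two one-dimensional ones.\<close>

lemma inverse_norm_le:
  fixes x :: "real^2"
  shows "1 / norm x \<le> (\<bar>x$1\<bar> powr (-1/2)) * (\<bar>x$2\<bar> powr (-1/2)) \<or> x$1 = 0 \<or> x$2 = 0"
proof (cases "x$1 = 0 \<or> x$2 = 0")
  case False
  have "sqrt (\<bar>x$1\<bar> * \<bar>x$2\<bar>) \<le> norm x"
  proof (rule real_le_lsqrt[THEN order_trans])
    show "\<bar>x$1\<bar> * \<bar>x$2\<bar> \<le> (norm x)\<^sup>2"
      using sum_squares_bound[of "\<bar>x$1\<bar>" "\<bar>x$2\<bar>"] mult_nonneg_nonneg[OF abs_ge_zero[of "x$1"] abs_ge_zero[of "x$2"]]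
      unfolding norm_plane power2_abs mult.assoc by linarith
  qed auto
  moreover have "sqrt (\<bar>x$1\<bar> * \<bar>x$2\<bar>) > 0" using False by simp
  ultimately have "1 / norm x \<le> 1 / sqrt (\<bar>x$1\<bar> * \<bar>x$2\<bar>)"
    using False by (intro divide_left_mono mult_pos_pos) auto
  also have "\<dots> = (\<bar>x$1\<bar> powr (-1/2)) * (\<bar>x$2\<bar> powr (-1/2))"
    using False by (simp add: powr_minus powr_half_sqrt real_sqrt_mult divide_simps)
  finally show ?thesis by simp
qed auto


text \<open>An inequality with a pointwise proof: the origin lies in both half-lines and is counted
  twice.\<close>

lemma nn_integral_even:
  fixes f :: "real \<Rightarrow> ennreal"
  assumes [measurable]: "f \<in> borel_measurable borel"
  shows "(\<integral>\<^sup>+x. f \<bar>x\<bar> \<partial>lborel) \<le> 2 * (\<integral>\<^sup>+x. f x * indicator {0..} x \<partial>lborel)"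
proof -
  have "(\<integral>\<^sup>+x. f \<bar>x\<bar> \<partial>lborel) \<le> (\<integral>\<^sup>+x. f x * indicator {0..} x + f (-x) * indicator {0..} (-x) \<partial>lborel)"
    by (rule nn_integral_mono) (auto simp: indicator_def abs_if)
  also have "\<dots> = (\<integral>\<^sup>+x. f x * indicator {0..} x \<partial>lborel) + (\<integral>\<^sup>+x. f (-x) * indicator {0..} (-x) \<partial>lborel)"
    by (rule nn_integral_add) auto
  also have "(\<integral>\<^sup>+x. f (-x) * indicator {0..} (-x) \<partial>lborel) = (\<integral>\<^sup>+x. f x * indicator {0..} x \<partial>lborel)"
    using nn_integral_real_affine[of "\<lambda>x. f x * indicator {0..} x" "-1" 0] by simp
  finally show ?thesis by (simp add: mult_2)
qed

text \<open>With the value \<open>\<infinity>\<close> at \<open>0\<close> the bound of \<open>1 / norm x\<close> by a product also holds on the axes.\<close>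

definition inv_sqrt :: "real \<Rightarrow> real \<Rightarrow> ennreal" where
  "inv_sqrt r s = (if s = 0 then \<infinity> else if \<bar>s\<bar> \<le> r then ennreal (\<bar>s\<bar> powr (-1/2)) else 0)"

lemma inv_sqrt_measurable [measurable]: "inv_sqrt r \<in> borel_measurable borel"
  unfolding inv_sqrt_def by measurable

lemma nn_integral_sing:
  assumes r: "r > 0"
  shows "(\<integral>\<^sup>+s. inv_sqrt r s \<partial>lborel) \<le> ennreal (4 * sqrt r)"
proof -
  have "((\<lambda>x. x powr (-1/2)) has_integral (r powr (-1/2+1) / (-1/2+1))) {0..r}"
    by (rule has_integral_powr_from_0) (use r in auto)
  then have h: "((\<lambda>x. x powr (-1/2)) has_integral (2 * sqrt r)) {0..r}"
    using r by (simp add: powr_half_sqrt mult.commute)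
  have "(\<integral>\<^sup>+s. inv_sqrt r s \<partial>lborel) = (\<integral>\<^sup>+s. inv_sqrt r \<bar>s\<bar> \<partial>lborel)"
    by (rule nn_integral_cong) (simp add: inv_sqrt_def)
  also have "\<dots> \<le> 2 * (\<integral>\<^sup>+x. inv_sqrt r x * indicator {0..} x \<partial>lborel)"
    by (rule nn_integral_even) measurable
  \<comment> \<open>The infinite value at the origin is discarded here as a null set.\<close>
  also have "(\<integral>\<^sup>+x. inv_sqrt r x * indicator {0..} x \<partial>lborel) = (\<integral>\<^sup>+x. ennreal (x powr (-1/2)) * indicator {0..r} x \<partial>lborel)"
    using AE_lborel_singleton[of "0::real"] r
    by (intro nn_integral_cong_AE) (auto simp: inv_sqrt_def indicator_def)
  also have "\<dots> = ennreal (2 * sqrt r)"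
    using nn_integral_has_integral_lebesgue[OF _ h] by (simp add: nn_integral_completion ennreal_mult' ennreal_indicator mult.commute)
  finally show ?thesis
    by (simp add: ennreal_mult'[symmetric] flip: ennreal_numeral)
qed

text \<open>The ball sits inside the square of half-side \<open>r\<close>, on which the majorant is
  a product; each factor integrates to at most 4 sqrt(r). Only the linear growth in \<open>r\<close>
  matters later, not the sharp constant.\<close>

lemma nn_integral_inverse_norm_ball:
  assumes r: "r > 0"
  shows "(\<integral>\<^sup>+x. ennreal (1 / norm x) * indicator (ball 0 r) x \<partial>leb2) \<le> ennreal (16 * r)"
proof -
  have "(\<integral>\<^sup>+x. ennreal (1 / norm x) * indicator (ball 0 r) x \<partial>leb2) \<le> (\<integral>\<^sup>+x. inv_sqrt r (x$1) * inv_sqrt r (x$2) \<partial>leb2)"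
  proof (rule nn_integral_mono)
    fix x :: "real^2"
    show "ennreal (1 / norm x) * indicator (ball 0 r) x \<le> inv_sqrt r (x$1) * inv_sqrt r (x$2)"
    proof (cases "x \<in> ball 0 r")
      case True
      then have n: "\<bar>x$1\<bar> \<le> r" "\<bar>x$2\<bar> \<le> r"
        using component_le_norm_cart[of x 1] component_le_norm_cart[of x 2] by auto
      \<comment> \<open>On an axis one factor is infinite. Since \<infinity> * 0 = 0, the product is
        infinite only because the other factor does not vanish.\<close>
      then have pos: "inv_sqrt r (x$i) \<noteq> 0" for i
        using exhaust_2[of i] by (auto simp: inv_sqrt_def)
      show ?thesis
      proof (cases "x$1 = 0 \<or> x$2 = 0")
        case True
        then have "inv_sqrt r (x$1) * inv_sqrt r (x$2) = \<infinity>"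
          using pos[of 1] pos[of 2] by (auto simp: inv_sqrt_def ennreal_mult_top ennreal_top_mult)
            (auto simp: ennreal_mult_top ennreal_top_mult split: if_splits)
        then show ?thesis by simp
      next
        case False
        then show ?thesis
          using inverse_norm_le[of x] n True
          by (auto simp: inv_sqrt_def ennreal_mult'[symmetric] intro!: ennreal_leI)
      qed
    qed simp
  qed
  also have "\<dots> = (\<integral>\<^sup>+x. inv_sqrt r x \<partial>lborel) * (\<integral>\<^sup>+x. inv_sqrt r x \<partial>lborel)"
    by (rule nn_integral_plane_prod) auto
  also have "\<dots> \<le> ennreal (4 * sqrt r) * ennreal (4 * sqrt r)"
    by (intro mult_mono nn_integral_sing r) auto
  also have "\<dots> = ennreal (16 * r)"
    using r by (simp add: ennreal_mult'[symmetric])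
  finally show ?thesis .
qed

lemma nn_integral_reflect:
  fixes f :: "real^2 \<Rightarrow> ennreal"
  assumes [measurable]: "f \<in> borel_measurable borel" and e: "e > 0"
  shows "(\<integral>\<^sup>+x. f (z - e *\<^sub>R x) \<partial>lborel) = ennreal (1 / e\<^sup>2) * (\<integral>\<^sup>+x. f x \<partial>lborel)"
proof -
  have "(\<integral>\<^sup>+x. f x \<partial>lborel) = ennreal (e\<^sup>2) * (\<integral>\<^sup>+x. f (z - e *\<^sub>R x) \<partial>lborel)"
    using nn_integral_affine[of f "-e" z] e by simp
  then show ?thesis
    using e by (simp add: mult.assoc[symmetric] ennreal_mult'[symmetric])
qed

lemma nn_integral_heat_reflect:
  assumes "b > 0" "e > 0"
  shows "(\<integral>\<^sup>+x. ennreal (heat b (z - e *\<^sub>R x)) \<partial>lborel) = ennreal (1 / e\<^sup>2)"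
  using nn_integral_reflect[of "\<lambda>x. ennreal (heat b x)" e z] assms by (simp add: nn_integral_heat)

text \<open>The plane is cut at distance sqrt(b) from the singularity. Inside, the kernel is at most
  1/(4 pi b) and the singularity contributes 16 sqrt(b); outside, the singularity is at most
  1/sqrt(b) and the kernel has mass 1. The sum 4/pi + 1 is below 3.\<close>

lemma nn_integral_heat_sing:
  assumes b: "b > 0"
  shows "(\<integral>\<^sup>+u. ennreal (heat b u / norm (u - p)) \<partial>lborel) \<le> ennreal (3 / sqrt b)"
proof -
  have [measurable]: "(indicator (ball 0 r) :: real^2 \<Rightarrow> ennreal) \<in> borel_measurable borel" for r
    by (simp add: borel_measurable_indicator)
  have [measurable]: "(\<lambda>u. indicator (ball 0 r) (u - p) :: ennreal) \<in> borel_measurable borel" for r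
    by (rule measurable_compose[of "\<lambda>u. u - p" borel borel]) (measurable, simp_all)
  have "(\<integral>\<^sup>+u. ennreal (heat b u / norm (u - p)) \<partial>lborel) \<le>
     (\<integral>\<^sup>+u. ennreal (1 / (4*pi*b)) * (ennreal (1 / norm (u - p)) * indicator (ball 0 (sqrt b)) (u - p)) + ennreal (1 / sqrt b) * ennreal (heat b u) \<partial>lborel)"
  proof (rule nn_integral_mono)
    fix u
    have hb: "heat b u \<le> 1 / (4*pi*b)" using b by (simp add: heat_def divide_right_mono)
    show "ennreal (heat b u / norm (u - p)) \<le> ennreal (1 / (4*pi*b)) * (ennreal (1 / norm (u - p)) * indicator (ball 0 (sqrt b)) (u - p)) + ennreal (1 / sqrt b) * ennreal (heat b u)"
    proof (cases "u - p \<in> ball 0 (sqrt b)")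
      case True
      have "heat b u / norm (u - p) \<le> 1 / (4*pi*b) * (1 / norm (u - p))"
        using mult_right_mono[OF hb, of "1 / norm (u-p)"] by simp
      then show ?thesis using True b
        by (intro add_increasing2) (auto simp: ennreal_mult'[symmetric] intro!: ennreal_leI)
    next
      case False
      then have "sqrt b \<le> norm (u - p)" by simp
      then have "heat b u / norm (u - p) \<le> heat b u / sqrt b"
        using b heat_nonneg[OF b, of u] by (intro divide_left_mono mult_pos_pos) (auto simp: less_le_trans)
      then show ?thesis using False b
        by (auto simp: ennreal_mult'[symmetric] intro!: ennreal_leI)
    qed
  qed
  also have "\<dots> = ennreal (1 / (4*pi*b)) * (\<integral>\<^sup>+u. ennreal (1 / norm (u - p)) * indicator (ball 0 (sqrt b)) (u - p) \<partial>lborel) + ennreal (1 / sqrt b) * (\<integral>\<^sup>+u. ennreal (heat b u) \<partial>lborel)"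
    by (subst nn_integral_add) (auto simp: nn_integral_cmult)
  also have "(\<integral>\<^sup>+u. ennreal (1 / norm (u - p)) * indicator (ball 0 (sqrt b)) (u - p) \<partial>lborel) = (\<integral>\<^sup>+u. ennreal (1 / norm u) * indicator (ball 0 (sqrt b)) u \<partial>leb2)"
    by (subst (2) nn_integral_affine[of _ 1 "-p"]) (measurable, simp_all)
  also have "ennreal (1 / (4*pi*b)) * \<dots> + ennreal (1 / sqrt b) * (\<integral>\<^sup>+u. ennreal (heat b u) \<partial>lborel) \<le> ennreal (1 / (4*pi*b)) * ennreal (16 * sqrt b) + ennreal (1 / sqrt b) * 1"
    using b by (intro add_mono mult_left_mono nn_integral_inverse_norm_ball) (simp_all add: nn_integral_heat)
  also have "\<dots> = ennreal ((4 / pi + 1) / sqrt b)"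
  proof -
    have "1 / (4*pi*b) * (16 * sqrt b) = 4 / pi * (sqrt b / b)" by simp
    also have "sqrt b / b = 1 / sqrt b" using b real_div_sqrt[of b] by (simp add: field_simps)
    finally have "1 / (4*pi*b) * (16 * sqrt b) + 1 / sqrt b = (4 / pi + 1) / sqrt b"
      by (simp add: add_divide_distrib)
    then show ?thesis
      using b by (simp add: ennreal_mult'[symmetric] ennreal_plus[symmetric] del: ennreal_plus)
  qed
  also have "\<dots> \<le> ennreal (3 / sqrt b)"
    using b pi_gt3 by (intro ennreal_leI divide_right_mono) (auto simp: field_simps)
  finally show ?thesis .
qed

text \<open>The substitution costs 1/e^2, and expressing \<open>norm (x - y)\<close> in the new
  variable gives one factor \<open>e\<close> back.\<close>

lemma nn_integral_heat_sing_reflect: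
  assumes b: "b > 0" and e: "e > 0"
  shows "(\<integral>\<^sup>+x. ennreal (heat b (z - e *\<^sub>R x) / norm (x - y)) \<partial>lborel) \<le> ennreal (3 / (sqrt b * e))"
proof -
  have "(\<integral>\<^sup>+x. ennreal (heat b (z - e *\<^sub>R x) / norm (x - y)) \<partial>lborel)
     = (\<integral>\<^sup>+x. ennreal e * ennreal (heat b (z - e *\<^sub>R x) / norm ((z - e *\<^sub>R x) - (z - e *\<^sub>R y))) \<partial>lborel)"
  proof (rule nn_integral_cong)
    fix x
    have "norm ((z - e *\<^sub>R x) - (z - e *\<^sub>R y)) = norm (e *\<^sub>R (x - y))"
      by (subst norm_minus_commute) (simp add: algebra_simps)
    also have "\<dots> = e * norm (x - y)" using e by simp
    finally show "ennreal (heat b (z - e *\<^sub>R x) / norm (x - y)) = ennreal e * ennreal (heat b (z - e *\<^sub>R x) / norm ((z - e *\<^sub>R x) - (z - e *\<^sub>R y)))"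
      using e by (simp add: ennreal_mult'[symmetric])
  qed
  also have "\<dots> = ennreal e * (ennreal (1 / e\<^sup>2) * (\<integral>\<^sup>+u. ennreal (heat b u / norm (u - (z - e *\<^sub>R y))) \<partial>lborel))"
    by (subst nn_integral_cmult, measurable, subst nn_integral_reflect[of "\<lambda>u. ennreal (heat b u / norm (u - (z - e *\<^sub>R y)))", OF _ e]) (measurable, measurable)
  also have "\<dots> \<le> ennreal e * (ennreal (1 / e\<^sup>2) * ennreal (3 / sqrt b))"
    by (intro mult_left_mono nn_integral_heat_sing b) auto
  also have "\<dots> = ennreal (3 / (sqrt b * e))"
    using e b by (simp add: ennreal_mult'[symmetric] power2_eq_square)
  finally show ?thesis .
qed

section \<open>Integrability of negative powers of the weight\<close>

definition decay_int :: "real \<Rightarrow> ennreal" where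
  "decay_int p = (\<integral>\<^sup>+x. ennreal ((1 + (norm x)\<^sup>2) powr (- p)) \<partial>leb2)"

text \<open>From (1 + a)(1 + b) \<le> (1 + a + b)^2 the integrand is dominated by a product of
  one-dimensional factors of exponent p/2. Their tails behave like x^(-p), so the one-dimensional
  threshold is again p > 1.\<close>

lemma decay_int_finite:
  assumes p: "p > 1"
  shows "decay_int p < \<infinity>"
proof -
  have h: "((\<lambda>x. x powr (-p)) has_integral (-(1 powr (-p+1)) / (-p+1))) {1..}"
    by (rule has_integral_powr_to_inf) (use p in auto)
  define K where "K = (-(1 powr (-p+1)) / (-p+1))"
  define f where "f x = ennreal ((1 + x\<^sup>2) powr (-p/2))" for x :: real
  have [measurable]: "f \<in> borel_measurable borel" unfolding f_def by measurable
  have "(\<integral>\<^sup>+x. f x \<partial>lborel) = (\<integral>\<^sup>+x. f \<bar>x\<bar> \<partial>lborel)"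
    by (rule nn_integral_cong) (simp add: f_def)
  also have "\<dots> \<le> 2 * (\<integral>\<^sup>+x. f x * indicator {0..} x \<partial>lborel)"
    by (rule nn_integral_even) measurable
  finally have 1: "(\<integral>\<^sup>+x. f x \<partial>lborel) \<le> 2 * (\<integral>\<^sup>+x. f x * indicator {0..} x \<partial>lborel)" .
  have "(\<integral>\<^sup>+x. f x * indicator {0..} x \<partial>lborel) \<le> (\<integral>\<^sup>+x. indicator {0..1} x + ennreal (x powr (-p)) * indicator {1..} x \<partial>lborel)"
  proof (rule nn_integral_mono)
    fix x :: real
    show "f x * indicator {0..} x \<le> indicator {0..1} x + ennreal (x powr (-p)) * indicator {1..} x"
    proof (cases "x \<ge> 0")
      case x: True
      show ?thesis
      proof (cases "x \<le> 1")
        case True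
        have "(1 + x\<^sup>2) powr (-p/2) \<le> 1 powr (-p/2)"
          by (rule powr_mono2') (use p in auto)
        then have "f x \<le> 1" by (simp add: f_def)
        then show ?thesis using x True by (intro add_increasing2) (auto simp: indicator_def)
      next
        case False
        have "(1 + x\<^sup>2) powr (-p/2) \<le> (x\<^sup>2) powr (-p/2)"
          by (rule powr_mono2') (use p False in auto)
        also have "(x\<^sup>2) powr (-p/2) = x powr (-p)"
          using False powr_powr[of x 2 "-p/2"] by simp
        finally show ?thesis using False x by (auto simp: f_def intro: ennreal_leI)
      qed
    qed simp
  qed
  also have "\<dots> = 1 + (\<integral>\<^sup>+x. ennreal (x powr (-p)) * indicator {1..} x \<partial>lborel)"
    by (subst nn_integral_add) auto
  also have "(\<integral>\<^sup>+x. ennreal (x powr (-p)) * indicator {1..} x \<partial>lborel) = ennreal K"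
    using nn_integral_has_integral_lebesgue[OF _ h] by (simp add: nn_integral_completion K_def ennreal_mult' ennreal_indicator mult.commute)
  finally have 2: "(\<integral>\<^sup>+x. f x * indicator {0..} x \<partial>lborel) \<le> 1 + ennreal K" .
  have "(\<integral>\<^sup>+x. f x \<partial>lborel) \<le> 2 * (1 + ennreal K)"
    by (rule order_trans[OF 1 mult_left_mono[OF 2]]) simp
  also have "\<dots> < \<infinity>" by (simp add: ennreal_mult_less_top)
  finally have fin: "(\<integral>\<^sup>+x. f x \<partial>lborel) < \<infinity>" .
  have "decay_int p \<le> (\<integral>\<^sup>+x. f (x$1) * f (x$2) \<partial>leb2)"
    unfolding decay_int_def
  proof (rule nn_integral_mono)
    fix x :: "real^2"
    have "(1 + a) * (1 + b) \<le> (1 + (a + b))\<^sup>2" if "a \<ge> 0" "b \<ge> 0" for a b :: real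
      using that by (simp add: power2_eq_square algebra_simps)
    from this[of "(x$1)\<^sup>2" "(x$2)\<^sup>2"] have "(1 + (x$1)\<^sup>2) * (1 + (x$2)\<^sup>2) \<le> (1 + (norm x)\<^sup>2)\<^sup>2"
      by (simp add: norm_plane)
    then have "((1 + (norm x)\<^sup>2)\<^sup>2) powr (-p/2) \<le> ((1 + (x$1)\<^sup>2) * (1 + (x$2)\<^sup>2)) powr (-p/2)"
      by (intro powr_mono2') (use p in \<open>auto intro!: mult_pos_pos simp: add_pos_nonneg\<close>)
    moreover have "((1 + (norm x)\<^sup>2)\<^sup>2) powr (-p/2) = (1 + (norm x)\<^sup>2) powr (-p)"
      using powr_powr[of "1 + (norm x)\<^sup>2" 2 "-p/2"] by (simp add: add_pos_nonneg)
    ultimately show "ennreal ((1 + (norm x)\<^sup>2) powr - p) \<le> f (x$1) * f (x$2)"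
      by (auto simp: f_def ennreal_mult'[symmetric] powr_mult intro!: ennreal_leI)
  qed
  also have "\<dots> = (\<integral>\<^sup>+x. f x \<partial>lborel) * (\<integral>\<^sup>+x. f x \<partial>lborel)"
    by (rule nn_integral_plane_prod) auto
  also have "\<dots> < \<infinity>" using fin by (simp add: ennreal_mult_less_top)
  finally show ?thesis .
qed

section \<open>Weighted bounds for the heat kernel and the Riesz potential\<close>

lemma nn_integral_swap:
  fixes f :: "'a::euclidean_space \<Rightarrow> 'b::euclidean_space \<Rightarrow> ennreal"
  assumes [measurable]: "(\<lambda>(x, y). f x y) \<in> borel_measurable (borel \<Otimes>\<^sub>M borel)"
  shows "(\<integral>\<^sup>+x. \<integral>\<^sup>+y. f x y \<partial>lborel \<partial>lborel) = (\<integral>\<^sup>+y. \<integral>\<^sup>+x. f x y \<partial>lborel \<partial>lborel)"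
proof -
  have "pair_sigma_finite (lborel :: 'a measure) (lborel :: 'b measure)"
    by (intro pair_sigma_finite.intro sigma_finite_lborel)
  then show ?thesis
    by (rule pair_sigma_finite.Fubini'[symmetric]) measurable
qed

text \<open>The ordinary inequality for the measure with density \<open>k\<close>. The density will
  be a heat kernel, a singular kernel, the polynomial weight or a weight in time.\<close>

lemma Cauchy_Schwarz_weighted:
  assumes [measurable]: "k \<in> borel_measurable M" "f \<in> borel_measurable M" "g \<in> borel_measurable M"
  shows "(\<integral>\<^sup>+x. k x * (f x * g x) \<partial>M)\<^sup>2 \<le> (\<integral>\<^sup>+x. k x * (f x)\<^sup>2 \<partial>M) * (\<integral>\<^sup>+x. k x * (g x)\<^sup>2 \<partial>M)"
  using Cauchy_Schwarz_nn_integral[of f "density M k" g] by (simp add: nn_integral_density)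

lemma ennreal_add_square_le: "(a + b)\<^sup>2 \<le> 2 * a\<^sup>2 + 2 * (b::ennreal)\<^sup>2"
proof (cases "a = \<infinity> \<or> b = \<infinity>")
  case False
  then obtain x y where "a = ennreal x" "b = ennreal y" "x \<ge> 0" "y \<ge> 0"
    by (metis ennreal_cases infinity_ennreal_def)
  moreover have "(x + y)\<^sup>2 \<le> 2 * x\<^sup>2 + 2 * y\<^sup>2"
    using sum_squares_bound[of x y] by (simp add: power2_sum)
  ultimately show ?thesis
    by (auto simp: ennreal_power ennreal_mult[symmetric] ennreal_plus[symmetric] simp del: ennreal_plus
        simp flip: ennreal_numeral intro!: ennreal_leI)
qed (auto simp: ennreal_mult_top ennreal_top_mult power2_eq_square)

section \<open>The polynomial weight against Gaussian kernels\<close>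

definition wt :: "real^2 \<Rightarrow> real" where
  "wt x = (1 + (norm x)\<^sup>2) ^ 3"

lemma wt_measurable [measurable]: "wt \<in> borel_measurable borel"
  unfolding wt_def by measurable

lemma wt_ge_1: "wt x \<ge> 1"
  by (simp add: wt_def one_le_power)

lemma wt_nonneg: "wt x \<ge> 0"
  using wt_ge_1[of x] by linarith

text \<open>Peetre's inequality 1 + |x + y|^2 \<le> 2 (1 + |x|^2)(1 + |y|^2), cubed.\<close>

lemma wt_add: "wt (x + y) \<le> 8 * (wt x * wt y)"
proof -
  have "(norm (x + y))\<^sup>2 \<le> (norm x + norm y)\<^sup>2"
    by (intro power_mono norm_triangle_ineq) auto
  also have "\<dots> \<le> 2 * (norm x)\<^sup>2 + 2 * (norm y)\<^sup>2"
    using sum_squares_bound[of "norm x" "norm y"] by (simp add: power2_sum)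
  finally have n: "(norm (x + y))\<^sup>2 \<le> 2 * (norm x)\<^sup>2 + 2 * (norm y)\<^sup>2" .
  have "2 * ((1 + (norm x)\<^sup>2) * (1 + (norm y)\<^sup>2)) = 2 + 2 * (norm x)\<^sup>2 + 2 * (norm y)\<^sup>2 + 2 * ((norm x)\<^sup>2 * (norm y)\<^sup>2)"
    by (simp add: algebra_simps)
  moreover have "0 \<le> (norm x)\<^sup>2 * (norm y)\<^sup>2" by simp
  ultimately have "1 + (norm (x + y))\<^sup>2 \<le> 2 * ((1 + (norm x)\<^sup>2) * (1 + (norm y)\<^sup>2))"
    using n by linarith
  then have "wt (x + y) \<le> (2 * ((1 + (norm x)\<^sup>2) * (1 + (norm y)\<^sup>2))) ^ 3"
    unfolding wt_def by (intro power_mono) auto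
  also have "\<dots> = 8 * (wt x * wt y)"
    by (simp add: wt_def power_mult_distrib)
  finally show ?thesis .
qed

text \<open>The factor 8 of \<open>wt_add\<close> times the factor 2 * 48^3 of
  \<open>heat_wt_le\<close>.\<close>

definition Cwt :: real where "Cwt = 16 * 48 ^ 3"

lemma Cwt_pos: "Cwt > 0" by (simp add: Cwt_def)

text \<open>The cube of 1 + s \<le> 48 exp(s/48). The rate 1/16 is dictated by
  \<open>heat_wt_le\<close>, where half of the Gaussian exponent at \<open>b = 2\<close> is
  available.\<close>

lemma cube_le_exp:
  fixes s :: real
  assumes "s \<ge> 0"
  shows "(1 + s) ^ 3 \<le> 48 ^ 3 * exp (s / 16)"
proof -
  have "(1 + s) ^ 3 \<le> (48 * exp (s / 48)) ^ 3"
  proof (rule power_mono)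
    show "1 + s \<le> 48 * exp (s / 48)"
      using assms exp_ge_add_one_self[of "s/48"] by linarith
  qed (use assms in auto)
  also have "\<dots> = 48 ^ 3 * exp (s / 16)"
    by (simp add: power_mult_distrib exp_of_nat_mult[symmetric])
  finally show ?thesis .
qed

text \<open>Half of the Gaussian exponent pays for the weight, so the variance doubles; the factor 2
  is the change of normalisation. The range up to 2 is needed because gradient bounds replace a time
  at most 1 by its double.\<close>

lemma heat_wt_le:
  assumes b: "0 < b" "b \<le> 2"
  shows "heat b x * wt x \<le> 2 * 48 ^ 3 * heat (2 * b) x"
proof -
  define s where "s = (norm x)\<^sup>2"
  have s: "s \<ge> 0" by (simp add: s_def)
  have "heat b x * wt x \<le> heat b x * (48 ^ 3 * exp (s / 16))"
    unfolding wt_def s_def[symmetric] using cube_le_exp[OF s] heat_nonneg[OF b(1)] by (intro mult_left_mono) auto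
  also have "\<dots> = 48 ^ 3 / (4 * pi * b) * (exp (- s / (4 * b)) * exp (s / 16))"
    by (simp add: heat_def s_def)
  also have "\<dots> \<le> 48 ^ 3 / (4 * pi * b) * exp (- s / (8 * b))"
  proof (rule mult_left_mono)
    have "s / 16 \<le> s / (8 * b)" using b s by (intro divide_left_mono) auto
    then show "exp (- s / (4 * b)) * exp (s / 16) \<le> exp (- s / (8 * b))"
      by (simp add: exp_add[symmetric] field_simps)
  qed (use b in auto)
  also have "48 ^ 3 / (4 * pi * b) * exp (- s / (8 * b)) = 2 * 48 ^ 3 * heat (2 * b) x"
    by (simp add: heat_def s_def)
  finally show ?thesis .
qed

text \<open>The weight passes from the integration variable to the centre of the kernel. After
  Tonelli this is how the weight of the output lands on the data.\<close>

lemma nn_integral_heat_wt: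
  assumes b: "0 < b" "b \<le> 2"
  shows "(\<integral>\<^sup>+x. ennreal (wt x) * ennreal (heat b (x - z)) \<partial>lborel) \<le> ennreal (Cwt * wt z)"
proof -
  have "(\<integral>\<^sup>+x. ennreal (wt x) * ennreal (heat b (x - z)) \<partial>lborel) \<le> (\<integral>\<^sup>+x. ennreal (Cwt * wt z) * ennreal (heat (2 * b) (x - z)) \<partial>lborel)"
  proof (rule nn_integral_mono)
    fix x
    have "wt x * heat b (x - z) \<le> (8 * (wt (x - z) * wt z)) * heat b (x - z)"
      using wt_add[of "x - z" z] heat_nonneg[OF b(1)] by (intro mult_right_mono) auto
    also have "\<dots> = 8 * wt z * (heat b (x - z) * wt (x - z))" by simp
    also have "\<dots> \<le> 8 * wt z * (2 * 48 ^ 3 * heat (2 * b) (x - z))"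
      using heat_wt_le[OF b] wt_nonneg[of z] by (intro mult_left_mono) auto
    also have "\<dots> = Cwt * wt z * heat (2 * b) (x - z)" by (simp add: Cwt_def)
    finally show "ennreal (wt x) * ennreal (heat b (x - z)) \<le> ennreal (Cwt * wt z) * ennreal (heat (2 * b) (x - z))"
      using b wt_nonneg[of x] wt_nonneg[of z] Cwt_pos by (auto simp: ennreal_mult'[symmetric] intro!: ennreal_leI)
  qed
  also have "\<dots> = ennreal (Cwt * wt z) * (\<integral>\<^sup>+x. ennreal (heat (2 * b) (x - z)) \<partial>lborel)"
    by (rule nn_integral_cmult) measurable
  also have "(\<integral>\<^sup>+x. ennreal (heat (2 * b) (x - z)) \<partial>lborel) = (\<integral>\<^sup>+x. ennreal (heat (2 * b) x) \<partial>lborel)"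
    using nn_integral_affine[of "\<lambda>x. ennreal (heat (2*b) x)" 1 "-z"] by simp
  finally show ?thesis using b by (simp add: nn_integral_heat)
qed

text \<open>The gradient of \<open>heat a\<close> in closed form; that it is the derivative is
  contained in the Taylor bound of \<open>heat_taylor\<close>.\<close>

definition grad :: "real \<Rightarrow> real^2 \<Rightarrow> real^2" where
  "grad a x = (- heat a x / (2 * a)) *\<^sub>R x"

lemma grad_measurable [measurable]: "grad a \<in> borel_measurable borel"
  unfolding grad_def by measurable

text \<open>In the scaled length y = |x|/sqrt(a) the extra factor \<open>y\<close> is absorbed by
  half of the Gaussian exponent through y \<le> 8 exp(y^2/8). What remains is the loss 1/sqrt(a) and
  the doubled time.\<close>

lemma norm_grad_le:
  assumes a: "a > 0"
  shows "norm (grad a x) \<le> 8 / sqrt a * heat (2 * a) x"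
proof -
  define y where "y = norm x / sqrt a"
  have y: "y \<ge> 0" "(norm x)\<^sup>2 = a * y\<^sup>2" "norm x = sqrt a * y" using a by (auto simp: y_def power_divide)
  have "(y - 1/2)\<^sup>2 = y\<^sup>2 - y + 1/4" by (simp add: power2_eq_square algebra_simps)
  then have "y \<le> 1 + y\<^sup>2" using zero_le_power2[of "y - 1/2"] by linarith
  also have "\<dots> \<le> 8 * (1 + y\<^sup>2 / 8)" by simp
  also have "\<dots> \<le> 8 * exp (y\<^sup>2 / 8)" using exp_ge_add_one_self[of "y\<^sup>2 / 8"] by (intro mult_left_mono) auto
  finally have 1: "y \<le> 8 * exp (y\<^sup>2 / 8)" .
  have "norm (grad a x) = heat a x * norm x / (2 * a)"
    using a heat_nonneg[OF a, of x] by (simp add: grad_def abs_mult)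
  also have "\<dots> = exp (- y\<^sup>2 / 4) / (4 * pi * a) * (y * (sqrt a / (2 * a)))"
    using a unfolding heat_def y(2) by (simp add: y(3))
  also have "sqrt a / (2 * a) = 1 / (2 * sqrt a)"
    using a real_div_sqrt[of a] by (simp add: field_simps)
  also have "exp (- y\<^sup>2 / 4) / (4 * pi * a) * (y * (1 / (2 * sqrt a))) \<le> exp (- y\<^sup>2 / 4) / (4 * pi * a) * (8 * exp (y\<^sup>2 / 8) * (1 / (2 * sqrt a)))"
    using a 1 by (intro mult_left_mono mult_right_mono) auto
  also have "\<dots> = 4 / sqrt a * (exp (- y\<^sup>2 / 4) * exp (y\<^sup>2 / 8)) / (4 * pi * a)" by simp
  also have "exp (- y\<^sup>2 / 4) * exp (y\<^sup>2 / 8) = exp (- y\<^sup>2 / 8)"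
    by (simp add: exp_add[symmetric])
  also have "4 / sqrt a * exp (- y\<^sup>2 / 8) / (4 * pi * a) = 8 / sqrt a * heat (2 * a) x"
    using a unfolding heat_def y(2) by simp
  finally show ?thesis .
qed

text \<open>The square of the weighted norm, for extended-valued functions, so that it applies to
  integral majorants whose finiteness is still open.\<close>

definition wint :: "(real^2 \<Rightarrow> ennreal) \<Rightarrow> ennreal" where
  "wint f = (\<integral>\<^sup>+x. ennreal (wt x) * (f x)\<^sup>2 \<partial>lborel)"

lemma wint_mono_AE: "AE x in lborel. f x \<le> g x \<Longrightarrow> wint f \<le> wint g"
  unfolding wint_def by (intro nn_integral_mono_AE) (auto intro!: mult_left_mono power_mono)

lemma wint_mono: "(\<And>x. f x \<le> g x) \<Longrightarrow> wint f \<le> wint g"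
  by (rule wint_mono_AE) auto

lemma wint_add:
  assumes [measurable]: "f \<in> borel_measurable borel" "g \<in> borel_measurable borel"
  shows "wint (\<lambda>x. f x + g x) \<le> 2 * wint f + 2 * wint g"
proof -
  have "wint (\<lambda>x. f x + g x) \<le> (\<integral>\<^sup>+x. 2 * (ennreal (wt x) * (f x)\<^sup>2) + 2 * (ennreal (wt x) * (g x)\<^sup>2) \<partial>lborel)"
    unfolding wint_def
  proof (rule nn_integral_mono)
    fix x
    have "ennreal (wt x) * (f x + g x)\<^sup>2 \<le> ennreal (wt x) * (2 * (f x)\<^sup>2 + 2 * (g x)\<^sup>2)"
      by (intro mult_left_mono ennreal_add_square_le) auto
    then show "ennreal (wt x) * (f x + g x)\<^sup>2 \<le> 2 * (ennreal (wt x) * (f x)\<^sup>2) + 2 * (ennreal (wt x) * (g x)\<^sup>2)"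
      by (simp add: algebra_simps)
  qed
  also have "\<dots> = 2 * wint f + 2 * wint g"
    unfolding wint_def by (subst nn_integral_add) (auto simp: nn_integral_cmult)
  finally show ?thesis .
qed

lemma wint_cmult:
  assumes [measurable]: "f \<in> borel_measurable borel"
  shows "wint (\<lambda>x. c * f x) = c\<^sup>2 * wint f"
  unfolding wint_def by (subst nn_integral_cmult[symmetric]) (auto simp: power_mult_distrib ac_simps)

section \<open>The Riesz potential dominating the velocity\<close>

definition Criesz :: ennreal where "Criesz = 16 + decay_int 2"

lemma Criesz_finite: "Criesz < \<infinity>"
  using decay_int_finite[of 2] by (simp add: Criesz_def)

definition w2 :: "real^2 \<Rightarrow> real" where "w2 x = 1 / (1 + (norm x)\<^sup>2)\<^sup>2"

lemma w2_measurable [measurable]: "w2 \<in> borel_measurable borel"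
  unfolding w2_def by measurable

lemma w2_pos: "w2 x > 0" and w2_le_1: "w2 x \<le> 1" and w2_nonneg: "w2 x \<ge> 0"
proof -
  have "(1 + (norm x)\<^sup>2)\<^sup>2 \<ge> 1" by (rule one_le_power) simp
  moreover from this have "(1 + (norm x)\<^sup>2)\<^sup>2 > 0" by linarith
  ultimately show "w2 x > 0" "w2 x \<le> 1" "w2 x \<ge> 0" by (simp_all only: w2_def divide_le_eq_1_pos zero_less_divide_1_iff zero_le_divide_1_iff less_imp_le)
qed

lemma nn_integral_w2: "(\<integral>\<^sup>+x. ennreal (w2 x) \<partial>lborel) = decay_int 2"
  unfolding decay_int_def w2_def
  by (intro nn_integral_cong) (simp add: powr_minus add_pos_nonneg divide_inverse)

text \<open>On the unit disc around the singularity \<open>w2\<close> is at most 1 and the disc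
  integral is at most 16; outside, the kernel is at most 1. These are the two summands of
  \<open>Criesz\<close>.\<close>

lemma nn_integral_w2_sing: "(\<integral>\<^sup>+y. ennreal (w2 y / norm (y - x)) \<partial>lborel) \<le> Criesz"
proof -
  have [measurable]: "(indicator (ball 0 r) :: real^2 \<Rightarrow> ennreal) \<in> borel_measurable borel" for r
    by (simp add: borel_measurable_indicator)
  have [measurable]: "(\<lambda>u. indicator (ball 0 r) (u - p) :: ennreal) \<in> borel_measurable borel" for r and p :: "real^2"
    by (rule measurable_compose[of "\<lambda>u. u - p" borel borel]) (measurable, simp)
  have "(\<integral>\<^sup>+y. ennreal (w2 y / norm (y - x)) \<partial>lborel) \<le> (\<integral>\<^sup>+y. ennreal (1 / norm (y - x)) * indicator (ball 0 1) (y - x) + ennreal (w2 y) \<partial>lborel)"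
  proof (rule nn_integral_mono)
    fix y
    show "ennreal (w2 y / norm (y - x)) \<le> ennreal (1 / norm (y - x)) * indicator (ball 0 1) (y - x) + ennreal (w2 y)"
    proof (cases "y - x \<in> ball 0 1")
      case True
      have "w2 y / norm (y - x) \<le> 1 / norm (y - x)"
        using w2_le_1[of y] by (intro divide_right_mono) auto
      then show ?thesis using True by (intro add_increasing2) (auto intro!: ennreal_leI)
    next
      case False
      then have "w2 y / norm (y - x) \<le> w2 y / 1"
        using w2_nonneg[of y] by (intro divide_left_mono) auto
      then show ?thesis using False by (auto intro!: ennreal_leI)
    qed
  qed
  also have "\<dots> = (\<integral>\<^sup>+y. ennreal (1 / norm (y - x)) * indicator (ball 0 1) (y - x) \<partial>lborel) + decay_int 2"
    by (subst nn_integral_add) (auto simp: nn_integral_w2)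
  also have "(\<integral>\<^sup>+y. ennreal (1 / norm (y - x)) * indicator (ball 0 1) (y - x) \<partial>lborel) = (\<integral>\<^sup>+u. ennreal (1 / norm u) * indicator (ball 0 1) u \<partial>leb2)"
    by (subst (2) nn_integral_affine[of _ 1 "-x"]) (measurable, simp_all)
  also have "\<dots> + decay_int 2 \<le> Criesz"
    using nn_integral_inverse_norm_ball[of 1] unfolding Criesz_def by (intro add_mono) auto
  finally show ?thesis .
qed

text \<open>The kernel is the length of the Biot-Savart kernel without 1/(2 pi). As an extended
  nonnegative integral it exists at every point.\<close>

definition riesz :: "(real^2 \<Rightarrow> real) \<Rightarrow> real^2 \<Rightarrow> ennreal" where
  "riesz f x = (\<integral>\<^sup>+y. ennreal (\<bar>f y\<bar> / norm (x - y)) \<partial>lborel)"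

lemma riesz_measurable [measurable]:
  assumes [measurable]: "f \<in> borel_measurable borel"
  shows "riesz f \<in> borel_measurable borel"
  unfolding riesz_def by measurable

abbreviation W :: "(real^2 \<Rightarrow> real) \<Rightarrow> ennreal" where "W f \<equiv> wint (\<lambda>x. ennreal \<bar>f x\<bar>)"

text \<open>The singular kernel itself is the Cauchy-Schwarz weight: putting it entirely into one
  factor would produce 1/|x - y|^2, which is not locally integrable in the plane. The density is
  split as \<open>f\<close> times 1 + |y|^2 and its reciprocal, the square of the latter being
  \<open>w2\<close>.\<close>

lemma riesz_square_le:
  assumes [measurable]: "f \<in> borel_measurable borel"
  shows "(riesz f x)\<^sup>2 \<le> Criesz * (\<integral>\<^sup>+y. ennreal ((f y)\<^sup>2 * wt y / norm (x - y)) \<partial>lborel)"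
proof -
  define m where "m y = 1 + (norm y)\<^sup>2" for y :: "real^2"
  have m: "m y \<ge> 1" for y by (simp add: m_def)
  have [measurable]: "m \<in> borel_measurable borel" unfolding m_def by measurable
  have "riesz f x = (\<integral>\<^sup>+y. ennreal (1 / norm (x - y)) * (ennreal (\<bar>f y\<bar> * m y) * ennreal (1 / m y)) \<partial>lborel)"
    unfolding riesz_def
  proof (rule nn_integral_cong)
    fix y show "ennreal (\<bar>f y\<bar> / norm (x - y)) = ennreal (1 / norm (x - y)) * (ennreal (\<bar>f y\<bar> * m y) * ennreal (1 / m y))"
      using m[of y] by (auto simp: ennreal_mult'[symmetric])
  qed
  then have "(riesz f x)\<^sup>2 \<le> (\<integral>\<^sup>+y. ennreal (1 / norm (x - y)) * (ennreal (\<bar>f y\<bar> * m y))\<^sup>2 \<partial>lborel) * (\<integral>\<^sup>+y. ennreal (1 / norm (x - y)) * (ennreal (1 / m y))\<^sup>2 \<partial>lborel)"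
    by (simp only:) (rule Cauchy_Schwarz_weighted, measurable)
  also have "\<dots> \<le> (\<integral>\<^sup>+y. ennreal ((f y)\<^sup>2 * wt y / norm (x - y)) \<partial>lborel) * Criesz"
  proof (intro mult_mono)
    show "(\<integral>\<^sup>+y. ennreal (1 / norm (x - y)) * (ennreal (\<bar>f y\<bar> * m y))\<^sup>2 \<partial>lborel) \<le> (\<integral>\<^sup>+y. ennreal ((f y)\<^sup>2 * wt y / norm (x - y)) \<partial>lborel)"
    proof (rule nn_integral_mono)
      fix y
      have "(m y)\<^sup>2 \<le> wt y" unfolding wt_def m_def[symmetric] using m[of y] by (intro power_increasing) auto
      then have "1 / norm (x - y) * ((f y)\<^sup>2 * (m y)\<^sup>2) \<le> 1 / norm (x - y) * ((f y)\<^sup>2 * wt y)"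
        by (intro mult_left_mono) auto
      then show "ennreal (1 / norm (x - y)) * (ennreal (\<bar>f y\<bar> * m y))\<^sup>2 \<le> ennreal ((f y)\<^sup>2 * wt y / norm (x - y))"
        using m[of y] by (auto simp: ennreal_power ennreal_mult'[symmetric] power_mult_distrib intro!: ennreal_leI)
    qed
    have "(\<integral>\<^sup>+y. ennreal (1 / norm (x - y)) * (ennreal (1 / m y))\<^sup>2 \<partial>lborel) = (\<integral>\<^sup>+y. ennreal (w2 y / norm (y - x)) \<partial>lborel)"
    proof (rule nn_integral_cong)
      fix y show "ennreal (1 / norm (x - y)) * (ennreal (1 / m y))\<^sup>2 = ennreal (w2 y / norm (y - x))"
        using m[of y] by (simp add: ennreal_power ennreal_mult'[symmetric] w2_def m_def power_divide norm_minus_commute)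
    qed
    then show "(\<integral>\<^sup>+y. ennreal (1 / norm (x - y)) * (ennreal (1 / m y))\<^sup>2 \<partial>lborel) \<le> Criesz"
      using nn_integral_w2_sing by simp
  qed auto
  finally show ?thesis by (simp add: mult.commute)
qed

text \<open>After \<open>riesz_square_le\<close>, Tonelli integrates the singularity against
  \<open>K\<close> first, so all that is asked of \<open>K\<close> is a potential bounded uniformly
  in \<open>y\<close>. The instances are \<open>w2\<close> and the heat kernels.\<close>

lemma nn_integral_riesz_square:
  assumes [measurable]: "f \<in> borel_measurable borel" "K \<in> borel_measurable borel"
    and c: "\<And>y. (\<integral>\<^sup>+x. ennreal (K x / norm (x - y)) \<partial>lborel) \<le> c" and K: "\<And>x. K x \<ge> 0"
  shows "(\<integral>\<^sup>+x. ennreal (K x) * (riesz f x)\<^sup>2 \<partial>lborel) \<le> Criesz * c * W f"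
proof -
  have "(\<integral>\<^sup>+x. ennreal (K x) * (riesz f x)\<^sup>2 \<partial>lborel) \<le> (\<integral>\<^sup>+x. Criesz * (\<integral>\<^sup>+y. ennreal (K x) * ennreal ((f y)\<^sup>2 * wt y / norm (x - y)) \<partial>lborel) \<partial>lborel)"
  proof (rule nn_integral_mono)
    fix x
    have "ennreal (K x) * (riesz f x)\<^sup>2 \<le> ennreal (K x) * (Criesz * (\<integral>\<^sup>+y. ennreal ((f y)\<^sup>2 * wt y / norm (x - y)) \<partial>lborel))"
      by (intro mult_left_mono riesz_square_le) auto
    then show "ennreal (K x) * (riesz f x)\<^sup>2 \<le> Criesz * (\<integral>\<^sup>+y. ennreal (K x) * ennreal ((f y)\<^sup>2 * wt y / norm (x - y)) \<partial>lborel)"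
      by (simp add: nn_integral_cmult ac_simps)
  qed
  also have "\<dots> = Criesz * (\<integral>\<^sup>+x. \<integral>\<^sup>+y. ennreal (K x) * ennreal ((f y)\<^sup>2 * wt y / norm (x - y)) \<partial>lborel \<partial>lborel)"
    by (rule nn_integral_cmult) measurable
  also have "(\<integral>\<^sup>+x. \<integral>\<^sup>+y. ennreal (K x) * ennreal ((f y)\<^sup>2 * wt y / norm (x - y)) \<partial>lborel \<partial>lborel)
     = (\<integral>\<^sup>+y. \<integral>\<^sup>+x. ennreal (K x) * ennreal ((f y)\<^sup>2 * wt y / norm (x - y)) \<partial>lborel \<partial>lborel)"
    by (rule nn_integral_swap) measurable
  also have "\<dots> = (\<integral>\<^sup>+y. ennreal ((f y)\<^sup>2 * wt y) * (\<integral>\<^sup>+x. ennreal (K x / norm (x - y)) \<partial>lborel) \<partial>lborel)"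
  proof (rule nn_integral_cong)
    fix y
    show "(\<integral>\<^sup>+x. ennreal (K x) * ennreal ((f y)\<^sup>2 * wt y / norm (x - y)) \<partial>lborel) = ennreal ((f y)\<^sup>2 * wt y) * (\<integral>\<^sup>+x. ennreal (K x / norm (x - y)) \<partial>lborel)"
      by (subst nn_integral_cmult[symmetric], measurable)
         (auto simp: ennreal_mult'[symmetric] ennreal_mult''[symmetric] K wt_nonneg ac_simps intro!: nn_integral_cong)
  qed
  also have "\<dots> \<le> (\<integral>\<^sup>+y. ennreal ((f y)\<^sup>2 * wt y) * c \<partial>lborel)"
    by (intro nn_integral_mono mult_left_mono c) auto
  also have "\<dots> = c * W f"
    unfolding wint_def by (subst nn_integral_cmult[symmetric]) (auto simp: ennreal_power ennreal_mult'[symmetric] wt_nonneg ac_simps intro!: nn_integral_cong)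
  finally show ?thesis by (simp add: mult_left_mono mult.assoc)
qed


lemma nn_integral_riesz_w2:
  assumes [measurable]: "f \<in> borel_measurable borel"
  shows "(\<integral>\<^sup>+x. ennreal (w2 x) * (riesz f x)\<^sup>2 \<partial>lborel) \<le> Criesz * Criesz * W f"
  by (rule nn_integral_riesz_square) (auto simp: nn_integral_w2_sing w2_nonneg)

text \<open>\<open>w2\<close> is positive everywhere, so finiteness of the weighted integral gives
  finiteness almost everywhere. Additivity of the velocity is available only at such points.\<close>

lemma AE_riesz_finite:
  assumes [measurable]: "f \<in> borel_measurable borel" and f: "W f < \<infinity>"
  shows "AE x in lborel. riesz f x < \<infinity>"
proof -
  have "(\<integral>\<^sup>+x. ennreal (w2 x) * (riesz f x)\<^sup>2 \<partial>lborel) < \<infinity>"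
    using f Criesz_finite by (intro le_less_trans[OF nn_integral_riesz_w2]) (auto simp: ennreal_mult_less_top)
  then have "AE x in lborel. ennreal (w2 x) * (riesz f x)\<^sup>2 \<noteq> \<infinity>"
    by (intro nn_integral_noteq_infinite) auto
  then show ?thesis
  proof eventually_elim
    case (elim x)
    show ?case
    proof (rule ccontr)
      assume "\<not> riesz f x < \<infinity>"
      then have "riesz f x = \<infinity>" by (simp add: less_top[symmetric])
      then show False using elim w2_pos[of x] by (simp add: power2_eq_square ennreal_mult_top ennreal_top_mult)
    qed
  qed
qed

text \<open>With j = sqrt(1 + |x|^2), write j = j^(-2) j^3 and apply Cauchy-Schwarz: the squares are
  \<open>w2\<close> and \<open>wt\<close>. The surplus factor \<open>j\<close> is a first moment of
  the flux, to be spent on the first-order Taylor remainder.\<close>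

lemma nn_integral_riesz_mult:
  assumes [measurable]: "f \<in> borel_measurable borel" "g \<in> borel_measurable borel"
  shows "(\<integral>\<^sup>+x. riesz f x * (ennreal (sqrt (1 + (norm x)\<^sup>2)) * g x) \<partial>lborel)\<^sup>2 \<le> Criesz * Criesz * W f * wint g"
proof -
  define j where "j x = sqrt (1 + (norm x)\<^sup>2)" for x :: "real^2"
  have j: "j x \<ge> 1" for x by (simp add: j_def)
  have j2: "(j x)\<^sup>2 = 1 + (norm x)\<^sup>2" for x by (simp add: j_def add_nonneg_nonneg)
  have [measurable]: "j \<in> borel_measurable borel" unfolding j_def by measurable
  have "(\<integral>\<^sup>+x. riesz f x * (ennreal (j x) * g x) \<partial>lborel) = (\<integral>\<^sup>+x. (ennreal (1 / (j x)\<^sup>2) * riesz f x) * (ennreal (j x ^ 3) * g x) \<partial>lborel)"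
  proof (rule nn_integral_cong)
    fix x
    have "ennreal (j x) = ennreal (1 / (j x)\<^sup>2) * ennreal (j x ^ 3)"
      using j[of x] by (auto simp: ennreal_mult'[symmetric] power2_eq_square power3_eq_cube)
    then show "riesz f x * (ennreal (j x) * g x) = (ennreal (1 / (j x)\<^sup>2) * riesz f x) * (ennreal (j x ^ 3) * g x)"
      by (simp add: ac_simps)
  qed
  then have "(\<integral>\<^sup>+x. riesz f x * (ennreal (j x) * g x) \<partial>lborel)\<^sup>2 \<le> (\<integral>\<^sup>+x. (ennreal (1 / (j x)\<^sup>2) * riesz f x)\<^sup>2 \<partial>lborel) * (\<integral>\<^sup>+x. (ennreal (j x ^ 3) * g x)\<^sup>2 \<partial>lborel)"
    by (simp only:) (rule Cauchy_Schwarz_nn_integral, measurable)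
  also have "(\<integral>\<^sup>+x. (ennreal (1 / (j x)\<^sup>2) * riesz f x)\<^sup>2 \<partial>lborel) = (\<integral>\<^sup>+x. ennreal (w2 x) * (riesz f x)\<^sup>2 \<partial>lborel)"
    by (intro nn_integral_cong) (simp add: j2 power_mult_distrib ennreal_power w2_def power_divide)
  also have "(\<integral>\<^sup>+x. (ennreal (j x ^ 3) * g x)\<^sup>2 \<partial>lborel) = wint g"
  proof -
    have "(j x ^ 3)\<^sup>2 = wt x" for x
      unfolding wt_def j2[symmetric] by (simp flip: power_mult)
    then show ?thesis unfolding wint_def using j
      by (intro nn_integral_cong) (simp add: power_mult_distrib ennreal_power order_trans[OF zero_le_one])
  qed
  also have "(\<integral>\<^sup>+x. ennreal (w2 x) * (riesz f x)\<^sup>2 \<partial>lborel) * wint g \<le> Criesz * Criesz * W f * wint g"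
    by (intro mult_right_mono nn_integral_riesz_w2) auto
  finally show ?thesis unfolding j_def .
qed

text \<open>The weight arrives at the contracted point \<open>e *\<^sub>R y\<close>, not at
  \<open>y\<close>; this contraction is the source of decay from far away.\<close>

lemma wint_kernel_swap:
  assumes [measurable]: "h \<in> borel_measurable borel" and b: "0 < b" "b \<le> 2" and e: "e > 0"
  shows "(\<integral>\<^sup>+\<xi>. ennreal (wt \<xi>) * (\<integral>\<^sup>+y. ennreal (heat b (\<xi> - e *\<^sub>R y)) * h y \<partial>lborel) \<partial>lborel)
    \<le> (\<integral>\<^sup>+y. ennreal (Cwt * wt (e *\<^sub>R y)) * h y \<partial>lborel)"
proof -
  have "(\<integral>\<^sup>+\<xi>. ennreal (wt \<xi>) * (\<integral>\<^sup>+y. ennreal (heat b (\<xi> - e *\<^sub>R y)) * h y \<partial>lborel) \<partial>lborel)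
    = (\<integral>\<^sup>+\<xi>. \<integral>\<^sup>+y. ennreal (wt \<xi>) * (ennreal (heat b (\<xi> - e *\<^sub>R y)) * h y) \<partial>lborel \<partial>lborel)"
    by (simp add: nn_integral_cmult)
  also have "\<dots> = (\<integral>\<^sup>+y. \<integral>\<^sup>+\<xi>. ennreal (wt \<xi>) * (ennreal (heat b (\<xi> - e *\<^sub>R y)) * h y) \<partial>lborel \<partial>lborel)"
    by (rule nn_integral_swap) measurable
  also have "\<dots> = (\<integral>\<^sup>+y. (\<integral>\<^sup>+\<xi>. ennreal (wt \<xi>) * ennreal (heat b (\<xi> - e *\<^sub>R y)) \<partial>lborel) * h y \<partial>lborel)"
    by (simp add: nn_integral_multc mult.assoc[symmetric])
  also have "\<dots> \<le> (\<integral>\<^sup>+y. ennreal (Cwt * wt (e *\<^sub>R y)) * h y \<partial>lborel)"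
    by (intro nn_integral_mono mult_right_mono nn_integral_heat_wt b) auto
  finally show ?thesis .
qed

text \<open>Jensen's inequality in Cauchy-Schwarz form; the mass of the kernel in \<open>y\<close>
  is 1/e^2.\<close>

lemma wint_heat_le:
  assumes [measurable]: "F \<in> borel_measurable borel" and b: "0 < b" "b \<le> 2" and e: "e > 0"
  shows "wint (\<lambda>\<xi>. \<integral>\<^sup>+y. ennreal (heat b (\<xi> - e *\<^sub>R y)) * F y \<partial>lborel)
    \<le> ennreal (1 / e\<^sup>2) * (\<integral>\<^sup>+y. ennreal (Cwt * wt (e *\<^sub>R y)) * (F y)\<^sup>2 \<partial>lborel)"
proof -
  have "wint (\<lambda>\<xi>. \<integral>\<^sup>+y. ennreal (heat b (\<xi> - e *\<^sub>R y)) * F y \<partial>lborel)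
    \<le> (\<integral>\<^sup>+\<xi>. ennreal (1 / e\<^sup>2) * (ennreal (wt \<xi>) * (\<integral>\<^sup>+y. ennreal (heat b (\<xi> - e *\<^sub>R y)) * (F y)\<^sup>2 \<partial>lborel)) \<partial>lborel)"
    unfolding wint_def
  proof (rule nn_integral_mono)
    fix \<xi>
    have "(\<integral>\<^sup>+y. ennreal (heat b (\<xi> - e *\<^sub>R y)) * (1 * F y) \<partial>lborel)\<^sup>2 \<le> (\<integral>\<^sup>+y. ennreal (heat b (\<xi> - e *\<^sub>R y)) * 1\<^sup>2 \<partial>lborel) * (\<integral>\<^sup>+y. ennreal (heat b (\<xi> - e *\<^sub>R y)) * (F y)\<^sup>2 \<partial>lborel)"
      by (rule Cauchy_Schwarz_weighted) measurable
    then have "(\<integral>\<^sup>+y. ennreal (heat b (\<xi> - e *\<^sub>R y)) * F y \<partial>lborel)\<^sup>2 \<le> ennreal (1 / e\<^sup>2) * (\<integral>\<^sup>+y. ennreal (heat b (\<xi> - e *\<^sub>R y)) * (F y)\<^sup>2 \<partial>lborel)"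
      using nn_integral_heat_reflect[OF b(1) e] by simp
    from mult_left_mono[OF this, of "ennreal (wt \<xi>)"]
    show "ennreal (wt \<xi>) * (\<integral>\<^sup>+y. ennreal (heat b (\<xi> - e *\<^sub>R y)) * F y \<partial>lborel)\<^sup>2 \<le> ennreal (1 / e\<^sup>2) * (ennreal (wt \<xi>) * (\<integral>\<^sup>+y. ennreal (heat b (\<xi> - e *\<^sub>R y)) * (F y)\<^sup>2 \<partial>lborel))"
      by (simp add: ac_simps)
  qed
  also have "\<dots> = ennreal (1 / e\<^sup>2) * (\<integral>\<^sup>+\<xi>. ennreal (wt \<xi>) * (\<integral>\<^sup>+y. ennreal (heat b (\<xi> - e *\<^sub>R y)) * (F y)\<^sup>2 \<partial>lborel) \<partial>lborel)"
    by (rule nn_integral_cmult) measurable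
  also have "\<dots> \<le> ennreal (1 / e\<^sup>2) * (\<integral>\<^sup>+y. ennreal (Cwt * wt (e *\<^sub>R y)) * (F y)\<^sup>2 \<partial>lborel)"
    by (intro mult_left_mono wint_kernel_swap b e) auto
  finally show ?thesis .
qed

text \<open>The kernel is shared by both Cauchy-Schwarz factors. The potential is integrated against
  it uniformly in \<xi>, and only the factor with \<open>F\<close> has to carry the weight.\<close>

lemma wint_heat_riesz_le:
  assumes [measurable]: "f \<in> borel_measurable borel" "F \<in> borel_measurable borel" and b: "0 < b" "b \<le> 2" and e: "e > 0"
  shows "wint (\<lambda>\<xi>. \<integral>\<^sup>+y. ennreal (heat b (\<xi> - e *\<^sub>R y)) * (riesz f y * F y) \<partial>lborel)
    \<le> Criesz * ennreal (3 / (sqrt b * e)) * W f * (\<integral>\<^sup>+y. ennreal (Cwt * wt (e *\<^sub>R y)) * (F y)\<^sup>2 \<partial>lborel)"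
proof -
  define A where "A = Criesz * ennreal (3 / (sqrt b * e)) * W f"
  have "wint (\<lambda>\<xi>. \<integral>\<^sup>+y. ennreal (heat b (\<xi> - e *\<^sub>R y)) * (riesz f y * F y) \<partial>lborel)
    \<le> (\<integral>\<^sup>+\<xi>. A * (ennreal (wt \<xi>) * (\<integral>\<^sup>+y. ennreal (heat b (\<xi> - e *\<^sub>R y)) * (F y)\<^sup>2 \<partial>lborel)) \<partial>lborel)"
    unfolding wint_def
  proof (rule nn_integral_mono)
    fix \<xi>
    have "(\<integral>\<^sup>+y. ennreal (heat b (\<xi> - e *\<^sub>R y)) * (riesz f y * F y) \<partial>lborel)\<^sup>2 \<le> (\<integral>\<^sup>+y. ennreal (heat b (\<xi> - e *\<^sub>R y)) * (riesz f y)\<^sup>2 \<partial>lborel) * (\<integral>\<^sup>+y. ennreal (heat b (\<xi> - e *\<^sub>R y)) * (F y)\<^sup>2 \<partial>lborel)"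
      by (rule Cauchy_Schwarz_weighted) measurable
    also have "\<dots> \<le> A * (\<integral>\<^sup>+y. ennreal (heat b (\<xi> - e *\<^sub>R y)) * (F y)\<^sup>2 \<partial>lborel)"
      unfolding A_def
      by (intro mult_right_mono nn_integral_riesz_square nn_integral_heat_sing_reflect b e heat_nonneg) auto
    finally have "(\<integral>\<^sup>+y. ennreal (heat b (\<xi> - e *\<^sub>R y)) * (riesz f y * F y) \<partial>lborel)\<^sup>2 \<le> A * (\<integral>\<^sup>+y. ennreal (heat b (\<xi> - e *\<^sub>R y)) * (F y)\<^sup>2 \<partial>lborel)" .
    from mult_left_mono[OF this, of "ennreal (wt \<xi>)"]
    show "ennreal (wt \<xi>) * (\<integral>\<^sup>+y. ennreal (heat b (\<xi> - e *\<^sub>R y)) * (riesz f y * F y) \<partial>lborel)\<^sup>2 \<le> A * (ennreal (wt \<xi>) * (\<integral>\<^sup>+y. ennreal (heat b (\<xi> - e *\<^sub>R y)) * (F y)\<^sup>2 \<partial>lborel))"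
      by (simp add: ac_simps)
  qed
  also have "\<dots> = A * (\<integral>\<^sup>+\<xi>. ennreal (wt \<xi>) * (\<integral>\<^sup>+y. ennreal (heat b (\<xi> - e *\<^sub>R y)) * (F y)\<^sup>2 \<partial>lborel) \<partial>lborel)"
    by (rule nn_integral_cmult) measurable
  also have "\<dots> \<le> A * (\<integral>\<^sup>+y. ennreal (Cwt * wt (e *\<^sub>R y)) * (F y)\<^sup>2 \<partial>lborel)"
    by (intro mult_left_mono wint_kernel_swap b e) auto
  finally show ?thesis unfolding A_def .
qed

lemma wt_scale_le:
  assumes "0 < e" "e \<le> 1"
  shows "wt (e *\<^sub>R y) \<le> wt y"
proof -
  have "(e * norm y)\<^sup>2 \<le> (norm y)\<^sup>2" using assms by (intro power_mono) (auto simp: mult_left_le_one_le)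
  then show ?thesis using assms unfolding wt_def by (intro power_mono) auto
qed

text \<open>For e|y| \<ge> 1 the summand 1 is at most e^2 |y|^2, so the cube of 2 e^2 |y|^2
  dominates. The weight exponent thus becomes the gain e^6 of the far part.\<close>

lemma wt_scale_far:
  assumes e: "0 < e" "e \<le> 1" and far: "e * norm y \<ge> 1"
  shows "wt (e *\<^sub>R y) \<le> 8 * e ^ 6 * wt y"
proof -
  have "1 \<le> (e * norm y)\<^sup>2" using far by (simp add: one_le_power)
  then have "wt (e *\<^sub>R y) \<le> (2 * (e\<^sup>2 * (norm y)\<^sup>2)) ^ 3"
    unfolding wt_def using e by (intro power_mono) (auto simp: power_mult_distrib)
  also have "\<dots> = 8 * e ^ 6 * ((norm y)\<^sup>2) ^ 3"
    by (simp add: power_mult_distrib flip: power_mult)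
  also have "\<dots> \<le> 8 * e ^ 6 * wt y"
    unfolding wt_def using e by (intro mult_left_mono power_mono) auto
  finally show ?thesis .
qed

lemma nn_integral_wt_scale_le:
  assumes "0 < e" "e \<le> 1" and [measurable]: "F \<in> borel_measurable borel"
  shows "(\<integral>\<^sup>+y. ennreal (Cwt * wt (e *\<^sub>R y)) * (F y)\<^sup>2 \<partial>lborel) \<le> ennreal Cwt * wint F"
proof -
  have "(\<integral>\<^sup>+y. ennreal (Cwt * wt (e *\<^sub>R y)) * (F y)\<^sup>2 \<partial>lborel) \<le> (\<integral>\<^sup>+y. ennreal Cwt * (ennreal (wt y) * (F y)\<^sup>2) \<partial>lborel)"
    using wt_scale_le[OF assms(1,2)] Cwt_pos
    by (intro nn_integral_mono)
       (auto simp: mult.assoc[symmetric] ennreal_mult'[symmetric] intro!: mult_right_mono ennreal_leI mult_left_mono)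
  then show ?thesis unfolding wint_def by (simp add: nn_integral_cmult)
qed

lemma nn_integral_wt_scale_far:
  assumes e: "0 < e" "e \<le> 1" and [measurable]: "F \<in> borel_measurable borel"
    and far: "\<And>y. e * norm y < 1 \<Longrightarrow> F y = 0"
  shows "(\<integral>\<^sup>+y. ennreal (Cwt * wt (e *\<^sub>R y)) * (F y)\<^sup>2 \<partial>lborel) \<le> ennreal (8 * e ^ 6 * Cwt) * wint F"
proof -
  have "(\<integral>\<^sup>+y. ennreal (Cwt * wt (e *\<^sub>R y)) * (F y)\<^sup>2 \<partial>lborel) \<le> (\<integral>\<^sup>+y. ennreal (8 * e ^ 6 * Cwt) * (ennreal (wt y) * (F y)\<^sup>2) \<partial>lborel)"
  proof (rule nn_integral_mono)
    fix y
    show "ennreal (Cwt * wt (e *\<^sub>R y)) * (F y)\<^sup>2 \<le> ennreal (8 * e ^ 6 * Cwt) * (ennreal (wt y) * (F y)\<^sup>2)"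
    proof (cases "e * norm y < 1")
      case False
      then have "Cwt * wt (e *\<^sub>R y) \<le> 8 * e ^ 6 * Cwt * wt y"
        using wt_scale_far[OF e, of y] Cwt_pos mult_left_mono[of _ _ Cwt] by (simp add: ac_simps)
      then show ?thesis using e Cwt_pos
        by (simp add: mult.assoc[symmetric] ennreal_mult'[symmetric] mult_right_mono ennreal_leI)
    qed (simp add: far)
  qed
  then show ?thesis unfolding wint_def by (simp add: nn_integral_cmult)
qed

section \<open>Taylor bounds and the space of weighted square-integrable functions\<close>

text \<open>A common majorant for the kernels with time at most 1, their gradients and their Taylor
  remainders. The exponent is weak enough to absorb a shift of length 1 and polynomial
  factors.\<close>

definition gauss_tail :: "real^2 \<Rightarrow> real" where "gauss_tail x = exp (- (norm x)\<^sup>2 / 16)"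

lemma gauss_tail_measurable [measurable]: "gauss_tail \<in> borel_measurable borel"
  unfolding gauss_tail_def by measurable

lemma gauss_tail_pos: "gauss_tail x > 0" and gauss_tail_nonneg: "gauss_tail x \<ge> 0"
  by (simp_all add: gauss_tail_def)

text \<open>The square is a multiple of \<open>heat 2\<close>, the largest time for which the weight
  can still be absorbed.\<close>

lemma wint_gauss_tail_finite: "W gauss_tail < \<infinity>"
proof -
  have "W gauss_tail \<le> (\<integral>\<^sup>+x. ennreal (8 * pi) * (ennreal (wt x) * ennreal (heat 2 (x - 0))) \<partial>lborel)"
    unfolding wint_def
  proof (rule nn_integral_mono)
    fix x
    have "(gauss_tail x)\<^sup>2 = exp (- (norm x)\<^sup>2 / 8)"
      by (simp add: gauss_tail_def power2_eq_square exp_add[symmetric])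
    then have "(gauss_tail x)\<^sup>2 = 8 * pi * heat 2 x" by (simp add: heat_def)
    then show "ennreal (wt x) * (ennreal \<bar>gauss_tail x\<bar>)\<^sup>2 \<le> ennreal (8 * pi) * (ennreal (wt x) * ennreal (heat 2 (x - 0)))"
      by (simp add: ennreal_power ennreal_mult'[symmetric] wt_nonneg ac_simps heat_nonneg)
  qed
  also have "\<dots> = ennreal (8 * pi) * (\<integral>\<^sup>+x. ennreal (wt x) * ennreal (heat 2 (x - 0)) \<partial>lborel)"
    by (rule nn_integral_cmult) measurable
  also have "\<dots> \<le> ennreal (8 * pi) * ennreal (Cwt * wt 0)"
    by (intro mult_left_mono nn_integral_heat_wt) auto
  also have "\<dots> < \<infinity>" by (simp add: ennreal_mult_less_top)
  finally show ?thesis .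
qed

lemma exp_minus_one_abs_le: "\<bar>exp u - 1\<bar> \<le> \<bar>u\<bar> * exp \<bar>u\<bar>" for u :: real
proof (cases "u \<ge> 0")
  case True
  have "exp u * (1 - u) \<le> exp u * exp (- u)"
    using exp_ge_add_one_self[of "-u"] by (intro mult_left_mono) auto
  then have "exp u * (1 - u) \<le> 1" by (simp add: exp_add[symmetric])
  then show ?thesis using True by (simp add: algebra_simps)
next
  case False
  have "1 - exp u \<le> - u" using exp_ge_add_one_self[of u] by linarith
  also have "\<dots> \<le> (- u) * exp (- u)"
    using False by (simp add: mult_le_cancel_left1)
  finally show ?thesis using False by simp
qed

text \<open>From exp(u)(1 - u) \<le> 1 the remainder is at most u (exp(u) - 1), which reduces the
  claim to the first-order bound.\<close>

lemma exp_second_order_le: "\<bar>exp u - 1 - u\<bar> \<le> u\<^sup>2 * exp \<bar>u\<bar>" for u :: real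
proof -
  have "exp u * (1 - u) \<le> exp u * exp (- u)"
    using exp_ge_add_one_self[of "-u"] by (intro mult_left_mono) auto
  then have "exp u * (1 - u) \<le> 1" by (simp add: exp_add[symmetric])
  then have "exp u - 1 - u \<le> u * (exp u - 1)" by (simp add: algebra_simps)
  also have "\<dots> \<le> \<bar>u\<bar> * \<bar>exp u - 1\<bar>" by (metis abs_ge_self abs_mult)
  also have "\<dots> \<le> \<bar>u\<bar> * (\<bar>u\<bar> * exp \<bar>u\<bar>)" by (intro mult_left_mono exp_minus_one_abs_le) auto
  also have "\<dots> = u\<^sup>2 * exp \<bar>u\<bar>" by (simp add: power2_eq_square mult.assoc[symmetric])
  finally show ?thesis using exp_ge_add_one_self[of u] by linarith
qed

text \<open>Writing heat a (x + h) = heat a x exp(u) turns everything into remainders of the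
  exponential. For |h| \<le> 1 one has |u| \<le> |h| (2|x| + 1)/(4a), so each remainder is a
  polynomial in |x| times a Gaussian. The lower bound \<open>a0\<close> on the time makes the
  constant uniform.\<close>

lemma heat_taylor:
  assumes a0: "a0 > 0"
  obtains C where "C > 0"
    "\<And>a x. a0 \<le> a \<Longrightarrow> a \<le> 1 \<Longrightarrow> heat a x \<le> C * gauss_tail x"
    "\<And>a x. a0 \<le> a \<Longrightarrow> a \<le> 1 \<Longrightarrow> norm (grad a x) \<le> C * gauss_tail x"
    "\<And>a x h. a0 \<le> a \<Longrightarrow> a \<le> 1 \<Longrightarrow> norm h \<le> 1 \<Longrightarrow> \<bar>heat a (x + h) - heat a x - grad a x \<bullet> h\<bar> \<le> C * (norm h)\<^sup>2 * gauss_tail x"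
    "\<And>a x h. a0 \<le> a \<Longrightarrow> a \<le> 1 \<Longrightarrow> norm h \<le> 1 \<Longrightarrow> norm (grad a (x + h) - grad a x) \<le> C * norm h * gauss_tail x"
proof -
  define L where "L = exp (3 / (4 * a0)) / (4 * pi * a0)"
  \<comment> \<open>The three summands serve the second-order remainder, the gradient and its
    increment, and the kernel itself.\<close>
  define C where "C = (128 / (16 * a0\<^sup>2) + 1 / (4 * a0)) * L + (1 / (2 * a0)) * (128 / (4 * a0) + 128) * L + L"
  have L: "L > 0" using a0 by (simp add: L_def)
  have C1: "(128 / (16 * a0\<^sup>2) + 1 / (4 * a0)) * L \<le> C" and C2: "(1 / (2 * a0)) * (128 / (4 * a0) + 128) * L \<le> C" and C3: "L \<le> C"
    and C: "C > 0"
    using a0 L unfolding C_def by (auto intro!: add_nonneg_nonneg mult_nonneg_nonneg add_pos_pos add_nonneg_pos)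
  {
    fix a :: real and x :: "real^2" assume a: "a0 \<le> a" "a \<le> 1"
    define p where "p = norm x"
    have p: "p \<ge> 0" by (simp add: p_def)
    define g where "g = gauss_tail x"
    have g: "g > 0" by (simp add: g_def gauss_tail_pos)
    have a': "a > 0" using a a0 by linarith
    \<comment> \<open>Polynomial factors are bought with half of the exponent: (2p + 1)^2 \<le> 8p^2
      + 2 \<le> 128 (1 + p^2/16).\<close>
    have poly: "(2 * p + 1)\<^sup>2 * exp (- p\<^sup>2 / 8) \<le> 128 * g"
    proof -
      have "(2 * p + 1)\<^sup>2 \<le> 8 * p\<^sup>2 + 2" using zero_le_power2[of "2*p - 1"] by (simp add: power2_sum power2_diff power_mult_distrib)
      also have "\<dots> \<le> 128 * (1 + p\<^sup>2 / 16)" by simp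
      also have "\<dots> \<le> 128 * exp (p\<^sup>2 / 16)" using exp_ge_add_one_self[of "p\<^sup>2/16"] by (intro mult_left_mono) auto
      finally have "(2 * p + 1)\<^sup>2 * exp (- p\<^sup>2 / 8) \<le> 128 * exp (p\<^sup>2 / 16) * exp (- p\<^sup>2 / 8)" by (intro mult_right_mono) auto
      also have "\<dots> = 128 * g" by (simp add: g_def gauss_tail_def p_def exp_add[symmetric])
      finally show ?thesis .
    qed
    have poly1: "1 * exp (- p\<^sup>2 / 8) \<le> g"
      by (simp add: g_def gauss_tail_def p_def)
    have p2: "p \<le> (2 * p + 1)\<^sup>2" "p * (2 * p + 1) \<le> (2 * p + 1)\<^sup>2" using p by (auto simp: power2_eq_square algebra_simps)
    have polyp: "p * exp (- p\<^sup>2 / 8) \<le> 128 * g" "p * (2 * p + 1) * exp (- p\<^sup>2 / 8) \<le> 128 * g"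
      by (rule order_trans[OF mult_right_mono[OF p2(1)] poly], simp) (rule order_trans[OF mult_right_mono[OF p2(2)] poly], simp)
    \<comment> \<open>The linear growth allowed to \<open>v\<close> is absorbed by half of the
      Gaussian exponent, since -p^2 + 2p + 1 \<le> -p^2/2 + 3. The number 3 here is the one in
      \<open>L\<close>.\<close>
    have key: "heat a x * exp v \<le> L * exp (- p\<^sup>2 / 8)" if v: "v \<le> (2 * p + 1) / (4 * a)" for v
    proof -
      have "- p\<^sup>2 / (4 * a) + v \<le> (- p\<^sup>2 + (2 * p + 1)) / (4 * a)" using v by (simp add: add_divide_distrib diff_divide_distrib)
      also have "\<dots> \<le> (- p\<^sup>2 / 2 + 3) / (4 * a)"
        using zero_le_power2[of "p - 2"] a' by (intro divide_right_mono) (auto simp: power2_diff)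
      also have "\<dots> = - p\<^sup>2 / (8 * a) + 3 / (4 * a)" using a' by (simp add: field_simps)
      also have "\<dots> \<le> - p\<^sup>2 / 8 + 3 / (4 * a0)"
      proof (rule add_mono)
        have "p\<^sup>2 / 8 \<le> p\<^sup>2 / (8 * a)" using a a' by (intro divide_left_mono) auto
        then show "- p\<^sup>2 / (8 * a) \<le> - p\<^sup>2 / 8" by simp
        show "3 / (4 * a) \<le> 3 / (4 * a0)" using a a0 a' by (intro divide_left_mono) auto
      qed
      finally have e: "exp (- p\<^sup>2 / (4 * a) + v) \<le> exp (3 / (4 * a0)) * exp (- p\<^sup>2 / 8)"
        by (simp add: exp_add[symmetric])
      have "heat a x * exp v = exp (- p\<^sup>2 / (4 * a) + v) / (4 * pi * a)"
        by (simp add: heat_def p_def mult_exp_exp)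
      also have "\<dots> \<le> (exp (3 / (4 * a0)) * exp (- p\<^sup>2 / 8)) / (4 * pi * a0)"
        using e a a0 by (intro frac_le) auto
      finally show ?thesis by (simp add: L_def)
    qed
    have h0: "heat a x \<le> L * exp (- p\<^sup>2 / 8)" using key[of 0] p a' by simp
    have hp: "heat a x > 0" using a' by (rule heat_pos)
    have "heat a x \<le> L * g" by (rule order_trans[OF h0 mult_left_mono]) (use poly1 L in auto)
    then have 1: "heat a x \<le> C * g" using mult_right_mono[OF C3, of g] g by linarith
    have i2: "1 / (2 * a) \<le> 1 / (2 * a0)" "1 / (4 * a) \<le> 1 / (4 * a0)" using a a0 by (auto intro!: divide_left_mono)
    have "norm (grad a x) = 1 / (2 * a) * (heat a x * p)"
      using a' hp by (simp add: grad_def p_def)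
    also have "\<dots> \<le> 1 / (2 * a0) * (L * exp (- p\<^sup>2 / 8) * p)"
      using i2 h0 hp p a' a0 L by (intro mult_mono) auto
    also have "\<dots> = 1 / (2 * a0) * L * (p * exp (- p\<^sup>2 / 8))" by simp
    also have "\<dots> \<le> 1 / (2 * a0) * L * (128 * g)" using polyp a0 L by (intro mult_left_mono) auto
    also have "\<dots> \<le> (1 / (2 * a0)) * (128 / (4 * a0) + 128) * L * g"
      using a0 L g by (simp add: field_simps)
    also have "\<dots> \<le> C * g" using C2 g by (intro mult_right_mono) auto
    finally have 2: "norm (grad a x) \<le> C * g" .
    have "\<bar>heat a (x + h) - heat a x - grad a x \<bullet> h\<bar> \<le> C * (norm h)\<^sup>2 * g \<and> norm (grad a (x + h) - grad a x) \<le> C * norm h * g"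
      if h: "norm h \<le> 1" for h
    proof -
      define q where "q = norm h"
      have q: "0 \<le> q" "q \<le> 1" using h by (auto simp: q_def)
      define u where "u = - (2 * (x \<bullet> h) + q\<^sup>2) / (4 * a)"
      have hu: "heat a (x + h) = heat a x * exp u"
      proof -
        have "(norm (x + h))\<^sup>2 = p\<^sup>2 + 2 * (x \<bullet> h) + q\<^sup>2"
          by (simp add: p_def q_def power2_norm_eq_inner inner_add inner_commute)
        then have "- (norm (x + h))\<^sup>2 / (4 * a) = - (norm x)\<^sup>2 / (4 * a) + u"
          by (simp add: u_def p_def add_divide_distrib diff_divide_distrib)
        then show ?thesis by (simp add: heat_def mult_exp_exp)
      qed
      have xh: "\<bar>x \<bullet> h\<bar> \<le> p * q" unfolding p_def q_def by (rule Cauchy_Schwarz_ineq2)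
      have "\<bar>2 * (x \<bullet> h) + q\<^sup>2\<bar> \<le> 2 * (p * q) + q * q" unfolding power2_eq_square using xh zero_le_square[of q] by linarith
      also have "\<dots> \<le> 2 * (p * q) + q * 1" using q by (intro add_left_mono mult_left_mono) auto
      finally have n: "\<bar>2 * (x \<bullet> h) + q\<^sup>2\<bar> \<le> q * (2 * p + 1)" by (simp add: algebra_simps)
      have ua: "\<bar>u\<bar> \<le> q * (2 * p + 1) / (4 * a)" using n a' by (simp add: u_def divide_right_mono)
      also have "\<dots> \<le> (2 * p + 1) / (4 * a)" using q p a' by (intro divide_right_mono) (auto simp: mult_left_le_one_le)
      finally have ub: "\<bar>u\<bar> \<le> (2 * p + 1) / (4 * a)" .
      have uc: "\<bar>u\<bar> \<le> q * (2 * p + 1) / (4 * a0)"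
        using ua a a0 q p by (intro order_trans[OF ua] divide_left_mono) auto
      have k: "heat a x * exp \<bar>u\<bar> \<le> L * exp (- p\<^sup>2 / 8)" using key[OF ub] .
      have ku: "heat a x * exp u \<le> L * exp (- p\<^sup>2 / 8)" using key[of u] ub by simp
      \<comment> \<open>The exponent \<open>u\<close> contains a quadratic part in \<open>h\<close>,
        so subtracting 1 + u overshoots the linear Taylor term by q^2/(4a); this is estimated
        separately.\<close>
      have gh: "grad a x \<bullet> h = heat a x * (u + q\<^sup>2 / (4 * a))"
        using a' by (simp add: grad_def u_def field_simps)
      have "\<bar>heat a (x + h) - heat a x - grad a x \<bullet> h\<bar> = \<bar>heat a x * (exp u - 1 - u) - heat a x * (q\<^sup>2 / (4 * a))\<bar>"
        by (simp only: hu gh) (simp add: algebra_simps)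
      also have "\<dots> \<le> heat a x * \<bar>exp u - 1 - u\<bar> + heat a x * (q\<^sup>2 / (4 * a))"
        using hp a' by (intro order_trans[OF abs_triangle_ineq4]) (auto simp: abs_mult)
      also have "\<dots> \<le> heat a x * (u\<^sup>2 * exp \<bar>u\<bar>) + heat a x * (q\<^sup>2 / (4 * a))"
        using hp exp_second_order_le[of u] by (intro add_right_mono mult_left_mono) auto
      also have "\<dots> = u\<^sup>2 * (heat a x * exp \<bar>u\<bar>) + (1 / (4 * a)) * q\<^sup>2 * heat a x" by simp
      also have "\<dots> \<le> (q * (2 * p + 1) / (4 * a0))\<^sup>2 * (L * exp (- p\<^sup>2 / 8)) + (1 / (4 * a0)) * q\<^sup>2 * (L * exp (- p\<^sup>2 / 8))"
      proof (rule add_mono)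
        have "u\<^sup>2 \<le> (q * (2 * p + 1) / (4 * a0))\<^sup>2" using uc by (metis abs_ge_zero power2_abs power_mono)
        then show "u\<^sup>2 * (heat a x * exp \<bar>u\<bar>) \<le> (q * (2 * p + 1) / (4 * a0))\<^sup>2 * (L * exp (- p\<^sup>2 / 8))"
          by (rule mult_mono[OF _ k]) (use hp in auto)
        show "1 / (4 * a) * q\<^sup>2 * heat a x \<le> 1 / (4 * a0) * q\<^sup>2 * (L * exp (- p\<^sup>2 / 8))"
          by (rule mult_mono[OF mult_right_mono[OF i2(2)] h0]) (use hp a0 in auto)
      qed
      also have "\<dots> = q\<^sup>2 / (16 * a0\<^sup>2) * L * ((2 * p + 1)\<^sup>2 * exp (- p\<^sup>2 / 8)) + (1 / (4 * a0)) * q\<^sup>2 * L * (1 * exp (- p\<^sup>2 / 8))"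
        by (simp add: power_mult_distrib power_divide ac_simps)
      also have "\<dots> \<le> q\<^sup>2 / (16 * a0\<^sup>2) * L * (128 * g) + (1 / (4 * a0)) * q\<^sup>2 * L * g"
        using a0 L by (intro add_mono mult_left_mono poly poly1) auto
      also have "\<dots> = ((128 / (16 * a0\<^sup>2) + 1 / (4 * a0)) * L) * (q\<^sup>2 * g)" by (simp add: algebra_simps)
      also have "\<dots> \<le> C * (q\<^sup>2 * g)" using g by (intro mult_right_mono C1) auto
      finally have A: "\<bar>heat a (x + h) - heat a x - grad a x \<bullet> h\<bar> \<le> C * (norm h)\<^sup>2 * g" by (simp add: q_def)
      have "grad a (x + h) - grad a x = (- 1 / (2 * a)) *\<^sub>R ((heat a x * (exp u - 1)) *\<^sub>R x + (heat a x * exp u) *\<^sub>R h)"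
      proof -
        have "grad a (x + h) = (- 1 / (2 * a)) *\<^sub>R ((heat a x * exp u) *\<^sub>R (x + h))" "grad a x = (- 1 / (2 * a)) *\<^sub>R (heat a x *\<^sub>R x)"
          by (simp_all add: grad_def hu)
        moreover have "(heat a x * exp u) *\<^sub>R (x + h) - heat a x *\<^sub>R x = (heat a x * (exp u - 1)) *\<^sub>R x + (heat a x * exp u) *\<^sub>R h"
          by (simp add: algebra_simps)
        ultimately show ?thesis by (simp only: scaleR_diff_right[symmetric])
      qed
      then have "norm (grad a (x + h) - grad a x) = 1 / (2 * a) * norm ((heat a x * (exp u - 1)) *\<^sub>R x + (heat a x * exp u) *\<^sub>R h)"
        using a' by simp
      also have "\<dots> \<le> 1 / (2 * a) * (heat a x * \<bar>exp u - 1\<bar> * p + heat a x * exp u * q)"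
        using a' hp by (intro mult_left_mono order_trans[OF norm_triangle_ineq]) (auto simp: abs_mult p_def q_def)
      also have "\<dots> \<le> 1 / (2 * a0) * ((q * (2 * p + 1) / (4 * a0) * (L * exp (- p\<^sup>2 / 8))) * p + L * exp (- p\<^sup>2 / 8) * q)"
      proof (rule mult_mono[OF i2(1)], rule add_mono[OF mult_right_mono mult_right_mono[OF ku]])
        have "heat a x * \<bar>exp u - 1\<bar> \<le> heat a x * (\<bar>u\<bar> * exp \<bar>u\<bar>)"
          using hp by (intro mult_left_mono exp_minus_one_abs_le) auto
        also have "\<dots> = \<bar>u\<bar> * (heat a x * exp \<bar>u\<bar>)" by simp
        also have "\<dots> \<le> q * (2 * p + 1) / (4 * a0) * (L * exp (- p\<^sup>2 / 8))"
          by (rule mult_mono[OF uc k]) (use hp q p a0 in auto)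
        finally show "heat a x * \<bar>exp u - 1\<bar> \<le> q * (2 * p + 1) / (4 * a0) * (L * exp (- p\<^sup>2 / 8))" .
      qed (use hp a0 q p L in auto)
      also have "\<dots> = 1 / (2 * a0) * L * q * (1 / (4 * a0) * (p * (2 * p + 1) * exp (- p\<^sup>2 / 8)) + 1 * exp (- p\<^sup>2 / 8))"
        by (simp add: algebra_simps add_divide_distrib)
      also have "\<dots> \<le> 1 / (2 * a0) * L * q * (1 / (4 * a0) * (128 * g) + 128 * g)"
        using a0 L q polyp poly1 g by (intro add_mono mult_left_mono) auto
      also have "\<dots> = (1 / (2 * a0)) * (128 / (4 * a0) + 128) * L * (q * g)" by (simp add: algebra_simps)
      also have "\<dots> \<le> C * (q * g)" using g q by (intro mult_right_mono C2) auto
      finally have B: "norm (grad a (x + h) - grad a x) \<le> C * norm h * g" by (simp add: q_def)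
      from A B show ?thesis ..
    qed
    note 1 2 this[THEN conjunct1] this[THEN conjunct2]
  } note * = this
  show thesis
    by (rule that[of C]) (use C * in auto)
qed


text \<open>Borel counterpart of \<open>L2 3\<close>. Borel measurability is preserved by the
  product and composition arguments needed for Tonelli, and every element of \<open>L2 3\<close> has
  such a representative.\<close>

definition wL2 :: "(real^2 \<Rightarrow> real) set" where
  "wL2 = {f \<in> borel_measurable borel. W f < \<infinity>}"

lemma wL2_measurable [measurable_dest]: "f \<in> wL2 \<Longrightarrow> f \<in> borel_measurable borel"
  and wL2_finite: "f \<in> wL2 \<Longrightarrow> W f < \<infinity>"
  by (auto simp: wL2_def)

lemma W_mono: "(\<And>x. \<bar>f x\<bar> \<le> \<bar>g x\<bar>) \<Longrightarrow> W f \<le> W g"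
  by (intro wint_mono ennreal_leI) auto

lemma W_add:
  assumes [measurable]: "f \<in> borel_measurable borel" "g \<in> borel_measurable borel"
  shows "W (\<lambda>x. f x + g x) \<le> 2 * W f + 2 * W g"
proof -
  have "W (\<lambda>x. f x + g x) \<le> wint (\<lambda>x. ennreal \<bar>f x\<bar> + ennreal \<bar>g x\<bar>)"
    by (intro wint_mono) (simp add: ennreal_plus[symmetric] ennreal_leI abs_triangle_ineq del: ennreal_plus)
  also have "\<dots> \<le> 2 * W f + 2 * W g" by (rule wint_add) measurable
  finally show ?thesis .
qed

lemma W_cmult:
  assumes [measurable]: "f \<in> borel_measurable borel"
  shows "W (\<lambda>x. c * f x) = ennreal (c\<^sup>2) * W f"
  using wint_cmult[of "\<lambda>x. ennreal \<bar>f x\<bar>" "ennreal \<bar>c\<bar>"]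
  by (simp add: abs_mult ennreal_mult ennreal_power)

lemma wL2_add: "f \<in> wL2 \<Longrightarrow> g \<in> wL2 \<Longrightarrow> (\<lambda>x. f x + g x) \<in> wL2"
  using W_add[of f g] by (auto simp: wL2_def ennreal_mult_less_top intro: le_less_trans)

lemma wL2_cmult: "f \<in> wL2 \<Longrightarrow> (\<lambda>x. c * f x) \<in> wL2"
  by (auto simp: wL2_def W_cmult ennreal_mult_less_top)

lemma wL2_diff: "f \<in> wL2 \<Longrightarrow> g \<in> wL2 \<Longrightarrow> (\<lambda>x. f x - g x) \<in> wL2"
  using wL2_add[OF _ wL2_cmult[of g "-1"], of f] by simp

lemma wL2_bound:
  assumes "g \<in> wL2" and [measurable]: "f \<in> borel_measurable borel" and "\<And>x. \<bar>f x\<bar> \<le> \<bar>g x\<bar>"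
  shows "f \<in> wL2"
  using assms W_mono[of f g] by (auto simp: wL2_def intro: le_less_trans)

lemma gauss_tail_wL2: "gauss_tail \<in> wL2"
  using wint_gauss_tail_finite by (simp add: wL2_def)

text \<open>The power s/2 is split as (s - 3)/2 plus 3/2, half of the weight exponent. The first
  factor is square integrable exactly for s < 2; the choice s = 2\<mu> is where \<mu> < 1
  enters.\<close>

lemma moment_bound:
  assumes [measurable]: "f \<in> borel_measurable borel"
  shows "(\<integral>\<^sup>+y. ennreal ((1 + (norm y)\<^sup>2) powr (s/2) * \<bar>f y\<bar>) \<partial>lborel)\<^sup>2 \<le> decay_int (3 - s) * W f"
proof -
  define m where "m y = 1 + (norm y)\<^sup>2" for y :: "real^2"
  have m: "m y > 0" for y by (simp add: m_def add_pos_nonneg)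
  have [measurable]: "m \<in> borel_measurable borel" unfolding m_def by measurable
  have "(\<integral>\<^sup>+y. ennreal (m y powr (s/2) * \<bar>f y\<bar>) \<partial>lborel) = (\<integral>\<^sup>+y. ennreal (m y powr ((s - 3) / 2)) * ennreal (m y powr (3/2) * \<bar>f y\<bar>) \<partial>lborel)"
  proof (rule nn_integral_cong)
    fix y
    have "m y powr (s/2) = m y powr ((s - 3) / 2) * m y powr (3/2)"
      by (simp add: powr_add[symmetric] diff_divide_distrib)
    then show "ennreal (m y powr (s/2) * \<bar>f y\<bar>) = ennreal (m y powr ((s - 3) / 2)) * ennreal (m y powr (3/2) * \<bar>f y\<bar>)"
      by (simp add: ennreal_mult'[symmetric])
  qed
  then have "(\<integral>\<^sup>+y. ennreal (m y powr (s/2) * \<bar>f y\<bar>) \<partial>lborel)\<^sup>2 \<le> (\<integral>\<^sup>+y. (ennreal (m y powr ((s - 3) / 2)))\<^sup>2 \<partial>lborel) * (\<integral>\<^sup>+y. (ennreal (m y powr (3/2) * \<bar>f y\<bar>))\<^sup>2 \<partial>lborel)"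
    by (simp only:) (rule Cauchy_Schwarz_nn_integral, measurable)
  also have "(\<integral>\<^sup>+y. (ennreal (m y powr ((s - 3) / 2)))\<^sup>2 \<partial>lborel) = decay_int (3 - s)"
    unfolding decay_int_def m_def[symmetric]
    by (intro nn_integral_cong) (simp add: power2_eq_square ennreal_mult'[symmetric] powr_add[symmetric])
  also have "(\<integral>\<^sup>+y. (ennreal (m y powr (3/2) * \<bar>f y\<bar>))\<^sup>2 \<partial>lborel) = W f"
    unfolding wint_def
  proof (rule nn_integral_cong)
    fix y
    have "(m y powr (3/2))\<^sup>2 = m y powr 3"
      using m[of y] by (simp add: power2_eq_square powr_add[symmetric])
    also have "\<dots> = wt y" using m[of y] by (simp add: wt_def m_def)
    finally show "(ennreal (m y powr (3/2) * \<bar>f y\<bar>))\<^sup>2 = ennreal (wt y) * (ennreal \<bar>f y\<bar>)\<^sup>2"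
      by (simp add: ennreal_power ennreal_mult'[symmetric] power_mult_distrib wt_nonneg)
  qed
  finally show ?thesis unfolding m_def .
qed

lemma moment_finite:
  assumes f: "f \<in> wL2" and s: "s < 2"
  shows "(\<integral>\<^sup>+y. ennreal ((1 + (norm y)\<^sup>2) powr (s/2) * \<bar>f y\<bar>) \<partial>lborel) < \<infinity>"
proof -
  have [measurable]: "f \<in> borel_measurable borel" using f by (simp add: wL2_def)
  have "(\<integral>\<^sup>+y. ennreal ((1 + (norm y)\<^sup>2) powr (s/2) * \<bar>f y\<bar>) \<partial>lborel)\<^sup>2 \<le> decay_int (3 - s) * W f"
    by (rule moment_bound) measurable
  also have "\<dots> < \<infinity>" using decay_int_finite[of "3 - s"] s wL2_finite[OF f] by (simp add: ennreal_mult_less_top)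
  finally show ?thesis by (simp add: power_less_top_ennreal)
qed

lemma wL2_moment1_integrable:
  assumes f: "f \<in> wL2"
  shows "integrable lborel (\<lambda>y. sqrt (1 + (norm y)\<^sup>2) * f y)"
proof (rule integrableI_bounded)
  have [measurable]: "f \<in> borel_measurable borel" using f by (simp add: wL2_def)
  show "(\<lambda>y. sqrt (1 + (norm y)\<^sup>2) * f y) \<in> borel_measurable lborel" by measurable
  have "(\<integral>\<^sup>+y. ennreal (norm (sqrt (1 + (norm y)\<^sup>2) * f y)) \<partial>lborel) = (\<integral>\<^sup>+y. ennreal ((1 + (norm y)\<^sup>2) powr (1/2) * \<bar>f y\<bar>) \<partial>lborel)"
    by (intro nn_integral_cong) (simp add: abs_mult powr_half_sqrt add_nonneg_nonneg)
  then show "(\<integral>\<^sup>+y. ennreal (norm (sqrt (1 + (norm y)\<^sup>2) * f y)) \<partial>lborel) < \<infinity>"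
    using moment_finite[OF f, of 1] by simp
qed

lemma le_sqrt_1_norm: "1 \<le> sqrt (1 + (norm y)\<^sup>2)" "norm y \<le> sqrt (1 + (norm y)\<^sup>2)"
  by (auto intro: real_le_rsqrt)

lemma wL2_integrable:
  assumes "f \<in> wL2" shows "integrable lborel f"
proof (rule Bochner_Integration.integrable_bound)
  show "integrable lborel (\<lambda>y. sqrt (1 + (norm y)\<^sup>2) * f y)"
    using assms by (rule wL2_moment1_integrable)
  show "f \<in> borel_measurable lborel" using assms by (auto simp: wL2_def)
  show "AE y in lborel. norm (f y) \<le> norm (sqrt (1 + (norm y)\<^sup>2) * f y)"
  proof (rule AE_I2)
    fix y :: "real^2"
    have "1 * \<bar>f y\<bar> \<le> sqrt (1 + (norm y)\<^sup>2) * \<bar>f y\<bar>"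
      by (intro mult_right_mono le_sqrt_1_norm) auto
    then show "norm (f y) \<le> norm (sqrt (1 + (norm y)\<^sup>2) * f y)"
      by (simp add: abs_mult add_nonneg_nonneg)
  qed
qed

lemma wL2_moment_integrable:
  assumes "f \<in> wL2" shows "integrable lborel (\<lambda>y. (c \<bullet> y) * f y)"
proof (rule Bochner_Integration.integrable_bound)
  show "integrable lborel (\<lambda>y. norm c * (sqrt (1 + (norm y)\<^sup>2) * f y))"
    using wL2_moment1_integrable[OF assms] by simp
  show "(\<lambda>y. c \<bullet> y * f y) \<in> borel_measurable lborel" using assms by (auto simp: wL2_def)
  show "AE x in lborel. norm (c \<bullet> x * f x) \<le> norm (norm c * (sqrt (1 + (norm x)\<^sup>2) * f x))"
  proof (rule AE_I2)
    fix x :: "real^2"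
    have "\<bar>c \<bullet> x\<bar> \<le> norm c * norm x" by (rule Cauchy_Schwarz_ineq2)
    also have "\<dots> \<le> norm c * sqrt (1 + (norm x)\<^sup>2)" by (intro mult_left_mono le_sqrt_1_norm) auto
    finally have "\<bar>c \<bullet> x\<bar> * \<bar>f x\<bar> \<le> norm c * sqrt (1 + (norm x)\<^sup>2) * \<bar>f x\<bar>" by (intro mult_right_mono) auto
    then show "norm (c \<bullet> x * f x) \<le> norm (norm c * (sqrt (1 + (norm x)\<^sup>2) * f x))"
      by (simp add: abs_mult add_nonneg_nonneg)
  qed
qed

section \<open>The Biot-Savart velocity\<close>

lemma perp_nth [simp]: "perp x $ 1 = - (x $ 2)" "perp x $ 2 = x $ 1"
  by (simp_all add: perp_def)

lemma perp_minus: "perp (- x) = - perp x"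
  by (simp add: vec_eq_iff forall_2)

lemma norm_perp [simp]: "norm (perp x) = norm x"
  by (simp add: norm_vec_def L2_set_def sum_2 add.commute)

lemma perp_measurable [measurable]: "perp \<in> borel_measurable borel"
proof (rule borel_measurable_continuous_onI)
  have "linear perp"
    by (rule linearI) (simp_all add: vec_eq_iff forall_2)
  then show "continuous_on UNIV perp" by (simp add: linear_continuous_on linear_conv_bounded_linear)
qed

definition bs_kernel :: "real^2 \<Rightarrow> real^2" where "bs_kernel x = (1 / (norm x)\<^sup>2) *\<^sub>R perp x"

lemma bs_kernel_measurable [measurable]: "bs_kernel \<in> borel_measurable borel"
  unfolding bs_kernel_def by measurable

lemma bs_kernel_minus: "bs_kernel (- x) = - bs_kernel x"
  by (simp add: bs_kernel_def perp_minus)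

lemma norm_bs_kernel: "norm (bs_kernel x) = 1 / norm x"
  by (simp add: bs_kernel_def power2_eq_square)

lemma biot_savart_lborel:
  assumes [measurable]: "f \<in> borel_measurable borel"
  shows "biot_savart f x = (1 / (2 * pi)) *\<^sub>R (\<integral>y. f y *\<^sub>R bs_kernel (x - y) \<partial>lborel)"
proof -
  have "(\<lambda>\<eta>. (f \<eta> / (norm (x - \<eta>))\<^sup>2) *\<^sub>R perp (x - \<eta>)) = (\<lambda>y. f y *\<^sub>R bs_kernel (x - y))"
    by (simp add: bs_kernel_def)
  moreover have "(\<lambda>y. f y *\<^sub>R bs_kernel (x - y)) \<in> borel_measurable lborel" by measurable
  ultimately show ?thesis unfolding biot_savart_def by (simp add: integral_completion)
qed

lemma biot_savart_measurable [measurable]: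
  assumes [measurable]: "f \<in> borel_measurable borel"
  shows "biot_savart f \<in> borel_measurable borel"
proof -
  have "(\<lambda>x. (1 / (2 * pi)) *\<^sub>R (\<integral>y. f y *\<^sub>R bs_kernel (x - y) \<partial>lborel)) \<in> borel_measurable borel"
    by measurable
  then show ?thesis using biot_savart_lborel[OF assms] by presburger
qed

text \<open>Where the velocity integral diverges the Bochner integral is 0, so the bound holds at
  every point. The factor 1/(2 pi) is simply dropped.\<close>

lemma norm_biot_savart_le:
  assumes [measurable]: "f \<in> borel_measurable borel"
  shows "ennreal (norm (biot_savart f x)) \<le> riesz f x"
proof -
  let ?I = "\<integral>y. f y *\<^sub>R bs_kernel (x - y) \<partial>lborel"
  have "norm (biot_savart f x) \<le> 1 * norm ?I"
    using pi_gt3 unfolding biot_savart_lborel[OF assms] norm_scaleR by (intro mult_right_mono) auto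
  then have "ennreal (norm (biot_savart f x)) \<le> ennreal (norm ?I)" by (intro ennreal_leI) simp
  also have "\<dots> \<le> (\<integral>\<^sup>+y. ennreal (norm (f y *\<^sub>R bs_kernel (x - y))) \<partial>lborel)"
  proof (cases "integrable lborel (\<lambda>y. f y *\<^sub>R bs_kernel (x - y))")
    case True then show ?thesis by (rule integral_norm_bound_ennreal)
  qed (simp add: not_integrable_integral_eq)
  also have "\<dots> = riesz f x" by (simp add: riesz_def norm_bs_kernel)
  finally show ?thesis .
qed

lemma bs_kernel_integrable:
  assumes [measurable]: "f \<in> borel_measurable borel" and "riesz f x < \<infinity>"
  shows "integrable lborel (\<lambda>y. f y *\<^sub>R bs_kernel (x - y))"
  by (rule integrableI_bounded) (use assms in \<open>auto simp: riesz_def norm_bs_kernel\<close>)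

lemma biot_savart_add:
  assumes "f \<in> borel_measurable borel" "g \<in> borel_measurable borel" "riesz f x < \<infinity>" "riesz g x < \<infinity>"
  shows "biot_savart (\<lambda>y. f y + g y) x = biot_savart f x + biot_savart g x"
  using bs_kernel_integrable[OF assms(1,3)] bs_kernel_integrable[OF assms(2,4)] assms(1,2)
  by (simp add: biot_savart_lborel scaleR_add_left scaleR_add_right)

lemma biot_savart_cmult:
  assumes "f \<in> borel_measurable borel"
  shows "biot_savart (\<lambda>y. c * f y) x = c *\<^sub>R biot_savart f x"
  using assms by (simp add: biot_savart_lborel scaleR_scaleR[symmetric] del: scaleR_scaleR) (simp add: ac_simps)

section \<open>The divergence part of the semigroup\<close>

text \<open>The first argument generates the velocity, the second is the vorticity it transports;
  the bilinear form is needed for polarisation.\<close>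

definition flux :: "(real^2 \<Rightarrow> real) \<Rightarrow> (real^2 \<Rightarrow> real) \<Rightarrow> real^2 \<Rightarrow> real^2" where
  "flux f g y = g y *\<^sub>R biot_savart f y"

lemma flux_measurable [measurable]:
  assumes [measurable]: "f \<in> borel_measurable borel" "g \<in> borel_measurable borel"
  shows "flux f g \<in> borel_measurable borel"
  unfolding flux_def by measurable

lemma norm_flux_le:
  assumes "f \<in> borel_measurable borel"
  shows "ennreal (norm (flux f g y)) \<le> riesz f y * ennreal \<bar>g y\<bar>"
  unfolding flux_def using mult_right_mono[OF norm_biot_savart_le[OF assms, of y], of "ennreal \<bar>g y\<bar>"]
  by (simp add: ennreal_mult mult.commute)

lemma riesz_mult_le: "riesz f y * F \<le> riesz f y * (ennreal (sqrt (1 + (norm y)\<^sup>2)) * F)"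
proof -
  have "riesz f y * (1 * F) \<le> riesz f y * (ennreal (sqrt (1 + (norm y)\<^sup>2)) * F)"
    using le_sqrt_1_norm(1)[of y] by (intro mult_left_mono mult_right_mono) (auto simp del: real_sqrt_ge_1_iff)
  then show ?thesis by simp
qed

lemma flux_moment_bound:
  assumes [measurable]: "f \<in> borel_measurable borel" "g \<in> borel_measurable borel"
  shows "(\<integral>\<^sup>+y. ennreal (norm (flux f g y)) \<partial>lborel)\<^sup>2 \<le> Criesz * Criesz * W f * W g"
proof -
  have "(\<integral>\<^sup>+y. ennreal (norm (flux f g y)) \<partial>lborel) \<le> (\<integral>\<^sup>+x. riesz f x * (ennreal (sqrt (1 + (norm x)\<^sup>2)) * ennreal \<bar>g x\<bar>) \<partial>lborel)"
    by (intro nn_integral_mono order_trans[OF norm_flux_le riesz_mult_le]) measurable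
  then have "(\<integral>\<^sup>+y. ennreal (norm (flux f g y)) \<partial>lborel)\<^sup>2 \<le> (\<integral>\<^sup>+x. riesz f x * (ennreal (sqrt (1 + (norm x)\<^sup>2)) * ennreal \<bar>g x\<bar>) \<partial>lborel)\<^sup>2"
    by (rule power_mono) simp
  also have "\<dots> \<le> Criesz * Criesz * W f * W g"
    by (rule nn_integral_riesz_mult) measurable
  finally show ?thesis .
qed

lemma flux_L1_finite:
  assumes "f \<in> wL2" "g \<in> wL2"
  shows "(\<integral>\<^sup>+y. ennreal (norm (flux f g y)) \<partial>lborel) < \<infinity>"
proof -
  have "(\<integral>\<^sup>+y. ennreal (norm (flux f g y)) \<partial>lborel)\<^sup>2 \<le> Criesz * Criesz * W f * W g"
    using assms by (intro flux_moment_bound) (auto simp: wL2_def)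
  also have "\<dots> < \<infinity>" using assms Criesz_finite by (auto simp: wL2_def ennreal_mult_less_top)
  finally show ?thesis by (simp add: power_less_top_ennreal)
qed

lemma flux_integrable:
  assumes "f \<in> wL2" "g \<in> wL2"
  shows "integrable lborel (flux f g)"
  using flux_L1_finite[OF assms] assms by (intro integrableI_bounded) (auto simp: wL2_def)

text \<open>Only almost everywhere, because additivity of the velocity fails to be available where
  one of the two potentials is infinite.\<close>

lemma flux_add_left:
  assumes "f \<in> wL2" "g \<in> wL2"
  shows "AE y in lborel. flux (\<lambda>y. f y + g y) h y = flux f h y + flux g h y"
  using AE_riesz_finite[of f] AE_riesz_finite[of g] assms
  by (auto simp: wL2_def flux_def biot_savart_add scaleR_add_right elim!: eventually_elim2)

lemma flux_add_right: "flux h (\<lambda>y. f y + g y) y = flux h f y + flux h g y"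
  by (simp add: flux_def scaleR_add_left)

lemma flux_cmult_left: "f \<in> borel_measurable borel \<Longrightarrow> flux (\<lambda>y. c * f y) h y = c *\<^sub>R flux f h y"
  by (simp add: flux_def biot_savart_cmult)

lemma flux_cmult_right: "flux h (\<lambda>y. c * f y) y = c *\<^sub>R flux h f y"
  by (simp add: flux_def)

text \<open>The kernel is odd, so the net velocity of a vorticity field on itself vanishes; this is the
  polarised form.\<close>

lemma flux_antisymmetric:
  assumes f: "f \<in> wL2" and g: "g \<in> wL2"
  shows "(\<integral>y. flux f g y + flux g f y \<partial>lborel) = 0"
proof -
  have [measurable]: "f \<in> borel_measurable borel" "g \<in> borel_measurable borel" using f g by (auto simp: wL2_def)
  define k where "k x y = (g x * f y) *\<^sub>R bs_kernel (x - y)" for x y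
  have k1: "(\<integral>y. k x y \<partial>lborel) = (2 * pi) *\<^sub>R flux f g x" for x
    by (simp add: k_def flux_def biot_savart_lborel scaleR_scaleR[symmetric] del: scaleR_scaleR) simp
  have "(\<lambda>x. k x y) = (\<lambda>x. - ((f y * g x) *\<^sub>R bs_kernel (y - x)))" for y
    using bs_kernel_minus[of "y - x" for x] by (auto simp: k_def fun_eq_iff)
  then have k2: "(\<integral>x. k x y \<partial>lborel) = - ((2 * pi) *\<^sub>R flux g f y)" for y
    by (simp add: flux_def biot_savart_lborel scaleR_scaleR[symmetric] del: scaleR_scaleR) simp
  \<comment> \<open>The hypothesis of Fubini: the absolute double integral is the integral of
    \<open>riesz f\<close> times |g|, which the first-moment bound controls.\<close>
  have int: "integrable (lborel \<Otimes>\<^sub>M lborel) (\<lambda>(x, y). k x y)"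
  proof (rule integrableI_bounded)
    show "(\<lambda>(x, y). k x y) \<in> borel_measurable (lborel \<Otimes>\<^sub>M lborel)" unfolding k_def by measurable
    have "(\<integral>\<^sup>+p. ennreal (norm (case p of (x, y) \<Rightarrow> k x y)) \<partial>(lborel \<Otimes>\<^sub>M lborel)) = (\<integral>\<^sup>+x. \<integral>\<^sup>+y. ennreal (norm (k x y)) \<partial>lborel \<partial>lborel)"
      unfolding k_def by (subst lborel.nn_integral_fst[symmetric]) (auto simp: case_prod_beta)
    also have "\<dots> = (\<integral>\<^sup>+x. riesz f x * ennreal \<bar>g x\<bar> \<partial>lborel)"
    proof (rule nn_integral_cong)
      fix x
      show "(\<integral>\<^sup>+y. ennreal (norm (k x y)) \<partial>lborel) = riesz f x * ennreal \<bar>g x\<bar>"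
        unfolding riesz_def k_def
        by (subst nn_integral_multc[symmetric]) (auto simp: norm_bs_kernel ennreal_mult'[symmetric] abs_mult ac_simps intro!: nn_integral_cong)
    qed
    also have "\<dots> \<le> (\<integral>\<^sup>+x. riesz f x * (ennreal (sqrt (1 + (norm x)\<^sup>2)) * ennreal \<bar>g x\<bar>) \<partial>lborel)"
      by (intro nn_integral_mono riesz_mult_le)
    also have "\<dots> < \<infinity>"
    proof -
      have "(\<integral>\<^sup>+x. riesz f x * (ennreal (sqrt (1 + (norm x)\<^sup>2)) * ennreal \<bar>g x\<bar>) \<partial>lborel)\<^sup>2 \<le> Criesz * Criesz * W f * W g"
        by (rule nn_integral_riesz_mult) measurable
      also have "\<dots> < \<infinity>" using f g Criesz_finite by (auto simp: wL2_def ennreal_mult_less_top)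
      finally show ?thesis by (simp add: power_less_top_ennreal)
    qed
    finally show "(\<integral>\<^sup>+p. ennreal (norm (case p of (x, y) \<Rightarrow> k x y)) \<partial>(lborel \<Otimes>\<^sub>M lborel)) < \<infinity>" .
  qed
  have "(\<integral>y. \<integral>x. k x y \<partial>lborel \<partial>lborel) = (\<integral>x. \<integral>y. k x y \<partial>lborel \<partial>lborel)"
    by (rule lborel_pair.Fubini_integral[OF int])
  then have "- ((2 * pi) *\<^sub>R (\<integral>y. flux g f y \<partial>lborel)) = (2 * pi) *\<^sub>R (\<integral>x. flux f g x \<partial>lborel)"
    unfolding k1 k2 by simp
  then have "(2 * pi) *\<^sub>R ((\<integral>x. flux f g x \<partial>lborel) + (\<integral>y. flux g f y \<partial>lborel)) = 0"
    unfolding scaleR_add_right by (metis add.left_inverse)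
  then have "(\<integral>x. flux f g x \<partial>lborel) + (\<integral>y. flux g f y \<partial>lborel) = 0"
    by simp
  then show ?thesis
    using flux_integrable[OF f g] flux_integrable[OF g f] by simp
qed

text \<open>The divergence of the convolution with the derivative already moved to the kernel, so
  that estimates involve no differentiability; the identification is
  \<open>divergence_heat_convolution\<close>.\<close>

definition div_heat :: "real \<Rightarrow> real \<Rightarrow> (real^2 \<Rightarrow> real^2) \<Rightarrow> real^2 \<Rightarrow> real" where
  "div_heat a e F \<xi> = (\<integral>y. grad a (\<xi> - e *\<^sub>R y) \<bullet> F y \<partial>lborel)"

lemma div_heat_measurable [measurable]:
  assumes [measurable]: "F \<in> borel_measurable borel"
  shows "div_heat a e F \<in> borel_measurable borel"
  unfolding div_heat_def by measurable

lemma heat_le: "a > 0 \<Longrightarrow> heat a x \<le> 1 / (4 * pi * a)"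
  by (simp add: heat_def divide_right_mono)

lemma norm_grad_bound:
  assumes "a > 0" shows "norm (grad a x) \<le> 8 / sqrt a * (1 / (8 * pi * a))"
  using heat_le[of "2 * a" x] assms by (intro order_trans[OF norm_grad_le] mult_left_mono) auto

lemma div_heat_integrable:
  assumes F: "integrable lborel F" and a: "a > 0"
  shows "integrable lborel (\<lambda>y. grad a (\<xi> - e *\<^sub>R y) \<bullet> F y)"
proof (rule Bochner_Integration.integrable_bound)
  have [measurable]: "F \<in> borel_measurable borel" using F by auto
  define K where "K = 8 / sqrt a * (1 / (8 * pi * a))"
  show "integrable lborel (\<lambda>y. K * norm (F y))" using F by simp
  show "(\<lambda>y. grad a (\<xi> - e *\<^sub>R y) \<bullet> F y) \<in> borel_measurable lborel" by measurable
  show "AE y in lborel. norm (grad a (\<xi> - e *\<^sub>R y) \<bullet> F y) \<le> norm (K * norm (F y))"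
  proof (rule AE_I2)
    fix y
    have "\<bar>grad a (\<xi> - e *\<^sub>R y) \<bullet> F y\<bar> \<le> norm (grad a (\<xi> - e *\<^sub>R y)) * norm (F y)"
      by (rule Cauchy_Schwarz_ineq2)
    also have "\<dots> \<le> K * norm (F y)" unfolding K_def by (intro mult_right_mono norm_grad_bound a) auto
    also have "\<dots> \<le> \<bar>K * norm (F y)\<bar>" by simp
    finally show "norm (grad a (\<xi> - e *\<^sub>R y) \<bullet> F y) \<le> norm (K * norm (F y))" by simp
  qed
qed

lemma div_heat_add:
  assumes "integrable lborel F" "integrable lborel H" "a > 0"
  shows "div_heat a e (\<lambda>y. F y + H y) \<xi> = div_heat a e F \<xi> + div_heat a e H \<xi>"
  using div_heat_integrable[OF assms(1,3)] div_heat_integrable[OF assms(2,3)]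
  by (simp add: div_heat_def inner_add_right)

lemma div_heat_cmult: "div_heat a e (\<lambda>y. c *\<^sub>R F y) \<xi> = c * div_heat a e F \<xi>"
  by (simp add: div_heat_def)

lemma div_heat_cong_AE:
  assumes [measurable]: "F \<in> borel_measurable borel" "H \<in> borel_measurable borel"
    and "AE y in lborel. F y = H y"
  shows "div_heat a e F = div_heat a e H"
  unfolding div_heat_def using assms(3) by (intro ext integral_cong_AE) auto

lemma div_heat_abs_le:
  assumes [measurable]: "F \<in> borel_measurable borel"
  shows "ennreal \<bar>div_heat a e F \<xi>\<bar> \<le> (\<integral>\<^sup>+y. ennreal (norm (grad a (\<xi> - e *\<^sub>R y))) * ennreal (norm (F y)) \<partial>lborel)"
proof -
  have "ennreal (norm (div_heat a e F \<xi>)) \<le> (\<integral>\<^sup>+y. ennreal (norm (grad a (\<xi> - e *\<^sub>R y) \<bullet> F y)) \<partial>lborel)"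
    unfolding div_heat_def
  proof (cases "integrable lborel (\<lambda>y. grad a (\<xi> - e *\<^sub>R y) \<bullet> F y)")
    case True
    then show "ennreal (norm (\<integral>y. grad a (\<xi> - e *\<^sub>R y) \<bullet> F y \<partial>lborel)) \<le> (\<integral>\<^sup>+y. ennreal (norm (grad a (\<xi> - e *\<^sub>R y) \<bullet> F y)) \<partial>lborel)"
      by (rule integral_norm_bound_ennreal)
  qed (simp add: not_integrable_integral_eq)
  also have "\<dots> \<le> (\<integral>\<^sup>+y. ennreal (norm (grad a (\<xi> - e *\<^sub>R y))) * ennreal (norm (F y)) \<partial>lborel)"
    by (intro nn_integral_mono) (auto simp: ennreal_mult'[symmetric] Cauchy_Schwarz_ineq2 intro!: ennreal_leI)
  finally show ?thesis by simp
qed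

text \<open>The squared gradient bound gives 64/a and the doubled time 2a; the singular velocity
  gives 3/(sqrt(2a) e). Hence 192 and the power a^(-3/2), with sqrt(2) discarded.\<close>

lemma wint_grad_riesz_le:
  assumes [measurable]: "f \<in> borel_measurable borel" "F \<in> borel_measurable borel"
    and a: "0 < a" "a \<le> 1" and e: "e > 0"
  shows "wint (\<lambda>\<xi>. \<integral>\<^sup>+y. ennreal (norm (grad a (\<xi> - e *\<^sub>R y))) * (riesz f y * F y) \<partial>lborel)
    \<le> Criesz * ennreal (192 / (a * sqrt a * e)) * W f * (\<integral>\<^sup>+y. ennreal (Cwt * wt (e *\<^sub>R y)) * (F y)\<^sup>2 \<partial>lborel)"
proof -
  define I where "I = (\<integral>\<^sup>+y. ennreal (Cwt * wt (e *\<^sub>R y)) * (F y)\<^sup>2 \<partial>lborel)"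
  have "wint (\<lambda>\<xi>. \<integral>\<^sup>+y. ennreal (norm (grad a (\<xi> - e *\<^sub>R y))) * (riesz f y * F y) \<partial>lborel)
    \<le> wint (\<lambda>\<xi>. ennreal (8 / sqrt a) * (\<integral>\<^sup>+y. ennreal (heat (2 * a) (\<xi> - e *\<^sub>R y)) * (riesz f y * F y) \<partial>lborel))"
  proof (rule wint_mono)
    fix \<xi>
    have "(\<integral>\<^sup>+y. ennreal (norm (grad a (\<xi> - e *\<^sub>R y))) * (riesz f y * F y) \<partial>lborel)
      \<le> (\<integral>\<^sup>+y. ennreal (8 / sqrt a) * (ennreal (heat (2 * a) (\<xi> - e *\<^sub>R y)) * (riesz f y * F y)) \<partial>lborel)"
    proof (rule nn_integral_mono)
      fix y
      have "ennreal (norm (grad a (\<xi> - e *\<^sub>R y))) \<le> ennreal (8 / sqrt a) * ennreal (heat (2 * a) (\<xi> - e *\<^sub>R y))"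
        using norm_grad_le[OF a(1), of "\<xi> - e *\<^sub>R y"] a by (simp add: ennreal_mult'[symmetric] ennreal_leI)
      from mult_right_mono[OF this, of "riesz f y * F y"]
      show "ennreal (norm (grad a (\<xi> - e *\<^sub>R y))) * (riesz f y * F y) \<le> ennreal (8 / sqrt a) * (ennreal (heat (2 * a) (\<xi> - e *\<^sub>R y)) * (riesz f y * F y))"
        by (simp add: mult.assoc)
    qed
    also have "\<dots> = ennreal (8 / sqrt a) * (\<integral>\<^sup>+y. ennreal (heat (2 * a) (\<xi> - e *\<^sub>R y)) * (riesz f y * F y) \<partial>lborel)"
      by (rule nn_integral_cmult) measurable
    finally show "(\<integral>\<^sup>+y. ennreal (norm (grad a (\<xi> - e *\<^sub>R y))) * (riesz f y * F y) \<partial>lborel)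
      \<le> ennreal (8 / sqrt a) * (\<integral>\<^sup>+y. ennreal (heat (2 * a) (\<xi> - e *\<^sub>R y)) * (riesz f y * F y) \<partial>lborel)" .
  qed
  also have "\<dots> = (ennreal (8 / sqrt a))\<^sup>2 * wint (\<lambda>\<xi>. \<integral>\<^sup>+y. ennreal (heat (2 * a) (\<xi> - e *\<^sub>R y)) * (riesz f y * F y) \<partial>lborel)"
    by (rule wint_cmult) measurable
  also have "\<dots> \<le> (ennreal (8 / sqrt a))\<^sup>2 * (Criesz * ennreal (3 / (sqrt (2 * a) * e)) * W f * I)"
    unfolding I_def using a e by (intro mult_left_mono wint_heat_riesz_le) auto
  also have "\<dots> = Criesz * ((ennreal (8 / sqrt a))\<^sup>2 * ennreal (3 / (sqrt (2 * a) * e))) * W f * I"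
    by (simp add: ac_simps)
  also have "(ennreal (8 / sqrt a))\<^sup>2 * ennreal (3 / (sqrt (2 * a) * e)) = ennreal (64 / a * (3 / (sqrt (2 * a) * e)))"
    using a e by (simp add: ennreal_power ennreal_mult'[symmetric] power_divide)
  also have "Criesz * ennreal (64 / a * (3 / (sqrt (2 * a) * e))) * W f * I \<le> Criesz * ennreal (192 / (a * sqrt a * e)) * W f * I"
  proof (intro mult_right_mono mult_left_mono ennreal_leI)
    have "64 / a * (3 / (sqrt (2 * a) * e)) = 192 / (a * (sqrt (2 * a) * e))" by simp
    also have "\<dots> \<le> 192 / (a * (sqrt a * e))" using a e by (intro divide_left_mono mult_left_mono mult_right_mono) auto
    finally show "64 / a * (3 / (sqrt (2 * a) * e)) \<le> 192 / (a * sqrt a * e)" by (simp add: mult.assoc)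
  qed auto
  finally show ?thesis unfolding I_def .
qed

text \<open>No cancellation is used. In norm the singularity is a^(-3/4), which is integrable in
  time, so this settles the times where \<open>e\<close> stays away from 0.\<close>

lemma div_heat_bound_short:
  assumes [measurable]: "f \<in> borel_measurable borel" "g \<in> borel_measurable borel"
    and a: "0 < a" "a \<le> 1" and e: "0 < e" "e \<le> 1"
  shows "W (div_heat a e (flux f g)) \<le> Criesz * ennreal (192 * Cwt / (a * sqrt a * e)) * W f * W g"
proof -
  have "W (div_heat a e (flux f g)) \<le> wint (\<lambda>\<xi>. \<integral>\<^sup>+y. ennreal (norm (grad a (\<xi> - e *\<^sub>R y))) * (riesz f y * ennreal \<bar>g y\<bar>) \<partial>lborel)"
    by (intro wint_mono order_trans[OF div_heat_abs_le] nn_integral_mono mult_left_mono norm_flux_le) auto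
  also have "\<dots> \<le> Criesz * ennreal (192 / (a * sqrt a * e)) * W f * (\<integral>\<^sup>+y. ennreal (Cwt * wt (e *\<^sub>R y)) * (ennreal \<bar>g y\<bar>)\<^sup>2 \<partial>lborel)"
    by (intro wint_grad_riesz_le a e) auto
  also have "\<dots> \<le> Criesz * ennreal (192 / (a * sqrt a * e)) * W f * (ennreal Cwt * W g)"
    by (intro mult_left_mono nn_integral_wt_scale_le e) auto
  also have "\<dots> = Criesz * (ennreal Cwt * ennreal (192 / (a * sqrt a * e))) * W f * W g"
    by (simp add: ac_simps)
  also have "ennreal Cwt * ennreal (192 / (a * sqrt a * e)) = ennreal (192 * Cwt / (a * sqrt a * e))"
    using Cwt_pos by (simp add: ennreal_mult'[symmetric] mult.commute)
  finally show ?thesis .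
qed

lemma moment1_riesz_bound:
  assumes [measurable]: "f \<in> borel_measurable borel" "g \<in> borel_measurable borel"
  shows "(\<integral>\<^sup>+x. riesz f x * (ennreal (sqrt (1 + (norm x)\<^sup>2)) * ennreal \<bar>g x\<bar>) \<partial>lborel)\<^sup>2 \<le> Criesz * Criesz * W f * W g"
  by (rule nn_integral_riesz_mult) measurable

text \<open>For large times the near part \<open>e |y| < 1\<close> gains a factor from the vanishing mean, the far part
  from the weight.\<close>

lemma div_heat_bound_long:
  obtains C where "C < \<infinity>"
    "\<And>a e f g. 1/2 \<le> a \<Longrightarrow> a \<le> 1 \<Longrightarrow> 0 < e \<Longrightarrow> e \<le> 1 \<Longrightarrow> f \<in> wL2 \<Longrightarrow> g \<in> wL2 \<Longrightarrow>
      W (div_heat a e (\<lambda>y. flux f g y + flux g f y)) \<le> C * ennreal (e\<^sup>2) * W f * W g"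
proof -
  obtain T where T: "T > 0"
    "\<And>a x. 1/2 \<le> a \<Longrightarrow> a \<le> 1 \<Longrightarrow> norm (grad a x) \<le> T * gauss_tail x"
    "\<And>a x h. 1/2 \<le> a \<Longrightarrow> a \<le> 1 \<Longrightarrow> norm h \<le> 1 \<Longrightarrow> norm (grad a (x + h) - grad a x) \<le> T * norm h * gauss_tail x"
    using heat_taylor[of "1/2"] by (metis half_gt_zero zero_less_one)
  \<comment> \<open>The first summand is the near part. In the second, 192 comes from the gradient
    bound, 4 from a sqrt(a) \<ge> 1/4, and the inner 8 from the far weight.\<close>
  define C where "C = 8 * Criesz * Criesz * ennreal (T\<^sup>2) * W gauss_tail + 8 * Criesz * ennreal (192 * 4 * 8 * Cwt)"
  show thesis
  proof (rule that[of C])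
    show "C < \<infinity>" using Criesz_finite wint_gauss_tail_finite by (simp add: C_def ennreal_mult_less_top)
    fix a e :: real and f g :: "real^2 \<Rightarrow> real"
    assume a: "1/2 \<le> a" "a \<le> 1" and e: "0 < e" "e \<le> 1" and f: "f \<in> wL2" and g: "g \<in> wL2"
    have [measurable]: "f \<in> borel_measurable borel" "g \<in> borel_measurable borel" using f g by (auto simp: wL2_def)
    define F where "F y = flux f g y + flux g f y" for y
    have [measurable]: "F \<in> borel_measurable borel" unfolding F_def by measurable
    have Fint: "integrable lborel F" unfolding F_def using flux_integrable f g by auto
    have F0: "(\<integral>y. F y \<partial>lborel) = 0" unfolding F_def by (rule flux_antisymmetric[OF f g])
    define j where "j y = sqrt (1 + (norm y)\<^sup>2)" for y :: "real^2"
    have [measurable]: "j \<in> borel_measurable borel" unfolding j_def by measurable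
    have jn: "norm y \<le> j y" "1 \<le> j y" for y unfolding j_def by (rule le_sqrt_1_norm)+
    define far where "far f y = (if e * norm y < 1 then 0 else ennreal \<bar>f y\<bar>)" for f :: "real^2 \<Rightarrow> real" and y
    have [measurable]: "far f \<in> borel_measurable borel" if "f \<in> borel_measurable borel" for f
      using that unfolding far_def by measurable
    define N where "N f g \<xi> = (\<integral>\<^sup>+y. ennreal (norm (grad a (\<xi> - e *\<^sub>R y))) * (riesz f y * far g y) \<partial>lborel)" for f g \<xi>
    have [measurable]: "N f g \<in> borel_measurable borel" if [measurable]: "f \<in> borel_measurable borel" "g \<in> borel_measurable borel" for f g
      unfolding N_def by measurable
    define M where "M f g = (\<integral>\<^sup>+y. riesz f y * (ennreal (j y) * ennreal \<bar>g y\<bar>) \<partial>lborel)" for f g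
    have Mb: "(M f g)\<^sup>2 \<le> Criesz * Criesz * W f * W g" "(M g f)\<^sup>2 \<le> Criesz * Criesz * W g * W f"
      unfolding M_def j_def by (rule moment1_riesz_bound; measurable)+
    \<comment> \<open>Far away the increment is not small, but the subtracted value may be
      multiplied by e|y| \<ge> 1, so it fits the near bound; only the original kernel remains as a
      far term.\<close>
    have diff: "norm (grad a (\<xi> - e *\<^sub>R y) - grad a \<xi>) \<le> T * e * gauss_tail \<xi> * j y + (if e * norm y < 1 then 0 else norm (grad a (\<xi> - e *\<^sub>R y)))" for \<xi> y
    proof (cases "e * norm y < 1")
      case True
      have "norm (grad a (\<xi> + (- (e *\<^sub>R y))) - grad a \<xi>) \<le> T * norm (- (e *\<^sub>R y)) * gauss_tail \<xi>"
        using True e by (intro T(3) a) auto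
      also have "\<dots> = T * e * gauss_tail \<xi> * norm y" using e by simp
      also have "\<dots> \<le> T * e * gauss_tail \<xi> * j y" using T(1) e gauss_tail_nonneg by (intro mult_left_mono jn) auto
      finally show ?thesis using True by simp
    next
      case False
      have "norm (grad a \<xi>) \<le> T * gauss_tail \<xi> * 1" using T(2)[OF a, of \<xi>] by simp
      also have "\<dots> \<le> T * gauss_tail \<xi> * (e * norm y)" using False T(1) gauss_tail_nonneg[of \<xi>] by (intro mult_left_mono) auto
      also have "\<dots> \<le> T * gauss_tail \<xi> * (e * j y)" using T(1) e gauss_tail_nonneg[of \<xi>] by (intro mult_left_mono jn) auto
      finally show ?thesis using False norm_triangle_ineq4[of "grad a (\<xi> - e *\<^sub>R y)" "grad a \<xi>"] by (simp add: ac_simps)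
    qed
    have nF: "ennreal (norm (F y)) \<le> riesz f y * ennreal \<bar>g y\<bar> + riesz g y * ennreal \<bar>f y\<bar>" for y
    proof -
      have "ennreal (norm (F y)) \<le> ennreal (norm (flux f g y)) + ennreal (norm (flux g f y))"
        unfolding F_def by (simp add: ennreal_plus[symmetric] norm_triangle_ineq ennreal_leI del: ennreal_plus)
      also have "\<dots> \<le> riesz f y * ennreal \<bar>g y\<bar> + riesz g y * ennreal \<bar>f y\<bar>"
        by (intro add_mono norm_flux_le) auto
      finally show ?thesis .
    qed
    have pw: "ennreal \<bar>div_heat a e F \<xi>\<bar> \<le> ennreal (T * e * gauss_tail \<xi>) * (M f g + M g f) + (N f g \<xi> + N g f \<xi>)" for \<xi>
    proof -
      have i1: "integrable lborel (\<lambda>y. grad a (\<xi> - e *\<^sub>R y) \<bullet> F y)" using Fint a by (intro div_heat_integrable) auto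
      have i2: "integrable lborel (\<lambda>y. grad a \<xi> \<bullet> F y)" using Fint by simp
      \<comment> \<open>The second integral is zero because \<open>F\<close> has mean zero;
        subtracting it produces the increment of the gradient.\<close>
      have "div_heat a e F \<xi> = (\<integral>y. grad a (\<xi> - e *\<^sub>R y) \<bullet> F y \<partial>lborel) - (\<integral>y. grad a \<xi> \<bullet> F y \<partial>lborel)"
        using F0 Fint by (simp add: div_heat_def)
      also have "\<dots> = (\<integral>y. (grad a (\<xi> - e *\<^sub>R y) - grad a \<xi>) \<bullet> F y \<partial>lborel)"
        using i1 i2 by (simp add: inner_diff_left)
      finally have D: "div_heat a e F \<xi> = (\<integral>y. (grad a (\<xi> - e *\<^sub>R y) - grad a \<xi>) \<bullet> F y \<partial>lborel)" .
      have i3: "integrable lborel (\<lambda>y. (grad a (\<xi> - e *\<^sub>R y) - grad a \<xi>) \<bullet> F y)"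
        using i1 i2 by (simp add: inner_diff_left)
      have "ennreal \<bar>div_heat a e F \<xi>\<bar> \<le> (\<integral>\<^sup>+y. ennreal (norm ((grad a (\<xi> - e *\<^sub>R y) - grad a \<xi>) \<bullet> F y)) \<partial>lborel)"
        using integral_norm_bound_ennreal[OF i3] D by simp
      also have "\<dots> \<le> (\<integral>\<^sup>+y. ennreal (T * e * gauss_tail \<xi>) * (riesz f y * (ennreal (j y) * ennreal \<bar>g y\<bar>)) + ennreal (T * e * gauss_tail \<xi>) * (riesz g y * (ennreal (j y) * ennreal \<bar>f y\<bar>))
          + (ennreal (norm (grad a (\<xi> - e *\<^sub>R y))) * (riesz f y * far g y) + ennreal (norm (grad a (\<xi> - e *\<^sub>R y))) * (riesz g y * far f y)) \<partial>lborel)"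
      proof (rule nn_integral_mono)
        fix y
        let ?H = "riesz f y * ennreal \<bar>g y\<bar> + riesz g y * ennreal \<bar>f y\<bar>"
        have "ennreal (norm ((grad a (\<xi> - e *\<^sub>R y) - grad a \<xi>) \<bullet> F y)) \<le> ennreal (norm (grad a (\<xi> - e *\<^sub>R y) - grad a \<xi>)) * ennreal (norm (F y))"
          by (auto simp: ennreal_mult'[symmetric] Cauchy_Schwarz_ineq2 intro!: ennreal_leI)
        also have "\<dots> \<le> ennreal (T * e * gauss_tail \<xi> * j y + (if e * norm y < 1 then 0 else norm (grad a (\<xi> - e *\<^sub>R y)))) * ?H"
          by (intro mult_mono nF ennreal_leI diff) auto
        also have "\<dots> = (ennreal (T * e * gauss_tail \<xi>) * ennreal (j y) + ennreal (if e * norm y < 1 then 0 else norm (grad a (\<xi> - e *\<^sub>R y)))) * ?H"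
          using T(1) e gauss_tail_nonneg[of \<xi>] jn(2)[of y] by (subst ennreal_plus) (auto simp: ennreal_mult)
        also have "\<dots> = ennreal (T * e * gauss_tail \<xi>) * (riesz f y * (ennreal (j y) * ennreal \<bar>g y\<bar>)) + ennreal (T * e * gauss_tail \<xi>) * (riesz g y * (ennreal (j y) * ennreal \<bar>f y\<bar>))
          + (ennreal (norm (grad a (\<xi> - e *\<^sub>R y))) * (riesz f y * far g y) + ennreal (norm (grad a (\<xi> - e *\<^sub>R y))) * (riesz g y * far f y))"
          by (simp add: far_def distrib_left distrib_right ac_simps)
        finally show "ennreal (norm ((grad a (\<xi> - e *\<^sub>R y) - grad a \<xi>) \<bullet> F y)) \<le> \<dots>" .
      qed
      also have "\<dots> = ennreal (T * e * gauss_tail \<xi>) * M f g + ennreal (T * e * gauss_tail \<xi>) * M g f + (N f g \<xi> + N g f \<xi>)"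
        unfolding M_def N_def by (simp add: nn_integral_add nn_integral_cmult)
      finally show ?thesis by (simp add: distrib_left)
    qed
    have Nb: "wint (N f g) \<le> Criesz * ennreal (192 * 4 * 8 * Cwt) * ennreal (e\<^sup>2) * W f * W g"
      if [measurable]: "f \<in> borel_measurable borel" "g \<in> borel_measurable borel" for f g
    proof -
      have "wint (N f g) \<le> Criesz * ennreal (192 / (a * sqrt a * e)) * W f * (\<integral>\<^sup>+y. ennreal (Cwt * wt (e *\<^sub>R y)) * (far g y)\<^sup>2 \<partial>lborel)"
        unfolding N_def using a e by (intro wint_grad_riesz_le) auto
      also have "\<dots> \<le> Criesz * ennreal (192 / (a * sqrt a * e)) * W f * (ennreal (8 * e ^ 6 * Cwt) * wint (far g))"
        using e by (intro mult_left_mono nn_integral_wt_scale_far) (auto simp: far_def)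
      also have "\<dots> \<le> Criesz * ennreal (192 / (a * sqrt a * e)) * W f * (ennreal (8 * e ^ 6 * Cwt) * W g)"
        by (intro mult_left_mono wint_mono) (auto simp: far_def)
      also have "\<dots> = Criesz * (ennreal (192 / (a * sqrt a * e)) * ennreal (8 * e ^ 6 * Cwt)) * W f * W g"
        by (simp add: ac_simps)
      also have "\<dots> \<le> Criesz * (ennreal (192 * 4 * 8 * Cwt) * ennreal (e\<^sup>2)) * W f * W g"
      proof (intro mult_right_mono mult_left_mono)
        have "1/4 \<le> a * sqrt a"
        proof -
          have "1/2 * (1/2) \<le> a * sqrt a"
            using a by (intro mult_mono real_le_rsqrt) (auto simp: power2_eq_square)
          then show ?thesis by simp
        qed
        then have "1/4 * e \<le> a * sqrt a * e" using e by (intro mult_right_mono) auto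
        then have "192 / (a * sqrt a * e) \<le> 192 / (1/4 * e)" using e a by (intro divide_left_mono) auto
        then have "192 / (a * sqrt a * e) * (8 * e ^ 6 * Cwt) \<le> 192 / (1/4 * e) * (8 * e ^ 6 * Cwt)"
          using e Cwt_pos by (intro mult_right_mono) auto
        also have "\<dots> = 192 * 4 * 8 * Cwt * e ^ 5" using e by (simp add: power_Suc numeral_eq_Suc)
        \<comment> \<open>The far part decays like e^6/e = e^5; it is weakened to the e^2 of the
          near part.\<close>
        also have "\<dots> \<le> 192 * 4 * 8 * Cwt * e ^ 2" using e Cwt_pos by (intro mult_left_mono power_decreasing) auto
        finally show "ennreal (192 / (a * sqrt a * e)) * ennreal (8 * e ^ 6 * Cwt) \<le> ennreal (192 * 4 * 8 * Cwt) * ennreal (e\<^sup>2)"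
          using e a Cwt_pos by (simp add: ennreal_mult'[symmetric] ennreal_leI)
      qed auto
      finally show ?thesis by (simp add: mult.assoc)
    qed
    have "W (div_heat a e F) \<le> wint (\<lambda>\<xi>. ennreal (T * e * gauss_tail \<xi>) * (M f g + M g f) + (N f g \<xi> + N g f \<xi>))"
      by (rule wint_mono) (rule pw)
    also have "\<dots> \<le> 2 * wint (\<lambda>\<xi>. ennreal (T * e * gauss_tail \<xi>) * (M f g + M g f)) + 2 * wint (\<lambda>\<xi>. N f g \<xi> + N g f \<xi>)"
      by (rule wint_add) measurable
    also have "\<dots> \<le> 2 * (4 * Criesz * Criesz * ennreal (T\<^sup>2) * W gauss_tail * ennreal (e\<^sup>2) * W f * W g) + 2 * (4 * Criesz * ennreal (192 * 4 * 8 * Cwt) * ennreal (e\<^sup>2) * W f * W g)"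
    proof (intro add_mono mult_left_mono)
      have "wint (\<lambda>\<xi>. ennreal (T * e * gauss_tail \<xi>) * (M f g + M g f)) = wint (\<lambda>\<xi>. (ennreal (T * e) * (M f g + M g f)) * ennreal \<bar>gauss_tail \<xi>\<bar>)"
        using T(1) e gauss_tail_nonneg by (simp add: ennreal_mult' ac_simps)
      also have "\<dots> = (ennreal (T * e) * (M f g + M g f))\<^sup>2 * W gauss_tail" by (rule wint_cmult) measurable
      also have "\<dots> = ennreal (T\<^sup>2) * ennreal (e\<^sup>2) * (M f g + M g f)\<^sup>2 * W gauss_tail"
        using T(1) e by (simp add: power_mult_distrib ennreal_mult ennreal_power)
      also have "\<dots> \<le> ennreal (T\<^sup>2) * ennreal (e\<^sup>2) * (2 * (Criesz * Criesz * W f * W g) + 2 * (Criesz * Criesz * W g * W f)) * W gauss_tail"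
        by (intro mult_right_mono mult_left_mono order_trans[OF ennreal_add_square_le] add_mono Mb) auto
      also have "\<dots> = 4 * Criesz * Criesz * ennreal (T\<^sup>2) * W gauss_tail * ennreal (e\<^sup>2) * W f * W g"
      proof -
        have "2 * x + 2 * x = 4 * (x::ennreal)" for x by (simp add: distrib_right[symmetric])
        from this[of "Criesz * Criesz * W f * W g"] show ?thesis by (simp add: ac_simps)
      qed
      finally show "wint (\<lambda>\<xi>. ennreal (T * e * gauss_tail \<xi>) * (M f g + M g f)) \<le> 4 * Criesz * Criesz * ennreal (T\<^sup>2) * W gauss_tail * ennreal (e\<^sup>2) * W f * W g" .
      let ?c = "Criesz * ennreal (192 * 4 * 8 * Cwt) * ennreal (e\<^sup>2) * W f * W g"
      have "wint (\<lambda>\<xi>. N f g \<xi> + N g f \<xi>) \<le> 2 * wint (N f g) + 2 * wint (N g f)"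
        by (rule wint_add) measurable
      also have "\<dots> \<le> 2 * ?c + 2 * ?c"
        using Nb[of f g] Nb[of g f] by (intro add_mono mult_left_mono) (auto simp: ac_simps)
      also have "\<dots> = 4 * ?c" by (simp add: distrib_right[symmetric])
      finally show "wint (\<lambda>\<xi>. N f g \<xi> + N g f \<xi>) \<le> 4 * Criesz * ennreal (192 * 4 * 8 * Cwt) * ennreal (e\<^sup>2) * W f * W g"
        by (simp add: mult.assoc)
    qed auto
    also have "\<dots> = C * ennreal (e\<^sup>2) * W f * W g"
      unfolding C_def by (simp add: distrib_right mult.assoc[symmetric])
    finally show "W (div_heat a e (\<lambda>y. flux f g y + flux g f y)) \<le> C * ennreal (e\<^sup>2) * W f * W g"
      unfolding F_def .
  qed
qed

section \<open>Decay of the semigroup on data with vanishing moments\<close>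

text \<open>Short and long times are separated at a = 1/2 and merged into one factor: e^2 is the
  square of the prefactor, e^2 comes from the vanishing mean, and a^(-3/2) is the short-time
  singularity. Its square root becomes the time kernel of the Duhamel integral.\<close>

lemma div_heat_bound:
  obtains C where "C < \<infinity>"
    "\<And>e f g. 0 < e \<Longrightarrow> e < 1 \<Longrightarrow> f \<in> wL2 \<Longrightarrow> g \<in> wL2 \<Longrightarrow>
      W (\<lambda>\<xi>. e * div_heat (1 - e\<^sup>2) e (\<lambda>y. flux f g y + flux g f y) \<xi>)
      \<le> C * ennreal (e ^ 4 / ((1 - e\<^sup>2) * sqrt (1 - e\<^sup>2))) * W f * W g"
proof -
  obtain C1 where C1: "C1 < \<infinity>"
    "\<And>a e f g. 1/2 \<le> a \<Longrightarrow> a \<le> 1 \<Longrightarrow> 0 < e \<Longrightarrow> e \<le> 1 \<Longrightarrow> f \<in> wL2 \<Longrightarrow> g \<in> wL2 \<Longrightarrow>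
      W (div_heat a e (\<lambda>y. flux f g y + flux g f y)) \<le> C1 * ennreal (e\<^sup>2) * W f * W g"
    using div_heat_bound_long by blast
  define C where "C = C1 + 4 * Criesz * ennreal (4 * 192 * Cwt)"
  show thesis
  proof (rule that[of C])
    show "C < \<infinity>" using C1(1) Criesz_finite by (simp add: C_def ennreal_mult_less_top)
    fix e :: real and f g :: "real^2 \<Rightarrow> real"
    assume e: "0 < e" "e < 1" and f: "f \<in> wL2" and g: "g \<in> wL2"
    have [measurable]: "f \<in> borel_measurable borel" "g \<in> borel_measurable borel" using f g by (auto simp: wL2_def)
    define a where "a = 1 - e\<^sup>2"
    have e2: "0 < e\<^sup>2" "e\<^sup>2 < 1" using e by (auto simp: power_less_one_iff)
    have a: "0 < a" "a < 1" using e2 by (auto simp: a_def)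
    define q where "q = a * sqrt a"
    have q: "0 < q" "q \<le> 1" using a by (auto simp: q_def intro!: mult_le_one)
    define F where "F y = flux f g y + flux g f y" for y
    have [measurable]: "F \<in> borel_measurable borel" unfolding F_def by measurable
    have eq: "W (\<lambda>\<xi>. e * div_heat a e F \<xi>) = ennreal (e\<^sup>2) * W (div_heat a e F)"
      by (rule W_cmult) measurable
    have "ennreal (e\<^sup>2) * W (div_heat a e F) \<le> C * ennreal (e ^ 4 / q) * W f * W g"
    proof (cases "1/2 \<le> a")
      case True
      have "ennreal (e\<^sup>2) * W (div_heat a e F) \<le> ennreal (e\<^sup>2) * (C1 * ennreal (e\<^sup>2) * W f * W g)"
        unfolding F_def using True a e f g by (intro mult_left_mono C1(2)) auto
      also have "\<dots> = C1 * (ennreal (e\<^sup>2) * ennreal (e\<^sup>2)) * W f * W g" by (simp add: ac_simps)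
      also have "\<dots> \<le> C * ennreal (e ^ 4 / q) * W f * W g"
      proof (intro mult_right_mono mult_mono)
        have "e ^ 4 * q \<le> e ^ 4" using q e by (intro mult_left_le) auto
        then have "e\<^sup>2 * e\<^sup>2 \<le> e ^ 4 / q" using q by (simp add: pos_le_divide_eq flip: power_add)
        then show "ennreal (e\<^sup>2) * ennreal (e\<^sup>2) \<le> ennreal (e ^ 4 / q)"
          by (simp add: ennreal_mult'[symmetric] ennreal_leI)
      qed (auto simp: C_def)
      finally show ?thesis .
    next
      case False
      then have e2': "1/2 \<le> e\<^sup>2" by (simp add: a_def)
      let ?c = "Criesz * ennreal (192 * Cwt / (q * e)) * W f * W g"
      have "div_heat a e F = (\<lambda>\<xi>. div_heat a e (flux f g) \<xi> + div_heat a e (flux g f) \<xi>)"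
        unfolding F_def using f g a by (intro ext div_heat_add flux_integrable) auto
      then have "W (div_heat a e F) \<le> 2 * W (div_heat a e (flux f g)) + 2 * W (div_heat a e (flux g f))"
        by (simp only:) (rule W_add, measurable)
      also have "\<dots> \<le> 2 * ?c + 2 * ?c"
        using div_heat_bound_short[of f g a e] div_heat_bound_short[of g f a e] a e
        by (intro add_mono mult_left_mono) (auto simp: q_def ac_simps)
      also have "\<dots> = 4 * ?c" by (simp add: distrib_right[symmetric])
      finally have "ennreal (e\<^sup>2) * W (div_heat a e F) \<le> ennreal (e\<^sup>2) * (4 * ?c)"
        by (rule mult_left_mono) simp
      also have "\<dots> = 4 * Criesz * (ennreal (e\<^sup>2) * ennreal (192 * Cwt / (q * e))) * W f * W g"
        by (simp add: ac_simps)
      also have "\<dots> \<le> 4 * Criesz * (ennreal (4 * 192 * Cwt) * ennreal (e ^ 4 / q)) * W f * W g"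
      proof (intro mult_right_mono mult_left_mono)
        \<comment> \<open>For e^2 \<ge> 1/2 the power e^4 is bounded below by 1/4, so the short-time
          estimate may be written with the long-time factor.\<close>
        have "1/2 * (1/2) \<le> e\<^sup>2 * e\<^sup>2" using e2' by (intro mult_mono) auto
        then have "1 \<le> 4 * e ^ 4" by (simp flip: power_add)
        then have "e \<le> 4 * e ^ 4" using e by linarith
        have "e\<^sup>2 * (192 * Cwt / (q * e)) = 192 * Cwt / q * e" using e by (simp add: power2_eq_square)
        also have "\<dots> \<le> 192 * Cwt / q * (4 * e ^ 4)" using \<open>e \<le> 4 * e ^ 4\<close> Cwt_pos q by (intro mult_left_mono) auto
        finally show "ennreal (e\<^sup>2) * ennreal (192 * Cwt / (q * e)) \<le> ennreal (4 * 192 * Cwt) * ennreal (e ^ 4 / q)"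
          using Cwt_pos by (simp add: ennreal_mult'[symmetric] ennreal_leI)
      qed auto
      also have "\<dots> = (4 * Criesz * ennreal (4 * 192 * Cwt)) * ennreal (e ^ 4 / q) * W f * W g"
        by (simp add: ac_simps)
      also have "\<dots> \<le> C * ennreal (e ^ 4 / q) * W f * W g"
        unfolding C_def by (intro mult_right_mono) auto
      finally show ?thesis .
    qed
    then show "W (\<lambda>\<xi>. e * div_heat (1 - e\<^sup>2) e (\<lambda>y. flux f g y + flux g f y) \<xi>)
      \<le> C * ennreal (e ^ 4 / ((1 - e\<^sup>2) * sqrt (1 - e\<^sup>2))) * W f * W g"
      using eq unfolding F_def a_def q_def by simp
  qed
qed

section \<open>The scalar semigroup as a heat convolution\<close>

definition heat_conv :: "real \<Rightarrow> real \<Rightarrow> (real^2 \<Rightarrow> real) \<Rightarrow> real^2 \<Rightarrow> real" where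
  "heat_conv a e f \<xi> = (\<integral>y. heat a (\<xi> - e *\<^sub>R y) * f y \<partial>lborel)"

lemma heat_conv_measurable [measurable]:
  assumes [measurable]: "f \<in> borel_measurable borel"
  shows "heat_conv a e f \<in> borel_measurable borel"
  unfolding heat_conv_def by measurable

lemma heat_conv_integrable:
  assumes f: "integrable lborel f" and a: "a > 0"
  shows "integrable lborel (\<lambda>y. heat a (\<xi> - e *\<^sub>R y) * f y)"
proof (rule Bochner_Integration.integrable_bound)
  have [measurable]: "f \<in> borel_measurable borel" using f by auto
  define K where "K = 1 / (4 * pi * a)"
  show "integrable lborel (\<lambda>y. K * f y)" using f by simp
  show "(\<lambda>y. heat a (\<xi> - e *\<^sub>R y) * f y) \<in> borel_measurable lborel" by measurable
  have "\<bar>heat a x\<bar> * \<bar>f y\<bar> \<le> \<bar>K\<bar> * \<bar>f y\<bar>" for x y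
    using heat_le[OF a, of x] heat_nonneg[OF a, of x] a by (intro mult_right_mono) (auto simp: K_def)
  then show "AE y in lborel. norm (heat a (\<xi> - e *\<^sub>R y) * f y) \<le> norm (K * f y)"
    by (simp add: abs_mult)
qed

lemma heat_conv_add:
  assumes "integrable lborel f" "integrable lborel g" "a > 0"
  shows "heat_conv a e (\<lambda>y. f y + g y) \<xi> = heat_conv a e f \<xi> + heat_conv a e g \<xi>"
  using heat_conv_integrable[OF assms(1,3)] heat_conv_integrable[OF assms(2,3)]
  by (simp add: heat_conv_def distrib_left)

lemma heat_conv_cmult: "heat_conv a e (\<lambda>y. c * f y) \<xi> = c * heat_conv a e f \<xi>"
  by (simp add: heat_conv_def mult.left_commute)

lemma heat_conv_abs_le:
  assumes [measurable]: "f \<in> borel_measurable borel" and a: "a > 0"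
  shows "ennreal \<bar>heat_conv a e f \<xi>\<bar> \<le> (\<integral>\<^sup>+y. ennreal (heat a (\<xi> - e *\<^sub>R y)) * ennreal \<bar>f y\<bar> \<partial>lborel)"
proof -
  have "ennreal (norm (heat_conv a e f \<xi>)) \<le> (\<integral>\<^sup>+y. ennreal (norm (heat a (\<xi> - e *\<^sub>R y) * f y)) \<partial>lborel)"
    unfolding heat_conv_def
  proof (cases "integrable lborel (\<lambda>y. heat a (\<xi> - e *\<^sub>R y) * f y)")
    case True
    then show "ennreal (norm (\<integral>y. heat a (\<xi> - e *\<^sub>R y) * f y \<partial>lborel)) \<le> (\<integral>\<^sup>+y. ennreal (norm (heat a (\<xi> - e *\<^sub>R y) * f y)) \<partial>lborel)"
      by (rule integral_norm_bound_ennreal)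
  qed (simp add: not_integrable_integral_eq)
  then show ?thesis using heat_nonneg[OF a] by (simp add: abs_mult ennreal_mult')
qed

lemma heat_conv_bound_short:
  assumes [measurable]: "f \<in> borel_measurable borel" and a: "0 < a" "a \<le> 1" and e: "0 < e" "e \<le> 1"
  shows "W (heat_conv a e f) \<le> ennreal (Cwt / e\<^sup>2) * W f"
proof -
  have "W (heat_conv a e f) \<le> wint (\<lambda>\<xi>. \<integral>\<^sup>+y. ennreal (heat a (\<xi> - e *\<^sub>R y)) * ennreal \<bar>f y\<bar> \<partial>lborel)"
    by (intro wint_mono heat_conv_abs_le a) auto
  also have "\<dots> \<le> ennreal (1 / e\<^sup>2) * (\<integral>\<^sup>+y. ennreal (Cwt * wt (e *\<^sub>R y)) * (ennreal \<bar>f y\<bar>)\<^sup>2 \<partial>lborel)"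
    using a e by (intro wint_heat_le) auto
  also have "\<dots> \<le> ennreal (1 / e\<^sup>2) * (ennreal Cwt * W f)"
    by (intro mult_left_mono nn_integral_wt_scale_le e) auto
  also have "\<dots> = ennreal (Cwt / e\<^sup>2) * W f"
    using Cwt_pos by (simp add: mult.assoc[symmetric] ennreal_mult'[symmetric])
  finally show ?thesis .
qed

text \<open>With both the mean and the first moments vanishing, the second-order Taylor remainder of the
  kernel is interpolated between its near and far bounds: \<open>min z\<^sup>2 z \<le> z powr (2 * \<mu>)\<close>.\<close>

lemma heat_conv_bound:
  fixes \<mu> :: real
  assumes \<mu>: "1/2 < \<mu>" "\<mu> < 1"
  obtains C where "C < \<infinity>"
    "\<And>e f. 0 < e \<Longrightarrow> e < 1 \<Longrightarrow> f \<in> wL2 \<Longrightarrow> (\<integral>y. f y \<partial>lborel) = 0 \<Longrightarrow> (\<And>c. (\<integral>y. (c \<bullet> y) * f y \<partial>lborel) = 0) \<Longrightarrow>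
      W (heat_conv (1 - e\<^sup>2) e f) \<le> C * ennreal (e powr (4 * \<mu>)) * W f"
proof -
  obtain T where T: "T > 0"
    "\<And>a x. 1/2 \<le> a \<Longrightarrow> a \<le> 1 \<Longrightarrow> heat a x \<le> T * gauss_tail x"
    "\<And>a x. 1/2 \<le> a \<Longrightarrow> a \<le> 1 \<Longrightarrow> norm (grad a x) \<le> T * gauss_tail x"
    "\<And>a x h. 1/2 \<le> a \<Longrightarrow> a \<le> 1 \<Longrightarrow> norm h \<le> 1 \<Longrightarrow> \<bar>heat a (x + h) - heat a x - grad a x \<bullet> h\<bar> \<le> T * (norm h)\<^sup>2 * gauss_tail x"
    using heat_taylor[of "1/2"] by (metis half_gt_zero zero_less_one)
  \<comment> \<open>The moment integral requires 3 - 2\<mu> > 1. The summand 16 \<open>Cwt\<close>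
    serves both the far part, as twice 8, and the short times.\<close>
  define C where "C = 2 * (ennreal ((2 * T)\<^sup>2) * decay_int (3 - 2 * \<mu>) * W gauss_tail) + ennreal (16 * Cwt)"
  show thesis
  proof (rule that[of C])
    show "C < \<infinity>" using decay_int_finite[of "3 - 2 * \<mu>"] \<mu> wint_gauss_tail_finite by (simp add: C_def ennreal_mult_less_top)
    fix e :: real and f :: "real^2 \<Rightarrow> real"
    assume e: "0 < e" "e < 1" and f: "f \<in> wL2" and f0: "(\<integral>y. f y \<partial>lborel) = 0" and f1: "\<And>c. (\<integral>y. (c \<bullet> y) * f y \<partial>lborel) = 0"
    have [measurable]: "f \<in> borel_measurable borel" using f by (auto simp: wL2_def)
    define a where "a = 1 - e\<^sup>2"
    have e2: "0 < e\<^sup>2" "e\<^sup>2 < 1" using e by (auto simp: power_less_one_iff)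
    have a: "0 < a" "a < 1" using e2 by (auto simp: a_def)
    have e4: "e ^ 4 \<le> e powr (4 * \<mu>)"
    proof -
      have "e powr 4 \<le> e powr (4 * \<mu>)" using e \<mu> by (intro powr_mono') auto
      then show ?thesis using e by simp
    qed
    have "W (heat_conv a e f) \<le> C * ennreal (e powr (4 * \<mu>)) * W f"
    proof (cases "1/2 \<le> a")
      case False
      then have e2': "1/2 \<le> e\<^sup>2" by (simp add: a_def)
      have "W (heat_conv a e f) \<le> ennreal (Cwt / e\<^sup>2) * W f"
        using a e by (intro heat_conv_bound_short) auto
      also have "\<dots> \<le> (ennreal (16 * Cwt) * ennreal (e powr (4 * \<mu>))) * W f"
      proof (intro mult_right_mono)
        have "1/2 * (1/2) \<le> e\<^sup>2 * e\<^sup>2" using e2' by (intro mult_mono) auto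
        then have 1: "1 \<le> 4 * e powr (4 * \<mu>)" using e4 by (simp flip: power_add)
        have "Cwt / e\<^sup>2 \<le> Cwt / (1/2)" using e2' e2 Cwt_pos by (intro divide_left_mono) auto
        also have "\<dots> = 2 * Cwt * 1" by simp
        also have "\<dots> \<le> 2 * Cwt * (8 * e powr (4 * \<mu>))" using 1 Cwt_pos by (intro mult_left_mono) auto
        finally show "ennreal (Cwt / e\<^sup>2) \<le> ennreal (16 * Cwt) * ennreal (e powr (4 * \<mu>))"
          using Cwt_pos by (simp add: ennreal_mult'[symmetric] ennreal_leI)
      qed auto
      also have "\<dots> \<le> C * ennreal (e powr (4 * \<mu>)) * W f"
        unfolding C_def by (intro mult_right_mono) auto
      finally show ?thesis .
    next
      case True
      have a': "1/2 \<le> a" "a \<le> 1" using True a by auto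
      define J where "J y = (1 + (norm y)\<^sup>2) powr (2 * \<mu> / 2)" for y :: "real^2"
      have [measurable]: "J \<in> borel_measurable borel" unfolding J_def by measurable
      define far where "far y = (if e * norm y < 1 then 0 else ennreal \<bar>f y\<bar>)" for y
      have [measurable]: "far \<in> borel_measurable borel" unfolding far_def by measurable
      define N where "N \<xi> = (\<integral>\<^sup>+y. ennreal (heat a (\<xi> - e *\<^sub>R y)) * far y \<partial>lborel)" for \<xi>
      have [measurable]: "N \<in> borel_measurable borel" unfolding N_def by measurable
      define M where "M = (\<integral>\<^sup>+y. ennreal (J y * \<bar>f y\<bar>) \<partial>lborel)"
      define E where "E = e powr (2 * \<mu>)"
      have E: "E > 0" "E\<^sup>2 = e powr (4 * \<mu>)" using e by (auto simp: E_def power2_eq_square powr_add[symmetric])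
      have Z: "(e * norm y) powr (2 * \<mu>) \<le> E * J y" for y
      proof -
        have "(norm y) powr (2 * \<mu>) = ((norm y)\<^sup>2) powr \<mu>" by (simp add: powr_powr[of _ 2, symmetric])
        also have "\<dots> \<le> J y" unfolding J_def using \<mu> by simp (intro powr_mono2, auto)
        finally show ?thesis using e E(1) by (simp add: powr_mult E_def)
      qed
      have diff: "\<bar>heat a (\<xi> - e *\<^sub>R y) - heat a \<xi> + grad a \<xi> \<bullet> (e *\<^sub>R y)\<bar> \<le> 2 * T * E * gauss_tail \<xi> * J y + (if e * norm y < 1 then 0 else heat a (\<xi> - e *\<^sub>R y))" for \<xi> y
      proof -
        define z where "z = e * norm y"
        have z: "z \<ge> 0" using e by (simp add: z_def)
        have zz: "2 * T * gauss_tail \<xi> * z powr (2 * \<mu>) \<le> 2 * T * E * gauss_tail \<xi> * J y"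
          using mult_left_mono[OF Z[of y], of "2 * T * gauss_tail \<xi>"] T(1) gauss_tail_nonneg[of \<xi>] by (simp add: z_def ac_simps)
        show ?thesis
        proof (cases "z < 1")
          case True
          have "\<bar>heat a (\<xi> + (- (e *\<^sub>R y))) - heat a \<xi> - grad a \<xi> \<bullet> (- (e *\<^sub>R y))\<bar> \<le> T * (norm (- (e *\<^sub>R y)))\<^sup>2 * gauss_tail \<xi>"
            using True e by (intro T(4) a') (auto simp: z_def)
          also have "\<dots> = T * gauss_tail \<xi> * z\<^sup>2" using e by (simp add: z_def power_mult_distrib)
          also have "\<dots> \<le> T * gauss_tail \<xi> * z powr (2 * \<mu>)"
          proof (intro mult_left_mono)
            have "z powr 2 \<le> z powr (2 * \<mu>)" using True z \<mu> by (intro powr_mono') auto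
            then show "z\<^sup>2 \<le> z powr (2 * \<mu>)" using z by (cases "z = 0") auto
          qed (use T(1) gauss_tail_nonneg in auto)
          also have "\<dots> \<le> 2 * T * gauss_tail \<xi> * z powr (2 * \<mu>)" using T(1) gauss_tail_nonneg[of \<xi>] by (intro mult_right_mono) auto
          also note zz
          finally show ?thesis using True by (simp add: z_def)
        next
          case False
          \<comment> \<open>For z \<ge> 1 the linear Taylor term has size \<open>z\<close>, and
            2\<mu> \<ge> 1 lets z powr (2\<mu>) dominate it as well as the constant term.\<close>
          have z1: "1 \<le> z powr (2 * \<mu>)" "z \<le> z powr (2 * \<mu>)"
            using powr_mono[of 0 "2 * \<mu>" z] powr_mono[of 1 "2 * \<mu>" z] False \<mu> by auto
          have "heat a \<xi> \<le> T * gauss_tail \<xi> * 1" using T(2)[OF a', of \<xi>] by simp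
          also have "\<dots> \<le> T * gauss_tail \<xi> * z powr (2 * \<mu>)" using z1 T(1) gauss_tail_nonneg[of \<xi>] by (intro mult_left_mono) auto
          finally have h1: "heat a \<xi> \<le> T * gauss_tail \<xi> * z powr (2 * \<mu>)" .
          have "\<bar>grad a \<xi> \<bullet> (e *\<^sub>R y)\<bar> \<le> norm (grad a \<xi>) * norm (e *\<^sub>R y)" by (rule Cauchy_Schwarz_ineq2)
          also have "\<dots> = norm (grad a \<xi>) * z" using e by (simp add: z_def)
          also have "\<dots> \<le> (T * gauss_tail \<xi>) * z powr (2 * \<mu>)" using z z1 T(1) gauss_tail_nonneg[of \<xi>] by (intro mult_mono T(3) a') auto
          finally have h2: "\<bar>grad a \<xi> \<bullet> (e *\<^sub>R y)\<bar> \<le> T * gauss_tail \<xi> * z powr (2 * \<mu>)" .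
          show ?thesis using h1 h2 zz False heat_nonneg[OF a(1), of \<xi>] heat_nonneg[OF a(1), of "\<xi> - e *\<^sub>R y"] unfolding z_def by auto
        qed
      qed
      have pw: "ennreal \<bar>heat_conv a e f \<xi>\<bar> \<le> ennreal (2 * T * E * gauss_tail \<xi>) * M + N \<xi>" for \<xi>
      proof -
        have i1: "integrable lborel (\<lambda>y. heat a (\<xi> - e *\<^sub>R y) * f y)" using wL2_integrable[OF f] a by (intro heat_conv_integrable) auto
        have i2: "integrable lborel (\<lambda>y. heat a \<xi> * f y)" using wL2_integrable[OF f] by simp
        have i3: "integrable lborel (\<lambda>y. ((e *\<^sub>R grad a \<xi>) \<bullet> y) * f y)" using wL2_moment_integrable[OF f] .
        have eqf: "(heat a (\<xi> - e *\<^sub>R y) - heat a \<xi> + grad a \<xi> \<bullet> (e *\<^sub>R y)) * f y = (heat a (\<xi> - e *\<^sub>R y) * f y - heat a \<xi> * f y) + ((e *\<^sub>R grad a \<xi>) \<bullet> y) * f y" for y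
          by (simp add: algebra_simps)
        have i4: "integrable lborel (\<lambda>y. (heat a (\<xi> - e *\<^sub>R y) - heat a \<xi> + grad a \<xi> \<bullet> (e *\<^sub>R y)) * f y)"
          unfolding eqf using i1 i2 i3 by auto
        have "(\<integral>y. (heat a (\<xi> - e *\<^sub>R y) - heat a \<xi> + grad a \<xi> \<bullet> (e *\<^sub>R y)) * f y \<partial>lborel)
          = (\<integral>y. heat a (\<xi> - e *\<^sub>R y) * f y \<partial>lborel) - (\<integral>y. heat a \<xi> * f y \<partial>lborel) + (\<integral>y. ((e *\<^sub>R grad a \<xi>) \<bullet> y) * f y \<partial>lborel)"
          unfolding eqf using i1 i2 i3 by (simp only: Bochner_Integration.integral_add Bochner_Integration.integral_diff Bochner_Integration.integrable_diff)
        also have "\<dots> = heat_conv a e f \<xi>"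
          using f1[of "e *\<^sub>R grad a \<xi>"] f0 by (simp only: heat_conv_def integral_mult_right_zero)
        finally have S: "heat_conv a e f \<xi> = (\<integral>y. (heat a (\<xi> - e *\<^sub>R y) - heat a \<xi> + grad a \<xi> \<bullet> (e *\<^sub>R y)) * f y \<partial>lborel)" ..
        have "ennreal \<bar>heat_conv a e f \<xi>\<bar> \<le> (\<integral>\<^sup>+y. ennreal (norm ((heat a (\<xi> - e *\<^sub>R y) - heat a \<xi> + grad a \<xi> \<bullet> (e *\<^sub>R y)) * f y)) \<partial>lborel)"
          using integral_norm_bound_ennreal[OF i4] S by simp
        also have "\<dots> \<le> (\<integral>\<^sup>+y. ennreal (2 * T * E * gauss_tail \<xi>) * ennreal (J y * \<bar>f y\<bar>) + ennreal (heat a (\<xi> - e *\<^sub>R y)) * far y \<partial>lborel)"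
        proof (rule nn_integral_mono)
          fix y
          have "norm ((heat a (\<xi> - e *\<^sub>R y) - heat a \<xi> + grad a \<xi> \<bullet> (e *\<^sub>R y)) * f y)
            \<le> (2 * T * E * gauss_tail \<xi> * J y + (if e * norm y < 1 then 0 else heat a (\<xi> - e *\<^sub>R y))) * \<bar>f y\<bar>"
            unfolding real_norm_def abs_mult by (intro mult_right_mono diff) auto
          then have "ennreal (norm ((heat a (\<xi> - e *\<^sub>R y) - heat a \<xi> + grad a \<xi> \<bullet> (e *\<^sub>R y)) * f y))
            \<le> ennreal (2 * T * E * gauss_tail \<xi> * (J y * \<bar>f y\<bar>) + (if e * norm y < 1 then 0 else heat a (\<xi> - e *\<^sub>R y)) * \<bar>f y\<bar>)"
            by (intro ennreal_leI) (simp add: algebra_simps)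
          also have "\<dots> = ennreal (2 * T * E * gauss_tail \<xi> * (J y * \<bar>f y\<bar>)) + ennreal ((if e * norm y < 1 then 0 else heat a (\<xi> - e *\<^sub>R y)) * \<bar>f y\<bar>)"
            using T(1) E(1) gauss_tail_nonneg[of \<xi>] heat_nonneg[OF a(1)] by (intro ennreal_plus) (auto simp: J_def)
          also have "\<dots> = ennreal (2 * T * E * gauss_tail \<xi>) * ennreal (J y * \<bar>f y\<bar>) + ennreal (heat a (\<xi> - e *\<^sub>R y)) * far y"
            using T(1) E(1) gauss_tail_nonneg[of \<xi>] heat_nonneg[OF a(1)] by (simp add: ennreal_mult' far_def)
          finally show "ennreal (norm ((heat a (\<xi> - e *\<^sub>R y) - heat a \<xi> + grad a \<xi> \<bullet> (e *\<^sub>R y)) * f y)) \<le> \<dots>" .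
        qed
        also have "\<dots> = ennreal (2 * T * E * gauss_tail \<xi>) * M + N \<xi>"
          unfolding M_def N_def by (subst nn_integral_add) (auto simp: nn_integral_cmult)
        finally show ?thesis .
      qed
      have "W (heat_conv a e f) \<le> wint (\<lambda>\<xi>. ennreal (2 * T * E * gauss_tail \<xi>) * M + N \<xi>)"
        by (rule wint_mono) (rule pw)
      also have "\<dots> \<le> 2 * wint (\<lambda>\<xi>. ennreal (2 * T * E * gauss_tail \<xi>) * M) + 2 * wint N"
        by (rule wint_add) measurable
      also have "\<dots> \<le> 2 * (ennreal ((2 * T)\<^sup>2) * decay_int (3 - 2 * \<mu>) * W gauss_tail * ennreal (e powr (4 * \<mu>)) * W f) + 2 * (ennreal (8 * Cwt) * ennreal (e powr (4 * \<mu>)) * W f)"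
      proof (intro add_mono mult_left_mono)
        have "wint (\<lambda>\<xi>. ennreal (2 * T * E * gauss_tail \<xi>) * M) = wint (\<lambda>\<xi>. (ennreal (2 * T * E) * M) * ennreal \<bar>gauss_tail \<xi>\<bar>)"
          using T(1) E gauss_tail_nonneg by (simp add: ennreal_mult' ac_simps)
        also have "\<dots> = (ennreal (2 * T * E) * M)\<^sup>2 * W gauss_tail" by (rule wint_cmult) measurable
        also have "\<dots> = ennreal ((2 * T)\<^sup>2) * ennreal (E\<^sup>2) * M\<^sup>2 * W gauss_tail"
        proof -
          have "(ennreal (2 * T * E))\<^sup>2 = ennreal ((2 * T * E)\<^sup>2)"
            using T(1) E(1) by (intro ennreal_power) auto
          also have "\<dots> = ennreal ((2 * T)\<^sup>2) * ennreal (E\<^sup>2)"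
            by (subst ennreal_mult'[symmetric]) (rule zero_le_power2, simp add: power_mult_distrib)
          finally show ?thesis by (simp only: power_mult_distrib)
        qed
        also have "\<dots> \<le> ennreal ((2 * T)\<^sup>2) * ennreal (E\<^sup>2) * (decay_int (3 - 2 * \<mu>) * W f) * W gauss_tail"
          unfolding M_def J_def by (intro mult_right_mono mult_left_mono moment_bound) auto
        finally show "wint (\<lambda>\<xi>. ennreal (2 * T * E * gauss_tail \<xi>) * M) \<le> ennreal ((2 * T)\<^sup>2) * decay_int (3 - 2 * \<mu>) * W gauss_tail * ennreal (e powr (4 * \<mu>)) * W f"
          by (simp add: E(2) ac_simps)
        have "wint N \<le> ennreal (1 / e\<^sup>2) * (\<integral>\<^sup>+y. ennreal (Cwt * wt (e *\<^sub>R y)) * (far y)\<^sup>2 \<partial>lborel)"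
          unfolding N_def using a e by (intro wint_heat_le) auto
        also have "\<dots> \<le> ennreal (1 / e\<^sup>2) * (ennreal (8 * e ^ 6 * Cwt) * wint far)"
          using e by (intro mult_left_mono nn_integral_wt_scale_far) (auto simp: far_def)
        also have "\<dots> \<le> ennreal (1 / e\<^sup>2) * (ennreal (8 * e ^ 6 * Cwt) * W f)"
          by (intro mult_left_mono wint_mono) (auto simp: far_def)
        also have "\<dots> = ennreal (1 / e\<^sup>2 * (8 * e ^ 6 * Cwt)) * W f"
          using e Cwt_pos by (simp add: mult.assoc[symmetric] ennreal_mult'[symmetric])
        \<comment> \<open>The far gain e^6 minus the kernel mass 1/e^2 leaves e^4, which is better
          than the exponent 4\<mu> of the near part.\<close>
        also have "1 / e\<^sup>2 * (8 * e ^ 6 * Cwt) = 8 * Cwt * e ^ 4"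
          using e by (simp add: numeral_eq_Suc)
        also have "ennreal (8 * Cwt * e ^ 4) * W f \<le> ennreal (8 * Cwt * e powr (4 * \<mu>)) * W f"
          using e4 Cwt_pos by (intro mult_right_mono ennreal_leI mult_left_mono) auto
        finally show "wint N \<le> ennreal (8 * Cwt) * ennreal (e powr (4 * \<mu>)) * W f"
          using Cwt_pos by (simp add: ennreal_mult')
      qed auto
      also have "\<dots> = C * ennreal (e powr (4 * \<mu>)) * W f"
      proof -
        have "ennreal (16 * Cwt) = 2 * ennreal (8 * Cwt)"
          using Cwt_pos by (simp add: ennreal_mult'[symmetric] flip: ennreal_numeral)
        then show ?thesis unfolding C_def by (simp add: distrib_right mult.assoc)
      qed
      finally show ?thesis .
    qed
    then show "W (heat_conv (1 - e\<^sup>2) e f) \<le> C * ennreal (e powr (4 * \<mu>)) * W f" unfolding a_def .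
  qed
qed

section \<open>Stationarity of the Gaussian\<close>

lemma heat_wL2: "0 < a \<Longrightarrow> a \<le> 1 \<Longrightarrow> heat a \<in> wL2"
proof -
  assume a: "0 < a" "a \<le> 1"
  obtain T where "\<And>b x. a \<le> b \<Longrightarrow> b \<le> 1 \<Longrightarrow> heat b x \<le> T * gauss_tail x" "T > 0"
    using heat_taylor[OF a(1)] by metis
  then have "\<bar>heat a x\<bar> \<le> \<bar>T * gauss_tail x\<bar>" for x
    using a heat_nonneg[OF a(1), of x] by (metis abs_ge_self abs_of_nonneg order_refl order_trans)
  then show "heat a \<in> wL2" using wL2_cmult[OF gauss_tail_wL2, of T] by (auto intro: wL2_bound)
qed

lemma G_measurable [measurable]: "G \<in> borel_measurable borel"
  by (simp add: G_eq_heat)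

text \<open>Minus twice the derivative of \<open>G\<close> in direction \<open>c\<close>; these
  functions are the semigroup eigenfunctions with eigenvalue exp(-\<tau>/2).\<close>

definition momG :: "real^2 \<Rightarrow> real^2 \<Rightarrow> real" where "momG c y = (c \<bullet> y) * G y"

lemma momG_measurable [measurable]: "momG c \<in> borel_measurable borel"
  unfolding momG_def by measurable

lemma G_taylor:
  obtains T where "T > 0" "\<And>x. \<bar>G x\<bar> \<le> T * gauss_tail x" "\<And>c x. \<bar>momG c x\<bar> \<le> T * norm c * gauss_tail x"
    "\<And>x h. norm h \<le> 1 \<Longrightarrow> \<bar>G (x + h) - G x + 1/2 * momG h x\<bar> \<le> T * (norm h)\<^sup>2 * gauss_tail x"
proof -
  obtain T where T: "T > 0"
    "\<And>a x. 1 \<le> a \<Longrightarrow> a \<le> 1 \<Longrightarrow> heat a x \<le> T * gauss_tail x"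
    "\<And>a x. 1 \<le> a \<Longrightarrow> a \<le> 1 \<Longrightarrow> norm (grad a x) \<le> T * gauss_tail x"
    "\<And>a x h. 1 \<le> a \<Longrightarrow> a \<le> 1 \<Longrightarrow> norm h \<le> 1 \<Longrightarrow> \<bar>heat a (x + h) - heat a x - grad a x \<bullet> h\<bar> \<le> T * (norm h)\<^sup>2 * gauss_tail x"
    using heat_taylor[of 1] by (metis zero_less_one)
  have lg: "grad 1 x \<bullet> h = - 1/2 * momG h x" for x h
    by (simp add: grad_def momG_def G_eq_heat inner_commute)
  show thesis
  proof (rule that[of "2 * T"])
    fix x c :: "real^2"
    have g: "T * gauss_tail x \<ge> 0" "gauss_tail x \<ge> 0" using T(1) gauss_tail_nonneg[of x] by auto
    show "\<bar>G x\<bar> \<le> 2 * T * gauss_tail x"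
      using T(2)[of 1 x] heat_nonneg[of 1 x] g by (simp add: G_eq_heat)
    have "\<bar>momG c x\<bar> = 2 * \<bar>grad 1 x \<bullet> c\<bar>" by (simp add: lg)
    also have "\<dots> \<le> 2 * (norm (grad 1 x) * norm c)" by (intro mult_left_mono Cauchy_Schwarz_ineq2) auto
    also have "\<dots> \<le> 2 * (T * gauss_tail x * norm c)" using T(3)[of 1 x] by (intro mult_left_mono mult_right_mono) auto
    finally show "\<bar>momG c x\<bar> \<le> 2 * T * norm c * gauss_tail x" by (simp add: ac_simps)
    fix h :: "real^2" assume h: "norm h \<le> 1"
    have "\<bar>G (x + h) - G x + 1/2 * momG h x\<bar> \<le> T * (norm h)\<^sup>2 * gauss_tail x"
      using T(4)[of 1 h x] h by (simp add: G_eq_heat[symmetric] lg)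
    also have "\<dots> \<le> 2 * T * (norm h)\<^sup>2 * gauss_tail x" using T(1) g by (intro mult_right_mono) auto
    finally show "\<bar>G (x + h) - G x + 1/2 * momG h x\<bar> \<le> 2 * T * (norm h)\<^sup>2 * gauss_tail x" .
  qed (use T in auto)
qed

lemma G_wL2: "G \<in> wL2"
  by (simp add: G_eq_heat heat_wL2)

lemma momG_wL2: "momG c \<in> wL2"
proof -
  obtain T where T: "\<And>c x. \<bar>momG c x\<bar> \<le> T * norm c * gauss_tail x" using G_taylor by metis
  have "\<bar>momG c x\<bar> \<le> \<bar>(T * norm c) * gauss_tail x\<bar>" for x using T[of c x] by linarith
  then show ?thesis using wL2_cmult[OF gauss_tail_wL2, of "T * norm c"] by (auto intro: wL2_bound)
qed

section \<open>Eigenfunctions of the semigroup and Gaussian moments\<close>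

lemma integral_odd_heat: "(\<integral>y. (c \<bullet> y) * heat a y \<partial>lborel) = 0"
  using integral_affine[of "-1" "\<lambda>y. (c \<bullet> y) * heat a y" 0] by simp

text \<open>Detailed balance of the Mehler kernel with respect to \<open>G\<close>. Integrals of the
  kernel against \<open>G\<close> times a function become averages over a Gaussian centred at
  \<open>e *\<^sub>R \<xi>\<close>.\<close>

lemma heat_complete_square:
  assumes e: "0 < e" "e < 1"
  shows "heat (1 - e\<^sup>2) (\<xi> - e *\<^sub>R y) * G y = G \<xi> * heat (1 - e\<^sup>2) (y - e *\<^sub>R \<xi>)"
proof -
  define a where "a = 1 - e\<^sup>2"
  have e2: "0 < e\<^sup>2" "e\<^sup>2 < 1" using e by (auto simp: power_less_one_iff)
  have a: "a > 0" "a \<noteq> 0" "e * e = 1 - a" using e2 by (auto simp: a_def power2_eq_square)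
  have n1: "(norm (\<xi> - e *\<^sub>R y))\<^sup>2 = \<xi> \<bullet> \<xi> - 2 * e * (\<xi> \<bullet> y) + (e * e) * (y \<bullet> y)"
   and n2: "(norm (y - e *\<^sub>R \<xi>))\<^sup>2 = y \<bullet> y - 2 * e * (\<xi> \<bullet> y) + (e * e) * (\<xi> \<bullet> \<xi>)"
    by (simp_all add: power2_norm_eq_inner inner_diff inner_commute algebra_simps)
  have "- (norm (\<xi> - e *\<^sub>R y))\<^sup>2 / (4 * a) + - (norm y)\<^sup>2 / 4 = - (norm \<xi>)\<^sup>2 / 4 + - (norm (y - e *\<^sub>R \<xi>))\<^sup>2 / (4 * a)"
    unfolding n1 n2 a(3) power2_norm_eq_inner[of y] power2_norm_eq_inner[of \<xi>] using a(2) by (simp add: field_simps)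
  then show ?thesis
    unfolding a_def[symmetric] heat_def G_def by (simp add: mult_exp_exp)
qed

lemma heat_conv_G:
  assumes e: "0 < e" "e < 1"
  shows "heat_conv (1 - e\<^sup>2) e G \<xi> = G \<xi>"
proof -
  have a: "1 - e\<^sup>2 > 0" using e by (simp add: power_less_one_iff)
  have "(\<integral>y. heat (1 - e\<^sup>2) (y - e *\<^sub>R \<xi>) \<partial>lborel) = 1"
    using integral_affine[of 1 "heat (1 - e\<^sup>2)" "- (e *\<^sub>R \<xi>)"] integral_heat[OF a] by simp
  then show ?thesis by (simp add: heat_conv_def heat_complete_square[OF e])
qed

text \<open>After the exchange of \<open>heat_complete_square\<close> the integral is a first moment
  of a Gaussian of mean \<open>e *\<^sub>R \<xi>\<close>, which yields the eigenvalue
  \<open>e\<close>.\<close>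

lemma heat_conv_momG:
  assumes e: "0 < e" "e < 1"
  shows "heat_conv (1 - e\<^sup>2) e (momG c) \<xi> = e * momG c \<xi>"
proof -
  define a where "a = 1 - e\<^sup>2"
  have a: "a > 0" "a \<le> 1" using e by (auto simp: a_def power_less_one_iff)
  have "heat_conv a e (momG c) \<xi> = G \<xi> * (\<integral>y. (c \<bullet> y) * heat a (y - e *\<^sub>R \<xi>) \<partial>lborel)"
  proof -
    have "heat a (\<xi> - e *\<^sub>R y) * momG c y = G \<xi> * ((c \<bullet> y) * heat a (y - e *\<^sub>R \<xi>))" for y
      using heat_complete_square[OF e, of \<xi> y] unfolding a_def momG_def by (simp add: ac_simps)
    then show ?thesis by (simp add: heat_conv_def)
  qed
  also have "(\<integral>y. (c \<bullet> y) * heat a (y - e *\<^sub>R \<xi>) \<partial>lborel) = (\<integral>z. (c \<bullet> (e *\<^sub>R \<xi> + z)) * heat a z \<partial>lborel)"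
    using integral_affine[of 1 "\<lambda>y. (c \<bullet> y) * heat a (y - e *\<^sub>R \<xi>)" "e *\<^sub>R \<xi>"] by simp
  also have "\<dots> = (\<integral>z. e * (c \<bullet> \<xi>) * heat a z + (c \<bullet> z) * heat a z \<partial>lborel)"
    by (simp add: inner_add_right distrib_right)
  also have "\<dots> = e * (c \<bullet> \<xi>)"
    using integrable_heat[OF a(1)] wL2_moment_integrable[OF heat_wL2[OF a], of c]
    by (simp add: integral_heat[OF a(1)] integral_odd_heat)
  finally show ?thesis unfolding a_def momG_def[of c \<xi>] by (simp add: mult.commute mult.left_commute)
qed

lemma integral_G: "(\<integral>y. G y \<partial>lborel) = 1"
  by (simp add: G_eq_heat integral_heat)

lemma integral_momG: "(\<integral>y. momG c y \<partial>lborel) = 0"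
  by (simp add: momG_def G_eq_heat integral_odd_heat)

lemma integral_G_square:
  "(\<integral>y. (y $ i)\<^sup>2 * G y \<partial>lborel) = 2"
proof -
  let ?n = "normal_density 0 (sqrt 2)"
  have s: "0 < sqrt (2::real)" by simp
  have hb: "has_bochner_integral lborel (\<lambda>x. ?n x * x\<^sup>2) 2"
    using normal_moment_even[OF s, of 0 1] by (simp add: fact_numeral)
  then have n2: "(\<integral>\<^sup>+x. ennreal (?n x * x\<^sup>2) \<partial>lborel) = 2"
    by (subst nn_integral_eq_integral) (auto simp: has_bochner_integral_iff)
  have n0: "(\<integral>\<^sup>+x. ennreal (?n x) \<partial>lborel) = 1" by (rule nn_integral_normal) simp
  have G: "G y = ?n (y$1) * ?n (y$2)" for y
    using heat_eq_normal[of 1 y] by (simp add: G_eq_heat)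
  have "(\<integral>\<^sup>+y. ennreal ((y $ i)\<^sup>2 * G y) \<partial>lborel) = 2"
  proof (cases "i = 1")
    case True
    have "(\<integral>\<^sup>+y. ennreal ((y $ 1)\<^sup>2 * G y) \<partial>lborel) = (\<integral>\<^sup>+y. ennreal (?n (y$1) * (y$1)\<^sup>2) * ennreal (?n (y$2)) \<partial>leb2)"
      by (intro nn_integral_cong) (simp add: G ennreal_mult'[symmetric] ac_simps)
    also have "\<dots> = 2" by (subst nn_integral_plane_prod) (auto simp: n2 n0)
    finally show ?thesis using True by simp
  next
    case False
    then have i: "i = 2" using exhaust_2[of i] by auto
    have "(\<integral>\<^sup>+y. ennreal ((y $ 2)\<^sup>2 * G y) \<partial>lborel) = (\<integral>\<^sup>+y. ennreal (?n (y$1)) * ennreal (?n (y$2) * (y$2)\<^sup>2) \<partial>leb2)"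
      by (intro nn_integral_cong) (simp add: G ennreal_mult'[symmetric] ac_simps)
    also have "\<dots> = 2" by (subst nn_integral_plane_prod) (auto simp: n2 n0)
    finally show ?thesis using i by simp
  qed
  then show ?thesis
    by (subst integral_eq_nn_integral) (auto simp: G_eq_heat heat_nonneg)
qed

section \<open>Reflection symmetry and stationarity of the Gaussian\<close>

definition reflection :: "real^2 \<Rightarrow> real^2 \<Rightarrow> real^2" where
  "reflection p x = x - (2 * (x \<bullet> p) / (p \<bullet> p)) *\<^sub>R p"

lemma linear_reflection: "linear (reflection p)"
  by (rule linearI) (simp_all add: reflection_def algebra_simps add_divide_distrib)

lemma inner_reflection: "reflection p x \<bullet> reflection p y = x \<bullet> y"
  by (cases "p = 0") (simp_all add: reflection_def inner_diff_left inner_diff_right inner_commute field_simps)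

text \<open>At \<open>p = 0\<close> division by zero makes the reflection the identity, so
  orthogonality holds for every \<open>p\<close>.\<close>

lemma orthogonal_reflection: "orthogonal_transformation (reflection p)"
  by (simp add: orthogonal_transformation_def linear_reflection inner_reflection)

lemma reflection_reflection: "reflection p (reflection p x) = x"
  by (cases "p = 0") (simp_all add: reflection_def inner_diff_left algebra_simps flip: scaleR_add_left)

lemma norm_reflection: "norm (reflection p x) = norm x"
  by (simp add: norm_eq_sqrt_inner inner_reflection)

lemma reflection_measurable [measurable]: "reflection p \<in> borel_measurable borel"
  unfolding reflection_def by measurable

lemma reflection_diff: "reflection p (x - y) = reflection p x - reflection p y"
  using linear_reflection by (rule linear_diff)

lemma reflection_scale: "reflection p (c *\<^sub>R x) = c *\<^sub>R reflection p x"
  using linear_reflection by (rule linear_cmul)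

lemma reflection_perp_fixed: "reflection (perp x) x = x"
  by (simp add: reflection_def inner_plane)

text \<open>A genuine reflection reverses orientation and therefore anticommutes with the quarter
  turn.\<close>

lemma perp_reflection:
  assumes "p \<noteq> 0"
  shows "perp (reflection p x) = - reflection p (perp x)"
proof -
  have "(p$1)\<^sup>2 + (p$2)\<^sup>2 \<noteq> 0"
    using assms by (simp only: norm_plane[symmetric]) simp
  then have n: "p$1 * p$1 + p$2 * p$2 \<noteq> 0" by (simp add: power2_eq_square)
  show ?thesis
    unfolding vec_eq_iff forall_2 reflection_def inner_plane using n
    by (simp add: field_simps)
qed

lemma G_norm: "norm x = norm y \<Longrightarrow> G x = G y"
  by (simp add: G_def)

lemma integral_G_cross: "(\<integral>y. (y $ 1 * y $ 2) * G y \<partial>lborel) = 0"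
proof -
  let ?R = "reflection (axis 1 1)"
  have R: "?R y $ 1 = - (y$1)" "?R y $ 2 = y$2" for y
    by (simp_all add: reflection_def inner_plane axis_def)
  have "(\<integral>y. (?R y $ 1 * ?R y $ 2) * G (?R y) \<partial>lborel) = (\<integral>y. (y $ 1 * y $ 2) * G y \<partial>lborel)"
    by (rule integral_orthogonal[OF orthogonal_reflection]) measurable
  moreover have "G (?R y) = G y" for y by (intro G_norm norm_reflection)
  ultimately show ?thesis by (simp add: R)
qed

text \<open>The factor 2 is the variance of a coordinate under \<open>G\<close>; it is the reason
  why first moments enter the expansion halved.\<close>

lemma integral_momG_moment: "(\<integral>y. (c \<bullet> y) * momG d y \<partial>lborel) = 2 * (c \<bullet> d)"
proof -
  have i: "integrable lborel (\<lambda>y. (y $ j) * momG d y)" for j and d :: "real^2"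
    using wL2_moment_integrable[OF momG_wL2, of "axis j 1" d] by (simp add: inner_axis')
  have ij: "integrable lborel (\<lambda>y. (y $ j * y $ k) * G y)" for j k
    using i[of j "axis k 1"] by (simp add: momG_def inner_axis' mult.assoc)
  have sq: "integrable lborel (\<lambda>y. (y $ j)\<^sup>2 * G y)" for j using ij[of j j] by (simp add: power2_eq_square)
  have "(\<lambda>y. (c \<bullet> y) * momG d y) = (\<lambda>y. (c$1 * d$1) * ((y$1)\<^sup>2 * G y) + (c$2 * d$2) * ((y$2)\<^sup>2 * G y) + (c$1 * d$2 + c$2 * d$1) * ((y$1 * y$2) * G y))"
    by (rule ext) (simp add: inner_plane momG_def power2_eq_square algebra_simps)
  then show ?thesis
    using sq ij by (simp add: integral_G_square integral_G_cross inner_plane)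
qed

lemma bs_kernel_reflection: "p \<noteq> 0 \<Longrightarrow> bs_kernel (reflection p x) = - reflection p (bs_kernel x)"
  by (simp add: bs_kernel_def norm_reflection perp_reflection reflection_scale)

text \<open>\<open>G\<close> is radial and the kernel changes by a sign because it contains a
  quarter turn: the velocity of a radial vortex is a pseudovector field.\<close>

lemma biot_savart_G_reflection:
  assumes p: "p \<noteq> 0"
  shows "biot_savart G (reflection p x) = - reflection p (biot_savart G x)"
proof -
  have "(\<integral>y. G y *\<^sub>R bs_kernel (reflection p x - y) \<partial>lborel) = (\<integral>y. G (reflection p y) *\<^sub>R bs_kernel (reflection p x - reflection p y) \<partial>lborel)"
    by (rule integral_orthogonal[OF orthogonal_reflection, symmetric]) measurable
  also have "\<dots> = (\<integral>y. - reflection p (G y *\<^sub>R bs_kernel (x - y)) \<partial>lborel)"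
    using G_norm[OF norm_reflection] p by (simp add: bs_kernel_reflection reflection_scale flip: reflection_diff)
  also have "\<dots> = - reflection p (\<integral>y. G y *\<^sub>R bs_kernel (x - y) \<partial>lborel)"
    using linear_reflection[of p] reflection_reflection
    by (subst integral_minus, subst integral_bounded_linear'[of "reflection p" "reflection p"])
       (auto simp: linear_conv_bounded_linear)
  finally show ?thesis
    by (simp add: biot_savart_lborel reflection_scale)
qed

lemma perp_eq_0: "perp x = 0 \<longleftrightarrow> x = 0"
  by (metis norm_eq_zero norm_perp)

text \<open>The reflection fixing \<open>y\<close> changes the sign of the radial component at
  \<open>y\<close>, so it vanishes without computing the velocity.\<close>

lemma inner_biot_savart_G: "y \<bullet> biot_savart G y = 0"
proof (cases "y = 0")
  case False
  let ?R = "reflection (perp y)"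
  have "y \<bullet> biot_savart G y = ?R y \<bullet> biot_savart G (?R y)" by (simp add: reflection_perp_fixed)
  also have "\<dots> = - (y \<bullet> biot_savart G y)"
    using False by (simp only: biot_savart_G_reflection perp_eq_0 inner_minus_right inner_reflection not_False_eq_True)
  finally show ?thesis by simp
qed simp

text \<open>Tangentiality removes the part of the gradient pointing along \<open>y\<close>. The
  remaining kernel, recentred at \<open>e *\<^sub>R \<xi>\<close>, is invariant under the reflection
  fixing \<xi>, while the component of the velocity along \<xi> is odd.\<close>

lemma div_heat_G_G:
  assumes e: "0 < e" "e < 1"
  shows "div_heat (1 - e\<^sup>2) e (flux G G) \<xi> = 0"
proof -
  define a where "a = 1 - e\<^sup>2"
  define k where "k y = heat a (y - e *\<^sub>R \<xi>) * (\<xi> \<bullet> biot_savart G y)" for y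
  have [measurable]: "k \<in> borel_measurable borel" unfolding k_def by measurable
  let ?R = "reflection (perp \<xi>)"
  have "k (?R y) = - k y" for y
  proof (cases "\<xi> = 0")
    case False
    have "norm (?R y - e *\<^sub>R \<xi>) = norm (?R (y - e *\<^sub>R \<xi>))"
      by (simp add: reflection_diff reflection_scale reflection_perp_fixed)
    then have "heat a (?R y - e *\<^sub>R \<xi>) = heat a (y - e *\<^sub>R \<xi>)" by (simp add: heat_def norm_reflection)
    moreover have "\<xi> \<bullet> biot_savart G (?R y) = - (?R \<xi> \<bullet> ?R (biot_savart G y))"
      using False by (simp add: biot_savart_G_reflection reflection_perp_fixed perp_eq_0)
    ultimately show ?thesis by (simp add: k_def inner_reflection)
  qed (simp add: k_def)
  then have "(\<integral>y. k y \<partial>lborel) = - (\<integral>y. k y \<partial>lborel)"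
    using integral_orthogonal[OF orthogonal_reflection[of "perp \<xi>"], of k] by simp
  then have k0: "(\<integral>y. k y \<partial>lborel) = 0" by simp
  have "grad a (\<xi> - e *\<^sub>R y) \<bullet> flux G G y = (- G \<xi> / (2 * a)) * k y" for y
  proof -
    have "grad a (\<xi> - e *\<^sub>R y) \<bullet> flux G G y = (- 1 / (2 * a)) * (heat a (\<xi> - e *\<^sub>R y) * G y) * ((\<xi> - e *\<^sub>R y) \<bullet> biot_savart G y)"
      by (simp add: grad_def flux_def)
    also have "(\<xi> - e *\<^sub>R y) \<bullet> biot_savart G y = \<xi> \<bullet> biot_savart G y"
      by (simp add: inner_diff_left inner_biot_savart_G)
    finally show ?thesis using heat_complete_square[OF e, of \<xi> y] by (simp add: k_def a_def)
  qed
  then show ?thesis unfolding div_heat_def a_def[symmetric] by (simp add: k0)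
qed

section \<open>Translated Gaussians and the cross term\<close>

lemma biot_savart_shift:
  assumes [measurable]: "f \<in> borel_measurable borel"
  shows "biot_savart (\<lambda>y. f (y + h)) x = biot_savart f (x + h)"
proof -
  have "(\<integral>y. f y *\<^sub>R bs_kernel (x + h - y) \<partial>lborel) = (\<integral>y. f (y + h) *\<^sub>R bs_kernel (x - y) \<partial>lborel)"
    using integral_affine[of 1 "\<lambda>y. f y *\<^sub>R bs_kernel (x + h - y)" h] by (simp add: add.commute)
  then show ?thesis by (simp add: biot_savart_lborel)
qed

text \<open>Shifting both arguments by \<open>h\<close> shifts the output by
  \<open>e *\<^sub>R h\<close>, and the unshifted expression vanishes at every point.\<close>

lemma div_heat_shift_G:
  assumes e: "0 < e" "e < 1"
  shows "div_heat (1 - e\<^sup>2) e (flux (\<lambda>y. G (y + h)) (\<lambda>y. G (y + h))) \<xi> = 0"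
proof -
  define a where "a = 1 - e\<^sup>2"
  have "div_heat a e (flux (\<lambda>y. G (y + h)) (\<lambda>y. G (y + h))) \<xi> = (\<integral>y. grad a (\<xi> - e *\<^sub>R y) \<bullet> flux G G (y + h) \<partial>lborel)"
    by (simp add: div_heat_def flux_def biot_savart_shift)
  also have "\<dots> = (\<integral>y. grad a (\<xi> + e *\<^sub>R h - e *\<^sub>R y) \<bullet> flux G G y \<partial>lborel)"
    using integral_affine[of 1 "\<lambda>y. grad a (\<xi> + e *\<^sub>R h - e *\<^sub>R y) \<bullet> flux G G y" h]
    by (simp add: algebra_simps)
  also have "\<dots> = div_heat a e (flux G G) (\<xi> + e *\<^sub>R h)" by (simp add: div_heat_def)
  finally show ?thesis using div_heat_G_G[OF e] by (simp add: a_def)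
qed

lemma div_heat_flux_add:
  assumes "a > 0" "f1 \<in> wL2" "f2 \<in> wL2" "g1 \<in> wL2" "g2 \<in> wL2"
  shows "div_heat a e (flux (\<lambda>y. f1 y + f2 y) (\<lambda>y. g1 y + g2 y)) \<xi> =
     div_heat a e (flux f1 g1) \<xi> + div_heat a e (flux f1 g2) \<xi> + div_heat a e (flux f2 g1) \<xi> + div_heat a e (flux f2 g2) \<xi>"
proof -
  note [measurable] = wL2_measurable[OF assms(2)] wL2_measurable[OF assms(3)] wL2_measurable[OF assms(4)] wL2_measurable[OF assms(5)]
  let ?F = "\<lambda>y. (flux f1 g1 y + flux f1 g2 y) + (flux f2 g1 y + flux f2 g2 y)"
  have "div_heat a e (flux (\<lambda>y. f1 y + f2 y) (\<lambda>y. g1 y + g2 y)) = div_heat a e ?F"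
  proof (rule div_heat_cong_AE)
    show "AE y in lborel. flux (\<lambda>y. f1 y + f2 y) (\<lambda>y. g1 y + g2 y) y = ?F y"
      using flux_add_left[OF assms(2,3), of g1] flux_add_left[OF assms(2,3), of g2]
      by eventually_elim (simp add: flux_add_right)
  qed measurable
  then show ?thesis
    using assms by (simp add: div_heat_add flux_integrable)
qed

lemma div_heat_flux_cmult:
  assumes [measurable]: "f \<in> borel_measurable borel"
  shows "div_heat a e (flux (\<lambda>y. c * f y) (\<lambda>y. d * g y)) \<xi> = c * d * div_heat a e (flux f g) \<xi>"
proof -
  have "flux (\<lambda>y. c * f y) (\<lambda>y. d * g y) = (\<lambda>y. (c * d) *\<^sub>R flux f g y)"
    by (rule ext) (simp add: flux_cmult_left flux_cmult_right mult.commute)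
  then show ?thesis by (simp add: div_heat_cmult)
qed

text \<open>A bilinear size estimate whose constant does not depend on the functions, on
  \<open>e\<close> or on \<xi>. It makes the terms of second order in the shift uniformly
  small.\<close>

lemma div_heat_abs_gauss_tail_bound:
  assumes a: "a > 0"
  obtains K where "\<And>f g M e \<xi>. f \<in> borel_measurable borel \<Longrightarrow> g \<in> borel_measurable borel \<Longrightarrow>
     (\<And>x. \<bar>f x\<bar> \<le> M * gauss_tail x) \<Longrightarrow> (\<And>x. \<bar>g x\<bar> \<le> M * gauss_tail x) \<Longrightarrow> \<bar>div_heat a e (flux f g) \<xi>\<bar> \<le> K * M\<^sup>2"
proof -
  define L where "L = (\<integral>\<^sup>+y. riesz gauss_tail y * ennreal \<bar>gauss_tail y\<bar> \<partial>lborel)"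
  define Kg where "Kg = 8 / sqrt a * (1 / (8 * pi * a))"
  have Kg: "Kg \<ge> 0" using a by (simp add: Kg_def)
  have "L\<^sup>2 \<le> (\<integral>\<^sup>+x. riesz gauss_tail x * (ennreal (sqrt (1 + (norm x)\<^sup>2)) * ennreal \<bar>gauss_tail x\<bar>) \<partial>lborel)\<^sup>2"
    unfolding L_def by (intro power_mono nn_integral_mono riesz_mult_le) simp
  also have "\<dots> \<le> Criesz * Criesz * W gauss_tail * W gauss_tail" by (rule moment1_riesz_bound) measurable
  also have "\<dots> < \<infinity>" using Criesz_finite wint_gauss_tail_finite by (simp add: ennreal_mult_less_top)
  finally have L: "L < \<infinity>" by (simp add: power_less_top_ennreal)
  show thesis
  proof (rule that[of "Kg * enn2real L"])
    fix f g :: "real^2 \<Rightarrow> real" and M e :: real and \<xi>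
    assume [measurable]: "f \<in> borel_measurable borel" "g \<in> borel_measurable borel"
      and f: "\<And>x. \<bar>f x\<bar> \<le> M * gauss_tail x" and g: "\<And>x. \<bar>g x\<bar> \<le> M * gauss_tail x"
    have M: "M \<ge> 0" using order_trans[OF abs_ge_zero f[of 0]] gauss_tail_pos[of 0] by (simp add: zero_le_mult_iff)
    have nvf: "riesz f y \<le> ennreal M * riesz gauss_tail y" for y
    proof -
      have "riesz f y \<le> (\<integral>\<^sup>+z. ennreal M * ennreal (\<bar>gauss_tail z\<bar> / norm (y - z)) \<partial>lborel)"
        unfolding riesz_def
      proof (rule nn_integral_mono)
        fix z
        have "\<bar>f z\<bar> / norm (y - z) \<le> M * gauss_tail z / norm (y - z)"
          by (intro divide_right_mono f) auto
        then show "ennreal (\<bar>f z\<bar> / norm (y - z)) \<le> ennreal M * ennreal (\<bar>gauss_tail z\<bar> / norm (y - z))"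
          using M gauss_tail_nonneg[of z] by (simp add: ennreal_mult'[symmetric] ennreal_leI)
      qed
      then show ?thesis by (simp add: riesz_def nn_integral_cmult)
    qed
    have "ennreal \<bar>div_heat a e (flux f g) \<xi>\<bar> \<le> (\<integral>\<^sup>+y. ennreal (norm (grad a (\<xi> - e *\<^sub>R y))) * ennreal (norm (flux f g y)) \<partial>lborel)"
      by (rule div_heat_abs_le) measurable
    also have "\<dots> \<le> (\<integral>\<^sup>+y. ennreal (Kg * M\<^sup>2) * (riesz gauss_tail y * ennreal \<bar>gauss_tail y\<bar>) \<partial>lborel)"
    proof (rule nn_integral_mono)
      fix y
      have "ennreal (norm (grad a (\<xi> - e *\<^sub>R y))) * ennreal (norm (flux f g y)) \<le> ennreal Kg * ((ennreal M * riesz gauss_tail y) * (ennreal M * ennreal \<bar>gauss_tail y\<bar>))"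
      proof (intro mult_mono order_trans[OF norm_flux_le] nvf)
        show "ennreal (norm (grad a (\<xi> - e *\<^sub>R y))) \<le> ennreal Kg"
          unfolding Kg_def by (intro ennreal_leI norm_grad_bound a)
        show "ennreal \<bar>g y\<bar> \<le> ennreal M * ennreal \<bar>gauss_tail y\<bar>"
          using g[of y] M gauss_tail_nonneg[of y] by (simp add: ennreal_mult'[symmetric] ennreal_leI)
      qed auto
      also have "\<dots> = ennreal (Kg * M\<^sup>2) * (riesz gauss_tail y * ennreal \<bar>gauss_tail y\<bar>)"
        using M Kg by (simp add: ennreal_mult power2_eq_square ac_simps)
      finally show "ennreal (norm (grad a (\<xi> - e *\<^sub>R y))) * ennreal (norm (flux f g y)) \<le> \<dots>" .
    qed
    also have "\<dots> = ennreal (Kg * M\<^sup>2) * L" unfolding L_def by (rule nn_integral_cmult) measurable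
    also have "\<dots> = ennreal (Kg * M\<^sup>2) * ennreal (enn2real L)" using L by simp
    also have "\<dots> = ennreal (Kg * enn2real L * M\<^sup>2)" by (simp add: ennreal_mult'[symmetric] ac_simps)
    finally show "\<bar>div_heat a e (flux f g) \<xi>\<bar> \<le> Kg * enn2real L * M\<^sup>2"
      using Kg by (subst (asm) ennreal_le_iff) auto
  qed
qed

text \<open>Translates of \<open>G\<close> are stationary too, so differentiating \<open>div_heat (flux G\<^sub>h G\<^sub>h) = 0\<close> in the shift
  \<open>h\<close> kills the cross terms.\<close>

lemma div_heat_G_momG:
  assumes e: "0 < e" "e < 1"
  shows "div_heat (1 - e\<^sup>2) e (flux G (momG c)) \<xi> + div_heat (1 - e\<^sup>2) e (flux (momG c) G) \<xi> = 0"
proof -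
  define a where "a = 1 - e\<^sup>2"
  have a: "a > 0" using e by (simp add: a_def power_less_one_iff)
  define D where "D f g = div_heat a e (flux f g) \<xi>" for f g
  obtain T where T: "T > 0" "\<And>x. \<bar>G x\<bar> \<le> T * gauss_tail x" "\<And>c x. \<bar>momG c x\<bar> \<le> T * norm c * gauss_tail x"
    "\<And>x h. norm h \<le> 1 \<Longrightarrow> \<bar>G (x + h) - G x + 1/2 * momG h x\<bar> \<le> T * (norm h)\<^sup>2 * gauss_tail x"
    using G_taylor by blast
  obtain K where K: "\<And>f g M. f \<in> borel_measurable borel \<Longrightarrow> g \<in> borel_measurable borel \<Longrightarrow>
     (\<And>x. \<bar>f x\<bar> \<le> M * gauss_tail x) \<Longrightarrow> (\<And>x. \<bar>g x\<bar> \<le> M * gauss_tail x) \<Longrightarrow> \<bar>D f g\<bar> \<le> K * M\<^sup>2"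
    using div_heat_abs_gauss_tail_bound[OF a] unfolding D_def by metis
  define M where "M = T * (1 + norm c)\<^sup>2"
  have n1: "1 \<le> (1 + norm c)\<^sup>2" by (rule one_le_power) simp
  have n2: "norm c \<le> (1 + norm c)\<^sup>2" "(norm c)\<^sup>2 \<le> (1 + norm c)\<^sup>2" by (auto simp: power2_sum)
  have M: "T \<le> M" "T * norm c \<le> M" "T * (norm c)\<^sup>2 \<le> M" "M \<ge> 0"
    using T(1) n1 n2 mult_left_mono[OF n1, of T] unfolding M_def by (auto intro!: mult_left_mono mult_nonneg_nonneg)
  define Q where "Q = D G (momG c) + D (momG c) G"
  define E where "E = 32 * (K * M\<^sup>2)"
  have lgb: "\<bar>G x\<bar> \<le> M * gauss_tail x" "\<bar>momG c x\<bar> \<le> M * gauss_tail x" for x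
    using T(2)[of x] T(3)[of c x] mult_right_mono[OF M(1) gauss_tail_nonneg[of x]] mult_right_mono[OF M(2) gauss_tail_nonneg[of x]] by linarith+
  have main: "\<bar>Q\<bar> \<le> E * s" if s: "0 < s" "s \<le> 1" "s * norm c \<le> 1" for s
  proof -
    \<comment> \<open>The second-order Taylor remainder divided by s^2, hence bounded by a multiple
      of \<open>gauss_tail\<close> uniformly in the step \<open>s\<close>.\<close>
    define r where "r x = (G (x + s *\<^sub>R c) - G x + 1/2 * momG (s *\<^sub>R c) x) / s\<^sup>2" for x
    have [measurable]: "r \<in> borel_measurable borel" unfolding r_def by measurable
    have rb: "\<bar>r x\<bar> \<le> M * gauss_tail x" for x
    proof -
      have "\<bar>G (x + s *\<^sub>R c) - G x + 1/2 * momG (s *\<^sub>R c) x\<bar> \<le> T * (norm (s *\<^sub>R c))\<^sup>2 * gauss_tail x"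
        using s by (intro T(4)) auto
      also have "\<dots> = s\<^sup>2 * (T * (norm c)\<^sup>2 * gauss_tail x)" by (simp add: power_mult_distrib)
      finally have "\<bar>r x\<bar> \<le> T * (norm c)\<^sup>2 * gauss_tail x" using s by (simp add: r_def field_simps)
      also have "\<dots> \<le> M * gauss_tail x" by (intro mult_right_mono M gauss_tail_nonneg)
      finally show ?thesis .
    qed
    have rX: "r \<in> wL2"
    proof (rule wL2_bound[OF wL2_cmult[OF gauss_tail_wL2, of M]])
      show "\<bar>r x\<bar> \<le> \<bar>M * gauss_tail x\<bar>" for x using rb[of x] by linarith
    qed measurable
    define m where "m = - s / 2"
    have GX: "(\<lambda>x. G x + m * momG c x) \<in> wL2" "(\<lambda>x. m * momG c x) \<in> wL2" "(\<lambda>x. s\<^sup>2 * r x) \<in> wL2"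
      by (auto intro!: wL2_add wL2_cmult G_wL2 momG_wL2 rX)
    have eq: "G (x + s *\<^sub>R c) = (G x + m * momG c x) + s\<^sup>2 * r x" for x
      using s by (simp add: r_def m_def momG_def)
    have one: "D (\<lambda>y. c1 * f y) (\<lambda>y. c2 * g y) = c1 * c2 * D f g" if "f \<in> borel_measurable borel" for f g c1 c2
      using div_heat_flux_cmult[OF that] by (simp add: D_def)
    have c1: "D f (\<lambda>y. c2 * g y) = c2 * D f g" if "f \<in> borel_measurable borel" for f g c2
      using one[OF that, of 1 c2 g] by simp
    have c2: "D (\<lambda>y. c2 * f y) g = c2 * D f g" if "f \<in> borel_measurable borel" for f g c2
      using one[OF that, of c2 1 g] by simp
    have add: "D (\<lambda>y. f1 y + f2 y) (\<lambda>y. g1 y + g2 y) = D f1 g1 + D f1 g2 + D f2 g1 + D f2 g2"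
      if "f1 \<in> wL2" "f2 \<in> wL2" "g1 \<in> wL2" "g2 \<in> wL2" for f1 f2 g1 g2
      using div_heat_flux_add[OF a that] by (simp add: D_def)
    define P where "P x = G x + m * momG c x" for x
    have PX: "P \<in> wL2" unfolding P_def by (rule GX)
    have [measurable]: "P \<in> borel_measurable borel" unfolding P_def by measurable
    have mle: "\<bar>m\<bar> \<le> 1" using s by (simp add: m_def)
    have Pb: "\<bar>P x\<bar> \<le> (2 * M) * gauss_tail x" for x
    proof -
      have "\<bar>m * momG c x\<bar> \<le> 1 * \<bar>momG c x\<bar>" unfolding abs_mult using mle by (intro mult_right_mono) auto
      then show ?thesis using lgb[of x] unfolding P_def by linarith
    qed
    have rb2: "\<bar>r x\<bar> \<le> (2 * M) * gauss_tail x" for x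
      using rb[of x] mult_nonneg_nonneg[OF M(4) gauss_tail_nonneg[of x]] unfolding mult.assoc by linarith
    have "0 = D (\<lambda>x. G (x + s *\<^sub>R c)) (\<lambda>x. G (x + s *\<^sub>R c))"
      using div_heat_shift_G[OF e] by (simp add: D_def a_def)
    also have "\<dots> = D (\<lambda>x. P x + s\<^sup>2 * r x) (\<lambda>x. P x + s\<^sup>2 * r x)" by (simp only: eq P_def)
    also have "\<dots> = D P P + s\<^sup>2 * D P r + s\<^sup>2 * D r P + s\<^sup>2 * s\<^sup>2 * D r r"
      by (subst add[OF PX GX(3) PX GX(3)]) (simp add: c1 c2)
    also have "D P P = D G G + m * D G (momG c) + m * D (momG c) G + m * m * D (momG c) (momG c)"
      unfolding P_def by (subst add[OF G_wL2 GX(2) G_wL2 GX(2)]) (simp add: c1 c2)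
    also have "D G G = 0" using div_heat_G_G[OF e] by (simp add: D_def a_def)
    \<comment> \<open>With m = -s/2 the term linear in \<open>s\<close> is -s Q/2. Every other
      surviving term carries at least s^2.\<close>
    finally have "s * (1/2 * Q) = s * (s * (D (momG c) (momG c) / 4 + D P r + D r P + s * s * D r r))"
      by (simp add: Q_def m_def power2_eq_square algebra_simps)
    then have Q: "1/2 * Q = s * (D (momG c) (momG c) / 4 + D P r + D r P + s * s * D r r)"
      using s by (simp only: mult_left_cancel)
    have b: "\<bar>D (momG c) (momG c)\<bar> \<le> K * (2 * M)\<^sup>2" "\<bar>D P r\<bar> \<le> K * (2 * M)\<^sup>2" "\<bar>D r P\<bar> \<le> K * (2 * M)\<^sup>2" "\<bar>D r r\<bar> \<le> K * (2 * M)\<^sup>2"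
    proof -
      have lgb2: "\<bar>momG c x\<bar> \<le> (2 * M) * gauss_tail x" for x
        using lgb(2)[of x] mult_nonneg_nonneg[OF M(4) gauss_tail_nonneg[of x]] unfolding mult.assoc by linarith
      show "\<bar>D (momG c) (momG c)\<bar> \<le> K * (2 * M)\<^sup>2" "\<bar>D P r\<bar> \<le> K * (2 * M)\<^sup>2" "\<bar>D r P\<bar> \<le> K * (2 * M)\<^sup>2" "\<bar>D r r\<bar> \<le> K * (2 * M)\<^sup>2"
        by (rule K; (rule lgb2 Pb rb2 | measurable))+
    qed
    have "\<bar>s * s * D r r\<bar> \<le> 1 * \<bar>D r r\<bar>" unfolding abs_mult using s by (intro mult_right_mono) (auto simp: mult_le_one)
    then have "\<bar>D (momG c) (momG c) / 4 + D P r + D r P + s * s * D r r\<bar> \<le> 4 * (K * (2 * M)\<^sup>2)"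
      using b by linarith
    then have "s * \<bar>D (momG c) (momG c) / 4 + D P r + D r P + s * s * D r r\<bar> \<le> s * (4 * (K * (2 * M)\<^sup>2))"
      using s by (intro mult_left_mono) auto
    moreover have "\<bar>1/2 * Q\<bar> = s * \<bar>D (momG c) (momG c) / 4 + D P r + D r P + s * s * D r r\<bar>"
      unfolding Q using s by (simp add: abs_mult)
    ultimately have "\<bar>Q\<bar> \<le> 2 * (s * (4 * (K * (2 * M)\<^sup>2)))" by linarith
    also have "\<dots> = E * s" by (simp add: E_def power2_eq_square)
    finally show ?thesis .
  qed
  have "Q = 0"
  proof (rule ccontr)
    assume "Q \<noteq> 0"
    \<comment> \<open>The first entry keeps the step and the shift at most 1, the second makes E s
      at most |Q|/2.\<close>
    define s where "s = min (1 / (1 + norm c)) (\<bar>Q\<bar> / (2 * (\<bar>E\<bar> + 1)))"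
    have s: "0 < s" "s \<le> 1 / (1 + norm c)" "s \<le> \<bar>Q\<bar> / (2 * (\<bar>E\<bar> + 1))"
      using \<open>Q \<noteq> 0\<close> by (auto simp: s_def add_pos_nonneg)
    have "s * (1 + norm c) \<le> 1" using s(2) by (simp add: pos_le_divide_eq add_pos_nonneg)
    moreover have "0 \<le> s * norm c" using s(1) by simp
    ultimately have s2: "s \<le> 1" "s * norm c \<le> 1" using s(1) unfolding distrib_left by linarith+
    have "\<bar>Q\<bar> \<le> E * s" using main s(1) s2 by auto
    also have "\<dots> \<le> (\<bar>E\<bar> + 1) * s" using s(1) by (intro mult_right_mono) auto
    also have "\<dots> \<le> (\<bar>E\<bar> + 1) * (\<bar>Q\<bar> / (2 * (\<bar>E\<bar> + 1)))" using s(3) by (intro mult_left_mono) auto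
    also have "\<dots> = \<bar>Q\<bar> / 2" by (simp add: field_simps)
    finally show False using \<open>Q \<noteq> 0\<close> by simp
  qed
  then show ?thesis unfolding Q_def D_def a_def .
qed

section \<open>Borel representatives and derivatives of heat convolutions\<close>

text \<open>An infinite \<open>W\<close> is sent to 0, so the value is meaningful on
  \<open>wL2\<close> only; upper bounds are therefore proved for \<open>W\<close> and transferred
  afterwards.\<close>

definition wnorm :: "(real^2 \<Rightarrow> real) \<Rightarrow> real" where "wnorm f = sqrt (enn2real (W f))"

lemma wnorm_nonneg [simp]: "wnorm f \<ge> 0" by (simp add: wnorm_def)

lemma wnorm_square: "f \<in> wL2 \<Longrightarrow> W f = ennreal ((wnorm f)\<^sup>2)"
  using wL2_finite[of f] by (simp add: wnorm_def)

lemma wnorm_le: "W f \<le> ennreal (c\<^sup>2) \<Longrightarrow> c \<ge> 0 \<Longrightarrow> wnorm f \<le> c"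
  unfolding wnorm_def by (intro real_le_lsqrt enn2real_leI) auto

lemma wnorm_cmult:
  assumes "f \<in> wL2" shows "wnorm (\<lambda>x. c * f x) = \<bar>c\<bar> * wnorm f"
proof -
  have "W (\<lambda>x. c * f x) = ennreal (c\<^sup>2) * W f" using assms by (intro W_cmult) (auto simp: wL2_def)
  then show ?thesis by (simp add: wnorm_def enn2real_mult real_sqrt_mult)
qed

lemma ennreal_square_le:
  assumes "(x::ennreal)\<^sup>2 \<le> (ennreal c)\<^sup>2" "c \<ge> 0"
  shows "x \<le> ennreal c"
proof (cases x)
  case (real r)
  then show ?thesis using assms by (auto simp: ennreal_power intro!: ennreal_leI dest: power2_le_imp_le)
next
  case top
  then show ?thesis using assms by (simp add: ennreal_power power2_eq_square ennreal_mult'[symmetric] top_unique)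
qed

text \<open>Minkowski with constant one, where \<open>W_add\<close> loses a factor 2. Upper bounds
  \<open>p\<close> and \<open>q\<close> replace the norms, so that pieces of a decomposition can be
  added from their estimates alone.\<close>

lemma wint_triangle:
  assumes [measurable]: "f \<in> borel_measurable borel" "g \<in> borel_measurable borel"
    and f: "W f \<le> ennreal (p\<^sup>2)" "p \<ge> 0" and g: "W g \<le> ennreal (q\<^sup>2)" "q \<ge> 0"
  shows "W (\<lambda>x. f x + g x) \<le> ennreal ((p + q)\<^sup>2)"
proof -
  define I where "I = (\<integral>\<^sup>+x. ennreal (wt x) * (ennreal \<bar>f x\<bar> * ennreal \<bar>g x\<bar>) \<partial>lborel)"
  have "I\<^sup>2 \<le> W f * W g" unfolding I_def wint_def by (rule Cauchy_Schwarz_weighted) measurable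
  also have "\<dots> \<le> ennreal (p\<^sup>2) * ennreal (q\<^sup>2)" by (intro mult_mono f g) auto
  also have "\<dots> = (ennreal (p * q))\<^sup>2" using f g by (simp add: ennreal_power ennreal_mult'[symmetric] power_mult_distrib)
  finally have I: "I \<le> ennreal (p * q)" using f g by (intro ennreal_square_le) auto
  have "W (\<lambda>x. f x + g x) \<le> (\<integral>\<^sup>+x. ennreal (wt x) * (ennreal \<bar>f x\<bar>)\<^sup>2 + (ennreal (wt x) * (ennreal \<bar>g x\<bar>)\<^sup>2 + 2 * (ennreal (wt x) * (ennreal \<bar>f x\<bar> * ennreal \<bar>g x\<bar>))) \<partial>lborel)"
    unfolding wint_def
  proof (rule nn_integral_mono)
    fix x
    have "ennreal \<bar>f x + g x\<bar> \<le> ennreal \<bar>f x\<bar> + ennreal \<bar>g x\<bar>"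
      by (simp add: ennreal_plus[symmetric] ennreal_leI abs_triangle_ineq del: ennreal_plus)
    then have "ennreal (wt x) * (ennreal \<bar>f x + g x\<bar>)\<^sup>2 \<le> ennreal (wt x) * (ennreal \<bar>f x\<bar> + ennreal \<bar>g x\<bar>)\<^sup>2"
      by (intro mult_left_mono power_mono) auto
    also have "\<dots> = ennreal (wt x) * (ennreal \<bar>f x\<bar>)\<^sup>2 + (ennreal (wt x) * (ennreal \<bar>g x\<bar>)\<^sup>2 + 2 * (ennreal (wt x) * (ennreal \<bar>f x\<bar> * ennreal \<bar>g x\<bar>)))"
      by (simp add: power2_eq_square distrib_left distrib_right mult_2 ac_simps)
    finally show "ennreal (wt x) * (ennreal \<bar>f x + g x\<bar>)\<^sup>2 \<le> \<dots>" .
  qed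
  also have "\<dots> = W f + (W g + 2 * I)"
    unfolding wint_def I_def by (subst nn_integral_add, measurable)+ (simp add: nn_integral_cmult)
  also have "\<dots> \<le> ennreal (p\<^sup>2) + (ennreal (q\<^sup>2) + 2 * ennreal (p * q))"
    by (intro add_mono mult_left_mono f g I) auto
  also have "\<dots> = ennreal ((p + q)\<^sup>2)"
    using f g by (simp add: power2_sum ennreal_plus[symmetric] ennreal_mult'[symmetric] ac_simps del: ennreal_plus flip: ennreal_numeral)
  finally show ?thesis .
qed

lemma wnorm_triangle:
  assumes "f \<in> wL2" "g \<in> wL2"
  shows "wnorm (\<lambda>x. f x + g x) \<le> wnorm f + wnorm g"
proof (rule wnorm_le)
  show "W (\<lambda>x. f x + g x) \<le> ennreal ((wnorm f + wnorm g)\<^sup>2)"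
    using wnorm_square[OF assms(1)] wnorm_square[OF assms(2)]
    by (intro wint_triangle wL2_measurable assms wnorm_nonneg) (simp_all only: order_refl)
qed simp

lemma wnorm_diff_triangle:
  assumes "f \<in> wL2" "g \<in> wL2"
  shows "\<bar>wnorm f - wnorm g\<bar> \<le> wnorm (\<lambda>x. f x - g x)"
proof -
  have "wnorm f \<le> wnorm (\<lambda>x. f x - g x) + wnorm g"
    using wnorm_triangle[OF wL2_diff[OF assms] assms(2)] by simp
  moreover have "wnorm g \<le> wnorm (\<lambda>x. f x - g x) + wnorm f"
  proof -
    have "wnorm g \<le> wnorm (\<lambda>x. g x - f x) + wnorm f"
      using wnorm_triangle[OF wL2_diff[OF assms(2,1)] assms(1)] by simp
    moreover have "wnorm (\<lambda>x. g x - f x) = wnorm (\<lambda>x. f x - g x)" by (simp add: wnorm_def abs_minus_commute)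
    ultimately show ?thesis by simp
  qed
  ultimately show ?thesis by linarith
qed

section \<open>Passage from Lebesgue to Borel functions\<close>

lemma norm_L2_borel:
  assumes [measurable]: "f \<in> borel_measurable borel"
  shows "norm_L2 3 f = wnorm f"
proof -
  have w: "(1 + (norm x)\<^sup>2) powr 3 = wt x" for x :: "real^2"
    by (simp add: wt_def add_pos_nonneg)
  have "(LINT \<xi>|lebesgue. (1 + (norm \<xi>)\<^sup>2) powr 3 * (f \<xi>)\<^sup>2) = (LINT \<xi>|lborel. wt \<xi> * (f \<xi>)\<^sup>2)"
    unfolding w by (rule integral_completion) measurable
  also have "\<dots> = enn2real (\<integral>\<^sup>+x. ennreal (wt x * (f x)\<^sup>2) \<partial>lborel)"
    by (rule integral_eq_nn_integral) (auto simp: wt_nonneg)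
  also have "(\<integral>\<^sup>+x. ennreal (wt x * (f x)\<^sup>2) \<partial>lborel) = W f"
    unfolding wint_def by (intro nn_integral_cong) (simp add: ennreal_power ennreal_mult'[symmetric] wt_nonneg)
  finally show ?thesis by (simp add: norm_L2_def wnorm_def)
qed

lemma norm_L2_cong:
  assumes "f \<in> borel_measurable lebesgue" "g \<in> borel_measurable borel" and ae: "AE x in lborel. f x = g x"
  shows "norm_L2 3 f = norm_L2 3 g"
proof -
  have [measurable]: "g \<in> borel_measurable lebesgue" using assms(2) by (intro measurable_completion) simp
  note [measurable] = assms(1)
  have [measurable]: "(\<lambda>\<xi>::real^2. (1 + (norm \<xi>)\<^sup>2) powr 3) \<in> borel_measurable lebesgue"
    by (intro measurable_completion) measurable
  have "(LINT \<xi>|lebesgue. (1 + (norm \<xi>)\<^sup>2) powr 3 * (f \<xi>)\<^sup>2) = (LINT \<xi>|lebesgue. (1 + (norm \<xi>)\<^sup>2) powr 3 * (g \<xi>)\<^sup>2)"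
  proof (rule integral_cong_AE)
    show "(\<lambda>\<xi>. (1 + (norm \<xi>)\<^sup>2) powr 3 * (f \<xi>)\<^sup>2) \<in> borel_measurable lebesgue"
      "(\<lambda>\<xi>. (1 + (norm \<xi>)\<^sup>2) powr 3 * (g \<xi>)\<^sup>2) \<in> borel_measurable lebesgue" by measurable
  qed (use AE_completion[OF ae] in \<open>eventually_elim, simp\<close>)
  then show ?thesis by (simp add: norm_L2_def)
qed

lemma L2_borel_representative:
  assumes "f \<in> L2 3"
  shows "\<exists>g\<in>wL2. AE x in lborel. f x = g x"
proof -
  have f: "f \<in> borel_measurable lebesgue" and int: "integrable lebesgue (\<lambda>\<xi>. (1 + (norm \<xi>)\<^sup>2) powr 3 * (f \<xi>)\<^sup>2)"
    using assms by (auto simp: L2_def)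
  obtain g where g: "g \<in> borel_measurable lborel" and ae: "AE x in lborel. f x = g x"
    using completion_ex_borel_measurable_real[OF f] by blast
  have [measurable]: "g \<in> borel_measurable borel" using g by simp
  have w: "(1 + (norm x)\<^sup>2) powr 3 = wt x" for x :: "real^2"
    by (simp add: wt_def add_pos_nonneg)
  have "W g = (\<integral>\<^sup>+x. ennreal (wt x * (g x)\<^sup>2) \<partial>lborel)"
    unfolding wint_def by (intro nn_integral_cong) (simp add: ennreal_power ennreal_mult'[symmetric] wt_nonneg)
  also have "\<dots> = (\<integral>\<^sup>+x. ennreal (wt x * (g x)\<^sup>2) \<partial>lebesgue)" by (simp add: nn_integral_completion)
  also have "\<dots> = (\<integral>\<^sup>+x. ennreal (norm ((1 + (norm x)\<^sup>2) powr 3 * (f x)\<^sup>2)) \<partial>lebesgue)"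
    using AE_completion[OF ae] by (intro nn_integral_cong_AE) (auto simp: w wt_nonneg elim!: eventually_mono)
  also have "\<dots> < \<infinity>" using int by (simp add: integrable_iff_bounded)
  finally show ?thesis using ae by (intro bexI[of _ g]) (auto simp: wL2_def)
qed

lemma AE_affine:
  fixes P :: "'a::euclidean_space \<Rightarrow> bool"
  assumes ae: "AE x in lborel. P x" and c: "c \<noteq> 0"
  shows "AE x in lborel. P (c *\<^sub>R x)"
proof -
  obtain N where N: "{x \<in> space lborel. \<not> P x} \<subseteq> N" "emeasure lborel N = 0" "N \<in> sets lborel"
    using AE_E[OF ae] by metis
  have [measurable]: "N \<in> sets borel" using N(3) by simp
  have "0 = (\<integral>\<^sup>+x. indicator N x \<partial>lborel)" using N(2,3) by simp
  also have "\<dots> = ennreal (\<bar>c\<bar> ^ DIM('a)) * (\<integral>\<^sup>+x. indicator N (0 + c *\<^sub>R x) \<partial>lborel)"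
    by (rule nn_integral_affine[OF _ c]) measurable
  finally have "(\<integral>\<^sup>+x. indicator N (c *\<^sub>R x) \<partial>lborel) = (0::ennreal)" using c by auto
  then have "AE x in lborel. indicator N (c *\<^sub>R x) = (0::ennreal)"
    by (subst (asm) nn_integral_0_iff_AE) auto
  then show ?thesis by eventually_elim (use N(1) in \<open>auto simp: indicator_def\<close>)
qed

lemma biot_savart_cong:
  assumes f: "f \<in> borel_measurable lebesgue" and g: "g \<in> borel_measurable borel" and ae: "AE x in lborel. f x = g x"
  shows "biot_savart f x = biot_savart g x"
proof -
  have [measurable]: "g \<in> borel_measurable lebesgue" using g by (intro measurable_completion) simp
  note [measurable] = f
  have [measurable]: "(\<lambda>\<eta>. (norm (x - \<eta>))\<^sup>2) \<in> borel_measurable lebesgue" "(\<lambda>\<eta>. perp (x - \<eta>)) \<in> borel_measurable lebesgue"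
    by (intro measurable_completion; measurable)+
  show ?thesis unfolding biot_savart_def
    using AE_completion[OF ae] by (intro arg_cong2[where f=scaleR] refl integral_cong_AE) (auto elim!: eventually_mono)
qed

text \<open>Under y = exp(t/2) \<xi>' the Jacobian exp(-t) cancels the prefactor exp(t). The
  right-hand side is insensitive to null sets, so for positive times equality almost everywhere
  becomes a pointwise statement.\<close>

lemma semigroup_L_eq:
  fixes f g :: "real^2 \<Rightarrow> 'b::{banach, second_countable_topology}"
  assumes t: "t > 0" and f: "f \<in> borel_measurable lebesgue" and g[measurable]: "g \<in> borel_measurable borel"
    and ae: "AE x in lborel. f x = g x"
  shows "semigroup_L t f \<xi> = (\<integral>y. heat (1 - (exp (- t / 2))\<^sup>2) (\<xi> - exp (- t / 2) *\<^sub>R y) *\<^sub>R g y \<partial>lborel)"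
proof -
  define e where "e = exp (- t / 2)"
  have e: "e > 0" "e < 1" using t by (auto simp: e_def)
  have ee: "exp (t / 2) *\<^sub>R (e *\<^sub>R y) = y" for y :: "real^2" by (simp add: e_def exp_add[symmetric])
  have e2: "e\<^sup>2 = exp (- t)" by (simp add: e_def power2_eq_square exp_add[symmetric])
  define a where "a = 1 - e\<^sup>2"
  have a: "a > 0" "semigroup_a t = a" using t by (auto simp: a_def e2 semigroup_a_def)
  define k where "k x = exp (- (norm (\<xi> - x))\<^sup>2 / (4 * a))" for x
  have [measurable]: "k \<in> borel_measurable borel" unfolding k_def by measurable
  have [measurable]: "k \<in> borel_measurable lebesgue" by (intro measurable_completion) measurable
  have [measurable]: "(\<lambda>x. f (exp (t / 2) *\<^sub>R x)) \<in> borel_measurable lebesgue"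
    using measurable_compose[OF lebesgue_measurable_scaling f] .
  have [measurable]: "(\<lambda>x. g (exp (t / 2) *\<^sub>R x)) \<in> borel_measurable lebesgue"
    by (intro measurable_completion) measurable
  have "AE x in lborel. f (exp (t / 2) *\<^sub>R x) = g (exp (t / 2) *\<^sub>R x)"
    by (rule AE_affine[OF ae]) simp
  from AE_completion[OF this] have "(LINT x|lebesgue. k x *\<^sub>R f (exp (t / 2) *\<^sub>R x)) = (LINT x|lebesgue. k x *\<^sub>R g (exp (t / 2) *\<^sub>R x))"
    by (intro integral_cong_AE) (auto elim!: eventually_mono)
  also have "\<dots> = (\<integral>x. k x *\<^sub>R g (exp (t / 2) *\<^sub>R x) \<partial>lborel)"
    by (rule integral_completion) measurable
  also have "\<dots> = e\<^sup>2 *\<^sub>R (\<integral>y. k (e *\<^sub>R y) *\<^sub>R g y \<partial>lborel)"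
    using integral_affine[of e "\<lambda>x. k x *\<^sub>R g (exp (t / 2) *\<^sub>R x)" 0] e by (simp add: ee del: scaleR_scaleR)
  finally have "semigroup_L t f \<xi> = (exp t / (4 * pi * a)) *\<^sub>R (e\<^sup>2 *\<^sub>R (\<integral>y. k (e *\<^sub>R y) *\<^sub>R g y \<partial>lborel))"
    using t by (simp add: semigroup_L_def a k_def)
  also have "\<dots> = (1 / (4 * pi * a)) *\<^sub>R (\<integral>y. k (e *\<^sub>R y) *\<^sub>R g y \<partial>lborel)"
    by (simp add: e2 exp_minus)
  also have "\<dots> = (\<integral>y. (1 / (4 * pi * a)) *\<^sub>R (k (e *\<^sub>R y) *\<^sub>R g y) \<partial>lborel)"
    by (rule integral_scaleR_right[symmetric])
  also have "\<dots> = (\<integral>y. heat a (\<xi> - e *\<^sub>R y) *\<^sub>R g y \<partial>lborel)"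
    by (simp add: heat_def k_def)
  finally show ?thesis by (simp add: a_def e_def)
qed

text \<open>The quadratic Taylor remainder of the kernel is uniform in its base point. Integrated
  against |F| it bounds the error of the difference quotient by a multiple of the increment.\<close>

lemma heat_convolution_has_derivative:
  fixes F :: "real^2 \<Rightarrow> real^2"
  assumes F: "integrable lborel F" and a: "0 < a" "a \<le> 1"
  shows "((\<lambda>\<xi>. \<integral>y. heat a (\<xi> - e *\<^sub>R y) *\<^sub>R F y \<partial>lborel) has_derivative
     (\<lambda>h. \<integral>y. (grad a (\<xi> - e *\<^sub>R y) \<bullet> h) *\<^sub>R F y \<partial>lborel)) (at \<xi>)"
proof -
  have [measurable]: "F \<in> borel_measurable borel" using F by auto
  define L where "L = (\<integral>y. norm (F y) \<partial>lborel)"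
  have nF: "integrable lborel (\<lambda>y. norm (F y))" using F by simp
  obtain T where T: "T > 0" "\<And>x h. norm h \<le> 1 \<Longrightarrow> \<bar>heat a (x + h) - heat a x - grad a x \<bullet> h\<bar> \<le> T * (norm h)\<^sup>2 * gauss_tail x"
    using heat_taylor[OF a(1)] a by (metis order_refl)
  define Kg where "Kg = 8 / sqrt a * (1 / (8 * pi * a))"
  have Kg: "norm (grad a x) \<le> Kg" for x unfolding Kg_def by (rule norm_grad_bound[OF a(1)])
  have ih: "integrable lborel (\<lambda>y. heat a (x - e *\<^sub>R y) *\<^sub>R F y)" for x
  proof (rule Bochner_Integration.integrable_bound)
    show "integrable lborel (\<lambda>y. (1 / (4 * pi * a)) * norm (F y))" using nF by simp
    show "AE y in lborel. norm (heat a (x - e *\<^sub>R y) *\<^sub>R F y) \<le> norm ((1 / (4 * pi * a)) * norm (F y))"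
    proof (rule AE_I2)
      fix y
      have "norm (heat a (x - e *\<^sub>R y) *\<^sub>R F y) = heat a (x - e *\<^sub>R y) * norm (F y)"
        using heat_nonneg[OF a(1)] by simp
      also have "\<dots> \<le> (1 / (4 * pi * a)) * norm (F y)" by (intro mult_right_mono heat_le a) auto
      also have "\<dots> \<le> norm ((1 / (4 * pi * a)) * norm (F y))" unfolding real_norm_def by (rule abs_ge_self)
      finally show "norm (heat a (x - e *\<^sub>R y) *\<^sub>R F y) \<le> norm ((1 / (4 * pi * a)) * norm (F y))" .
    qed
  qed measurable
  have gb: "norm ((grad a x \<bullet> h) *\<^sub>R F y) \<le> norm h * Kg * norm (F y)" for x h y
  proof -
    have "\<bar>grad a x \<bullet> h\<bar> \<le> norm (grad a x) * norm h" by (rule Cauchy_Schwarz_ineq2)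
    also have "\<dots> \<le> Kg * norm h" by (intro mult_right_mono Kg) auto
    finally show ?thesis using mult_right_mono[of "\<bar>grad a x \<bullet> h\<bar>" "Kg * norm h" "norm (F y)"] by (simp add: mult.commute)
  qed
  have ig: "integrable lborel (\<lambda>y. (grad a (x - e *\<^sub>R y) \<bullet> h) *\<^sub>R F y)" for x h
  proof (rule Bochner_Integration.integrable_bound)
    show "integrable lborel (\<lambda>y. norm h * Kg * norm (F y))" using nF by simp
    show "AE y in lborel. norm ((grad a (x - e *\<^sub>R y) \<bullet> h) *\<^sub>R F y) \<le> norm (norm h * Kg * norm (F y))"
      using gb by (intro AE_I2) (metis abs_ge_self order_trans real_norm_def)
  qed measurable
  show ?thesis
  proof (rule has_derivativeI_sandwich[where e=1 and H="\<lambda>z. T * L * norm (z - \<xi>)"])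
    show "bounded_linear (\<lambda>h. \<integral>y. (grad a (\<xi> - e *\<^sub>R y) \<bullet> h) *\<^sub>R F y \<partial>lborel)"
    proof (rule bounded_linear_intro[where K="Kg * L"])
      fix h :: "real^2"
      have "norm (\<integral>y. (grad a (\<xi> - e *\<^sub>R y) \<bullet> h) *\<^sub>R F y \<partial>lborel) \<le> (\<integral>y. norm h * Kg * norm (F y) \<partial>lborel)"
        by (rule Bochner_Integration.integral_norm_bound_integral) (use ig nF gb in auto)
      also have "\<dots> = norm h * (Kg * L)" unfolding L_def by (simp add: mult.assoc)
      finally show "norm (\<integral>y. (grad a (\<xi> - e *\<^sub>R y) \<bullet> h) *\<^sub>R F y \<partial>lborel) \<le> norm h * (Kg * L)" .
    next
      fix h h' :: "real^2"
      show "(\<integral>y. (grad a (\<xi> - e *\<^sub>R y) \<bullet> (h + h')) *\<^sub>R F y \<partial>lborel) = (\<integral>y. (grad a (\<xi> - e *\<^sub>R y) \<bullet> h) *\<^sub>R F y \<partial>lborel) + (\<integral>y. (grad a (\<xi> - e *\<^sub>R y) \<bullet> h') *\<^sub>R F y \<partial>lborel)"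
        unfolding inner_add_right scaleR_add_left by (rule Bochner_Integration.integral_add) (rule ig)+
    next
      fix r and h :: "real^2"
      show "(\<integral>y. (grad a (\<xi> - e *\<^sub>R y) \<bullet> (r *\<^sub>R h)) *\<^sub>R F y \<partial>lborel) = r *\<^sub>R (\<integral>y. (grad a (\<xi> - e *\<^sub>R y) \<bullet> h) *\<^sub>R F y \<partial>lborel)"
        by (simp flip: scaleR_scaleR integral_scaleR_right)
    qed
    show "((\<lambda>z. T * L * norm (z - \<xi>)) \<longlongrightarrow> 0) (at \<xi>)"
      by (auto intro!: tendsto_eq_intros)
    fix z assume z: "z \<noteq> \<xi>" "dist z \<xi> < 1"
    define h where "h = z - \<xi>"
    have h: "norm h \<le> 1" "h \<noteq> 0" "z = \<xi> + h" using z by (auto simp: h_def dist_norm)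
    have tb: "norm ((heat a (z - e *\<^sub>R y) - heat a (\<xi> - e *\<^sub>R y) - grad a (\<xi> - e *\<^sub>R y) \<bullet> h) *\<^sub>R F y) \<le> T * (norm h)\<^sup>2 * norm (F y)" for y
    proof -
      have "\<bar>heat a ((\<xi> - e *\<^sub>R y) + h) - heat a (\<xi> - e *\<^sub>R y) - grad a (\<xi> - e *\<^sub>R y) \<bullet> h\<bar> \<le> T * (norm h)\<^sup>2 * gauss_tail (\<xi> - e *\<^sub>R y)"
        by (rule T(2)[OF h(1)])
      also have "\<dots> \<le> T * (norm h)\<^sup>2 * 1" using T(1) by (intro mult_left_mono) (auto simp: gauss_tail_def)
      finally have b: "\<bar>heat a ((\<xi> - e *\<^sub>R y) + h) - heat a (\<xi> - e *\<^sub>R y) - grad a (\<xi> - e *\<^sub>R y) \<bullet> h\<bar> \<le> T * (norm h)\<^sup>2 * 1" .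
      have zh: "z - e *\<^sub>R y = (\<xi> - e *\<^sub>R y) + h" by (simp add: h(3))
      show ?thesis unfolding zh norm_scaleR using mult_right_mono[OF b norm_ge_zero[of "F y"]] by simp
    qed
    have "(\<integral>y. heat a (z - e *\<^sub>R y) *\<^sub>R F y \<partial>lborel) - (\<integral>y. heat a (\<xi> - e *\<^sub>R y) *\<^sub>R F y \<partial>lborel) - (\<integral>y. (grad a (\<xi> - e *\<^sub>R y) \<bullet> h) *\<^sub>R F y \<partial>lborel)
      = (\<integral>y. (heat a (z - e *\<^sub>R y) - heat a (\<xi> - e *\<^sub>R y) - grad a (\<xi> - e *\<^sub>R y) \<bullet> h) *\<^sub>R F y \<partial>lborel)"
      using ih ig by (simp add: scaleR_diff_left)
    also have "norm \<dots> \<le> (\<integral>y. T * (norm h)\<^sup>2 * norm (F y) \<partial>lborel)"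
    proof (rule Bochner_Integration.integral_norm_bound_integral)
      show "integrable lborel (\<lambda>y. (heat a (z - e *\<^sub>R y) - heat a (\<xi> - e *\<^sub>R y) - grad a (\<xi> - e *\<^sub>R y) \<bullet> h) *\<^sub>R F y)"
        unfolding scaleR_diff_left using ih ig by (intro Bochner_Integration.integrable_diff)
    qed (use nF tb in auto)
    also have "\<dots> = T * L * norm (z - \<xi>) * norm (z - \<xi>)" by (simp add: L_def h_def power2_eq_square ac_simps)
    finally show "norm ((\<integral>y. heat a (z - e *\<^sub>R y) *\<^sub>R F y \<partial>lborel) - (\<integral>y. heat a (\<xi> - e *\<^sub>R y) *\<^sub>R F y \<partial>lborel) - (\<integral>y. (grad a (\<xi> - e *\<^sub>R y) \<bullet> (z - \<xi>)) *\<^sub>R F y \<partial>lborel)) / norm (z - \<xi>)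
        \<le> T * L * norm (z - \<xi>)"
      using h(2) by (simp add: h_def pos_divide_le_eq)
  qed simp
qed

lemma divergence_heat_convolution:
  fixes F :: "real^2 \<Rightarrow> real^2"
  assumes F: "integrable lborel F" and a: "0 < a" "a \<le> 1"
  shows "divergence (\<lambda>\<xi>. \<integral>y. heat a (\<xi> - e *\<^sub>R y) *\<^sub>R F y \<partial>lborel) \<xi> = div_heat a e F \<xi>"
proof -
  have [measurable]: "F \<in> borel_measurable borel" using F by auto
  note D = frechet_derivative_at[OF heat_convolution_has_derivative[OF F a, of e \<xi>], symmetric]
  define Kg where "Kg = 8 / sqrt a * (1 / (8 * pi * a))"
  have Kg: "norm (grad a x) \<le> Kg" for x unfolding Kg_def by (rule norm_grad_bound[OF a(1)])
  have ig: "integrable lborel (\<lambda>y. (grad a (\<xi> - e *\<^sub>R y) $ i) *\<^sub>R F y)" for i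
  proof (rule Bochner_Integration.integrable_bound)
    show "integrable lborel (\<lambda>y. Kg * norm (F y))" using F by simp
    have "\<bar>grad a x $ i\<bar> * norm (F y) \<le> \<bar>Kg\<bar> * norm (F y)" for x y
      using order_trans[OF component_le_norm_cart Kg, of x i] by (intro mult_right_mono) auto
    then show "AE y in lborel. norm ((grad a (\<xi> - e *\<^sub>R y) $ i) *\<^sub>R F y) \<le> norm (Kg * norm (F y))"
      by (simp add: abs_mult)
  qed measurable
  have c: "(\<integral>y. (grad a (\<xi> - e *\<^sub>R y) $ i) *\<^sub>R F y \<partial>lborel) $ i = (\<integral>y. grad a (\<xi> - e *\<^sub>R y) $ i * F y $ i \<partial>lborel)" for i
    using integral_bounded_linear[OF bounded_linear_vec_nth ig, of i i] by simp
  have ic: "integrable lborel (\<lambda>y. grad a (\<xi> - e *\<^sub>R y) $ i * F y $ i)" for i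
    using integrable_bounded_linear[OF bounded_linear_vec_nth ig, of i i] by simp
  show ?thesis
    unfolding divergence_def D sum_2 inner_axis
    unfolding div_heat_def inner_plane by (simp add: c ic)
qed

section \<open>The Duhamel integral\<close>

lemma flux_L1_le:
  assumes f: "f \<in> wL2" and g: "g \<in> wL2"
  shows "(\<integral>y. norm (flux f g y) \<partial>lborel) \<le> enn2real Criesz * wnorm f * wnorm g"
proof -
  have [measurable]: "f \<in> borel_measurable borel" "g \<in> borel_measurable borel" using f g by (auto simp: wL2_def)
  define c where "c = enn2real Criesz"
  have c: "Criesz = ennreal c" "c \<ge> 0" using Criesz_finite by (auto simp: c_def)
  have "(\<integral>\<^sup>+y. ennreal (norm (flux f g y)) \<partial>lborel)\<^sup>2 \<le> Criesz * Criesz * W f * W g"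
    by (rule flux_moment_bound) measurable
  also have "\<dots> = (ennreal (c * wnorm f * wnorm g))\<^sup>2"
    unfolding c(1) wnorm_square[OF f] wnorm_square[OF g] using c(2)
    by (simp add: ennreal_mult'[symmetric] ennreal_power power_mult_distrib power2_eq_square mult.assoc)
  finally have "(\<integral>\<^sup>+y. ennreal (norm (flux f g y)) \<partial>lborel) \<le> ennreal (c * wnorm f * wnorm g)"
    using c by (intro ennreal_square_le) auto
  then show ?thesis
    using flux_integrable[OF f g] c by (subst integral_eq_nn_integral) (auto simp: c_def intro!: enn2real_leI)
qed

lemma div_heat_abs_le_L1:
  assumes F: "integrable lborel F" and a: "a > 0"
  shows "\<bar>div_heat a e F \<xi>\<bar> \<le> 8 / sqrt a * (1 / (8 * pi * a)) * (\<integral>y. norm (F y) \<partial>lborel)"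
proof -
  define Kg where "Kg = 8 / sqrt a * (1 / (8 * pi * a))"
  have "norm (\<integral>y. grad a (\<xi> - e *\<^sub>R y) \<bullet> F y \<partial>lborel) \<le> (\<integral>y. Kg * norm (F y) \<partial>lborel)"
  proof (rule Bochner_Integration.integral_norm_bound_integral)
    show "integrable lborel (\<lambda>y. grad a (\<xi> - e *\<^sub>R y) \<bullet> F y)" by (rule div_heat_integrable[OF F a])
    show "integrable lborel (\<lambda>y. Kg * norm (F y))" using F by simp
    fix y
    have "\<bar>grad a (\<xi> - e *\<^sub>R y) \<bullet> F y\<bar> \<le> norm (grad a (\<xi> - e *\<^sub>R y)) * norm (F y)" by (rule Cauchy_Schwarz_ineq2)
    also have "\<dots> \<le> Kg * norm (F y)" unfolding Kg_def by (intro mult_right_mono norm_grad_bound a) auto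
    finally show "norm (grad a (\<xi> - e *\<^sub>R y) \<bullet> F y) \<le> Kg * norm (F y)" by simp
  qed
  then show ?thesis by (simp add: div_heat_def Kg_def)
qed

text \<open>The integrand at time \<open>s\<close> of the equation at time \<open>t\<close>. At s =
  t the kernel parameter is 0, so the integrand is only considered on the half-open
  interval.\<close>

definition duhamel :: "real \<Rightarrow> (real \<Rightarrow> real^2 \<Rightarrow> real) \<Rightarrow> real \<Rightarrow> real^2 \<Rightarrow> real" where
  "duhamel t u s \<xi> = exp (- (t - s) / 2) * div_heat (1 - (exp (- (t - s) / 2))\<^sup>2) (exp (- (t - s) / 2)) (flux (u s) (u s)) \<xi>"

text \<open>This secures joint measurability in time and space. The representatives
  \<open>u s\<close> are chosen separately for each time, and nothing makes them jointly measurable;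
  the smoothing kernel turns norm continuity in \<open>s\<close> into joint continuity.\<close>

lemma duhamel_continuous:
  assumes u: "\<And>s. s \<ge> 0 \<Longrightarrow> u s \<in> wL2"
    and cont: "\<And>t. t \<ge> 0 \<Longrightarrow> ((\<lambda>s. wnorm (\<lambda>\<xi>. u s \<xi> - u t \<xi>)) \<longlongrightarrow> 0) (at t within {0..})"
  shows "continuous_on ({0..<t} \<times> UNIV) (\<lambda>(s, \<xi>). duhamel t u s \<xi>)"
proof (rule continuous_on_sequentiallyI)
  fix p :: "nat \<Rightarrow> real \<times> (real^2)" and b
  assume p: "\<forall>n. p n \<in> {0..<t} \<times> UNIV" and b: "b \<in> {0..<t} \<times> UNIV" and lim: "p \<longlonglongrightarrow> b"
  define s where "s n = fst (p n)" for n
  define x where "x n = snd (p n)" for n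
  obtain s0 x0 where b0: "b = (s0, x0)" by (cases b)
  have s: "0 \<le> s n" "s n < t" for n using p[rule_format, of n] by (auto simp: s_def)
  have s0: "0 \<le> s0" "s0 < t" using b b0 by auto
  have sl: "s \<longlonglongrightarrow> s0" using tendsto_fst[OF lim] by (simp add: s_def[abs_def] b0)
  have xl: "x \<longlonglongrightarrow> x0" using tendsto_snd[OF lim] by (simp add: x_def[abs_def] b0)
  define e where "e n = exp (- (t - s n) / 2)" for n
  define e0 where "e0 = exp (- (t - s0) / 2)"
  define a where "a n = 1 - (e n)\<^sup>2" for n
  define a0 where "a0 = 1 - e0\<^sup>2"
  have el: "e \<longlonglongrightarrow> e0" unfolding e_def[abs_def] e0_def by (intro tendsto_intros sl) auto
  have al: "a \<longlonglongrightarrow> a0" unfolding a_def[abs_def] a0_def by (intro tendsto_intros el)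
  have ap: "a n > 0" for n using s[of n] by (auto simp: a_def e_def power_less_one_iff)
  have a0p: "a0 > 0" using s0 by (auto simp: a0_def e0_def power_less_one_iff)
  define Kg where "Kg a = 8 / sqrt a * (1 / (8 * pi * a))" for a
  have Kl: "(\<lambda>n. Kg (a n)) \<longlonglongrightarrow> Kg a0"
    unfolding Kg_def using a0p by (intro tendsto_intros al) auto
  have Kb: "norm (grad (a n) z) \<le> Kg (a n)" for n z unfolding Kg_def by (rule norm_grad_bound[OF ap])
  obtain K where "\<forall>n. norm (Kg (a n)) \<le> K"
    using convergent_imp_Bseq[OF convergentI[OF Kl]] by (rule BseqE)
  then have K: "norm (Kg (a n)) \<le> K" for n by blast
  define v where "v n = u (s n)" for n
  define v0 where "v0 = u s0"
  have vX: "v n \<in> wL2" for n using u[OF s(1)] by (simp add: v_def)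
  have v0X: "v0 \<in> wL2" using u[OF s0(1)] by (simp add: v0_def)
  note [measurable] = wL2_measurable[OF vX] wL2_measurable[OF v0X]
  define d where "d n = wnorm (\<lambda>\<xi>. v n \<xi> - v0 \<xi>)" for n
  have dl: "d \<longlonglongrightarrow> 0"
  proof -
    have "continuous (at s0 within {0..}) (\<lambda>r. wnorm (\<lambda>\<xi>. u r \<xi> - v0 \<xi>))"
      using cont[OF s0(1)] by (simp add: continuous_within v0_def wnorm_def wint_def)
    from continuous_within_tendsto_compose'[OF this _ sl]
    have "(\<lambda>n. wnorm (\<lambda>\<xi>. u (s n) \<xi> - v0 \<xi>)) \<longlonglongrightarrow> wnorm (\<lambda>\<xi>. u s0 \<xi> - v0 \<xi>)"
      using s by auto
    then show ?thesis by (simp add: d_def[abs_def] v_def v0_def wnorm_def wint_def)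
  qed
  define F0 where "F0 = flux v0 v0"
  have F0i: "integrable lborel F0" unfolding F0_def by (intro flux_integrable v0X)
  define cJ where "cJ = enn2real Criesz"
  have cJ: "cJ \<ge> 0" by (simp add: cJ_def)
  define Dn where "Dn n = div_heat (a n) (e n) (flux (v n) (v n)) (x n)" for n
  define En where "En n = div_heat (a n) (e n) F0 (x n)" for n
  have diff: "\<bar>Dn n - En n\<bar> \<le> K * (cJ * d n * (d n + wnorm v0 + wnorm v0))" for n
  proof -
    define w where "w \<xi> = v n \<xi> - v0 \<xi>" for \<xi>
    have wX: "w \<in> wL2" unfolding w_def by (intro wL2_diff vX v0X)
    note [measurable] = wL2_measurable[OF wX]
    have vw: "v n = (\<lambda>\<xi>. w \<xi> + v0 \<xi>)" by (simp add: w_def)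
    have "Dn n = div_heat (a n) (e n) (flux w w) (x n) + div_heat (a n) (e n) (flux w v0) (x n) + div_heat (a n) (e n) (flux v0 w) (x n) + En n"
      unfolding Dn_def En_def F0_def vw by (rule div_heat_flux_add[OF ap wX v0X wX v0X])
    moreover have b: "\<bar>div_heat (a n) (e n) (flux f g) (x n)\<bar> \<le> K * (cJ * wnorm f * wnorm g)" if "f \<in> wL2" "g \<in> wL2" for f g
    proof -
      have "\<bar>div_heat (a n) (e n) (flux f g) (x n)\<bar> \<le> Kg (a n) * (\<integral>y. norm (flux f g y) \<partial>lborel)"
        unfolding Kg_def by (intro div_heat_abs_le_L1 flux_integrable that ap)
      also have "\<dots> \<le> K * (cJ * wnorm f * wnorm g)"
        unfolding cJ_def using K[of n] by (intro mult_mono flux_L1_le that) (auto intro: integral_nonneg_AE)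
      finally show ?thesis .
    qed
    ultimately have "\<bar>Dn n - En n\<bar> \<le> K * (cJ * wnorm w * wnorm w) + K * (cJ * wnorm w * wnorm v0) + K * (cJ * wnorm v0 * wnorm w)"
      using b[OF wX wX] b[OF wX v0X] b[OF v0X wX] by linarith
    also have "\<dots> = K * (cJ * d n * (d n + wnorm v0 + wnorm v0))" by (simp add: d_def w_def[abs_def] algebra_simps)
    finally show ?thesis .
  qed
  have "(\<lambda>n. K * (cJ * d n * (d n + wnorm v0 + wnorm v0))) \<longlonglongrightarrow> K * (cJ * 0 * (0 + wnorm v0 + wnorm v0))"
    by (intro tendsto_intros dl)
  then have g0: "(\<lambda>n. K * (cJ * d n * (d n + wnorm v0 + wnorm v0))) \<longlonglongrightarrow> 0" by simp
  have ev: "\<forall>\<^sub>F n in sequentially. norm (Dn n - En n) \<le> K * (cJ * d n * (d n + wnorm v0 + wnorm v0))"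
    unfolding real_norm_def by (rule always_eventually, rule allI, rule diff)
  have DE: "(\<lambda>n. Dn n - En n) \<longlonglongrightarrow> 0"
    by (rule Lim_null_comparison[OF ev g0])
  have E: "En \<longlonglongrightarrow> div_heat a0 e0 F0 x0"
    unfolding En_def[abs_def] div_heat_def
  proof (rule integral_dominated_convergence[where w="\<lambda>y. K * norm (F0 y)"])
    have [measurable]: "F0 \<in> borel_measurable borel" using F0i by auto
    show "(\<lambda>y. grad a0 (x0 - e0 *\<^sub>R y) \<bullet> F0 y) \<in> borel_measurable lborel" by measurable
    show "(\<lambda>y. grad (a n) (x n - e n *\<^sub>R y) \<bullet> F0 y) \<in> borel_measurable lborel" for n by measurable
    show "integrable lborel (\<lambda>y. K * norm (F0 y))" using F0i by simp
    show "AE y in lborel. (\<lambda>n. grad (a n) (x n - e n *\<^sub>R y) \<bullet> F0 y) \<longlonglongrightarrow> grad a0 (x0 - e0 *\<^sub>R y) \<bullet> F0 y"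
      unfolding grad_def heat_def using a0p by (intro AE_I2 tendsto_intros al el xl) auto
    fix n
    show "AE y in lborel. norm (grad (a n) (x n - e n *\<^sub>R y) \<bullet> F0 y) \<le> K * norm (F0 y)"
    proof (rule AE_I2)
      fix y
      have "\<bar>grad (a n) (x n - e n *\<^sub>R y) \<bullet> F0 y\<bar> \<le> norm (grad (a n) (x n - e n *\<^sub>R y)) * norm (F0 y)" by (rule Cauchy_Schwarz_ineq2)
      also have "\<dots> \<le> K * norm (F0 y)"
        using Kb[of n "x n - e n *\<^sub>R y"] K[of n] by (intro mult_right_mono) auto
      finally show "norm (grad (a n) (x n - e n *\<^sub>R y) \<bullet> F0 y) \<le> K * norm (F0 y)" by simp
    qed
  qed
  have "Dn \<longlonglongrightarrow> div_heat a0 e0 F0 x0"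
    using tendsto_add[OF DE E] by simp
  then have "(\<lambda>n. e n * Dn n) \<longlonglongrightarrow> e0 * div_heat a0 e0 F0 x0" by (intro tendsto_intros el)
  moreover have "(\<lambda>n. (\<lambda>(s, \<xi>). duhamel t u s \<xi>) (p n)) = (\<lambda>n. e n * Dn n)"
    by (auto simp: duhamel_def e_def Dn_def a_def v_def s_def x_def case_prod_beta fun_eq_iff)
  moreover have "(\<lambda>(s, \<xi>). duhamel t u s \<xi>) b = e0 * div_heat a0 e0 F0 x0"
    by (simp add: b0 duhamel_def e0_def a0_def F0_def v0_def)
  ultimately show "(\<lambda>n. (\<lambda>(s, \<xi>). duhamel t u s \<xi>) (p n)) \<longlonglongrightarrow> (\<lambda>(s, \<xi>). duhamel t u s \<xi>) b" by simp
qed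

lemma duhamel_measurable:
  assumes "\<And>s. s \<ge> 0 \<Longrightarrow> u s \<in> wL2"
    and "\<And>t. t \<ge> 0 \<Longrightarrow> ((\<lambda>s. wnorm (\<lambda>\<xi>. u s \<xi> - u t \<xi>)) \<longlongrightarrow> 0) (at t within {0..})"
  shows "(\<lambda>(s, \<xi>). indicator {0..<t} s * duhamel t u s \<xi>) \<in> borel_measurable (borel \<Otimes>\<^sub>M borel)"
proof -
  have "{0..<t} \<times> (UNIV :: (real^2) set) \<in> sets borel"
    by (intro borel_Times) auto
  then have "(\<lambda>p. indicator ({0..<t} \<times> UNIV) p *\<^sub>R (\<lambda>(s, \<xi>). duhamel t u s \<xi>) p) \<in> borel_measurable borel"
    by (intro borel_measurable_continuous_on_indicator duhamel_continuous assms)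
  moreover have "(\<lambda>p. indicator ({0..<t} \<times> UNIV) p *\<^sub>R (\<lambda>(s, \<xi>). duhamel t u s \<xi>) p) = (\<lambda>(s, \<xi>). indicator {0..<t} s * duhamel t u s \<xi>)"
    by (auto simp: fun_eq_iff indicator_def)
  ultimately show ?thesis by (simp add: borel_prod)
qed

text \<open>Minkowski's integral inequality in time, by Cauchy-Schwarz against the weight \<open>q\<close>.\<close>

lemma wint_time_integral:
  fixes H :: "real \<Rightarrow> real^2 \<Rightarrow> real"
  assumes H[measurable]: "(\<lambda>(s, \<xi>). H s \<xi>) \<in> borel_measurable (borel \<Otimes>\<^sub>M borel)" and q[measurable]: "q \<in> borel_measurable borel"
    and q0: "\<And>s. q s \<ge> 0" and qH: "\<And>s \<xi>. q s = 0 \<Longrightarrow> H s \<xi> = 0"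
    and WH: "\<And>s. W (H s) \<le> ennreal ((q s)\<^sup>2)"
    and Q: "(\<integral>\<^sup>+s. ennreal (q s) \<partial>lborel) \<le> ennreal Q"
  shows "wint (\<lambda>\<xi>. \<integral>\<^sup>+s. ennreal \<bar>H s \<xi>\<bar> \<partial>lborel) \<le> (ennreal Q)\<^sup>2"
proof -
  \<comment> \<open>Where \<open>q s\<close> vanishes the quotient is 0 by convention; the
    factorisation survives because \<open>H s\<close> vanishes there too.\<close>
  define r where "r s \<xi> = ennreal (\<bar>H s \<xi>\<bar> / q s)" for s \<xi>
  have rm[measurable]: "(\<lambda>(s, \<xi>). r s \<xi>) \<in> borel_measurable (borel \<Otimes>\<^sub>M borel)" unfolding r_def by measurable
  have [measurable]: "(\<lambda>s. r s \<xi>) \<in> borel_measurable borel" for \<xi>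
    using measurable_compose[OF measurable_Pair2' rm, of \<xi>] by simp
  have [measurable]: "H s \<in> borel_measurable borel" for s
    using measurable_compose[OF measurable_Pair1' H, of s] by simp
  have [measurable]: "r s \<in> borel_measurable borel" for s
    using measurable_compose[OF measurable_Pair1' rm, of s] by simp
  have eq: "ennreal \<bar>H s \<xi>\<bar> = ennreal (q s) * (1 * r s \<xi>)" for s \<xi>
    using q0[of s] qH[of s \<xi>] by (cases "q s = 0") (auto simp: r_def ennreal_mult'[symmetric])
  have rm2: "(\<lambda>(\<xi>, s). ennreal (wt \<xi>) * (ennreal (q s) * (r s \<xi>)\<^sup>2)) \<in> borel_measurable (borel \<Otimes>\<^sub>M borel)"
    by measurable
  have "wint (\<lambda>\<xi>. \<integral>\<^sup>+s. ennreal \<bar>H s \<xi>\<bar> \<partial>lborel) \<le> (\<integral>\<^sup>+\<xi>. ennreal Q * (\<integral>\<^sup>+s. ennreal (wt \<xi>) * (ennreal (q s) * (r s \<xi>)\<^sup>2) \<partial>lborel) \<partial>lborel)"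
    unfolding wint_def
  proof (rule nn_integral_mono)
    fix \<xi>
    have "(\<integral>\<^sup>+s. ennreal \<bar>H s \<xi>\<bar> \<partial>lborel)\<^sup>2 \<le> (\<integral>\<^sup>+s. ennreal (q s) * 1\<^sup>2 \<partial>lborel) * (\<integral>\<^sup>+s. ennreal (q s) * (r s \<xi>)\<^sup>2 \<partial>lborel)"
      unfolding eq by (rule Cauchy_Schwarz_weighted) measurable
    also have "\<dots> \<le> ennreal Q * (\<integral>\<^sup>+s. ennreal (q s) * (r s \<xi>)\<^sup>2 \<partial>lborel)"
      using Q by (intro mult_right_mono) auto
    finally have "ennreal (wt \<xi>) * (\<integral>\<^sup>+s. ennreal \<bar>H s \<xi>\<bar> \<partial>lborel)\<^sup>2 \<le> ennreal (wt \<xi>) * (ennreal Q * (\<integral>\<^sup>+s. ennreal (q s) * (r s \<xi>)\<^sup>2 \<partial>lborel))"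
      by (rule mult_left_mono) simp
    also have "\<dots> = ennreal Q * (\<integral>\<^sup>+s. ennreal (wt \<xi>) * (ennreal (q s) * (r s \<xi>)\<^sup>2) \<partial>lborel)"
      by (subst nn_integral_cmult) (auto simp: ac_simps)
    finally show "ennreal (wt \<xi>) * (\<integral>\<^sup>+s. ennreal \<bar>H s \<xi>\<bar> \<partial>lborel)\<^sup>2 \<le> \<dots>" .
  qed
  also have "\<dots> = ennreal Q * (\<integral>\<^sup>+\<xi>. \<integral>\<^sup>+s. ennreal (wt \<xi>) * (ennreal (q s) * (r s \<xi>)\<^sup>2) \<partial>lborel \<partial>lborel)"
    using rm2 by (intro nn_integral_cmult) measurable
  finally have 1: "wint (\<lambda>\<xi>. \<integral>\<^sup>+s. ennreal \<bar>H s \<xi>\<bar> \<partial>lborel) \<le> ennreal Q * (\<integral>\<^sup>+\<xi>. \<integral>\<^sup>+s. ennreal (wt \<xi>) * (ennreal (q s) * (r s \<xi>)\<^sup>2) \<partial>lborel \<partial>lborel)" .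
  have "(\<integral>\<^sup>+\<xi>. \<integral>\<^sup>+s. ennreal (wt \<xi>) * (ennreal (q s) * (r s \<xi>)\<^sup>2) \<partial>lborel \<partial>lborel) = (\<integral>\<^sup>+s. \<integral>\<^sup>+\<xi>. ennreal (wt \<xi>) * (ennreal (q s) * (r s \<xi>)\<^sup>2) \<partial>lborel \<partial>lborel)"
    by (rule nn_integral_swap) (rule rm2)
  also have "\<dots> \<le> (\<integral>\<^sup>+s. ennreal (q s) \<partial>lborel)"
  proof (rule nn_integral_mono)
    fix s
    have rs: "r s = (\<lambda>\<xi>. ennreal (1 / q s) * ennreal \<bar>H s \<xi>\<bar>)"
      using q0[of s] by (intro ext) (simp add: r_def ennreal_mult'[symmetric])
    have "(\<integral>\<^sup>+\<xi>. ennreal (wt \<xi>) * (ennreal (q s) * (r s \<xi>)\<^sup>2) \<partial>lborel) = ennreal (q s) * wint (r s)"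
      unfolding wint_def by (subst nn_integral_cmult[symmetric]) (auto simp: ac_simps)
    also have "wint (r s) = (ennreal (1 / q s))\<^sup>2 * W (H s)" unfolding rs by (rule wint_cmult) measurable
    finally have e: "(\<integral>\<^sup>+\<xi>. ennreal (wt \<xi>) * (ennreal (q s) * (r s \<xi>)\<^sup>2) \<partial>lborel) = ennreal (q s) * ((ennreal (1 / q s))\<^sup>2 * W (H s))" .
    have "(ennreal (1 / q s))\<^sup>2 * W (H s) \<le> (ennreal (1 / q s))\<^sup>2 * ennreal ((q s)\<^sup>2)" by (intro mult_left_mono WH) auto
    also have "\<dots> \<le> 1" using q0[of s]
      by (cases "q s = 0") (auto simp: ennreal_power ennreal_mult'[symmetric] power_divide)
    finally have "ennreal (q s) * ((ennreal (1 / q s))\<^sup>2 * W (H s)) \<le> ennreal (q s) * 1"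
      by (rule mult_left_mono) simp
    with e show "(\<integral>\<^sup>+\<xi>. ennreal (wt \<xi>) * (ennreal (q s) * (r s \<xi>)\<^sup>2) \<partial>lborel) \<le> ennreal (q s)"
      by simp
  qed
  finally have 2: "(\<integral>\<^sup>+\<xi>. \<integral>\<^sup>+s. ennreal (wt \<xi>) * (ennreal (q s) * (r s \<xi>)\<^sup>2) \<partial>lborel \<partial>lborel) \<le> (\<integral>\<^sup>+s. ennreal (q s) \<partial>lborel)" .
  have "wint (\<lambda>\<xi>. \<integral>\<^sup>+s. ennreal \<bar>H s \<xi>\<bar> \<partial>lborel) \<le> ennreal Q * (\<integral>\<^sup>+s. ennreal (q s) \<partial>lborel)"
    by (rule order_trans[OF 1 mult_left_mono[OF 2]]) simp
  also have "\<dots> \<le> ennreal Q * ennreal Q" by (intro mult_left_mono Q) auto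
  finally show ?thesis by (simp add: power2_eq_square)
qed

text \<open>The square root of the factor in \<open>div_heat_bound\<close> at e = exp(-t/2).\<close>

definition duhamel_kernel :: "real \<Rightarrow> real" where "duhamel_kernel t = exp (- t) * (1 - exp (- t)) powr (- 3/4)"

lemma duhamel_kernel_measurable [measurable]: "duhamel_kernel \<in> borel_measurable borel"
  unfolding duhamel_kernel_def by measurable

lemma duhamel_kernel_pos: "t > 0 \<Longrightarrow> duhamel_kernel t > 0"
  by (simp add: duhamel_kernel_def)

text \<open>Up to time 1 the bound 1 - exp(-t) \<ge> t/2 leaves the integrable singularity t^(-3/4);
  afterwards the integrand is at most 2 exp(-(1 - \<mu>) t), which needs \<mu> < 1.\<close>

lemma duhamel_kernel_integral_finite:
  assumes \<mu>: "\<mu> < 1"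
  shows "(\<integral>\<^sup>+t. ennreal (exp (\<mu> * t) * duhamel_kernel t) * indicator {0<..} t \<partial>lborel) < \<infinity>"
proof -
  define d where "d = 1 - \<mu>"
  have d: "d > 0" using \<mu> by (simp add: d_def)
  have h1: "((\<lambda>t. t powr (-3/4)) has_integral (1 powr (-3/4+1) / (-3/4+1))) {0..1::real}"
    by (rule has_integral_powr_from_0) auto
  then have i1: "(\<integral>\<^sup>+t. ennreal (t powr (-3/4)) * indicator {0..1} t \<partial>lborel) = ennreal 4"
    using nn_integral_has_integral_lebesgue[OF _ h1] by (simp add: nn_integral_completion ennreal_mult' ennreal_indicator mult.commute)
  have h2: "((\<lambda>t. exp (- d * t)) has_integral exp (- d * 1) / d) {1..}"
    by (rule has_integral_exp_minus_to_infinity) (rule d)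
  then have i2: "(\<integral>\<^sup>+t. ennreal (exp (- d * t)) * indicator {1..} t \<partial>lborel) = ennreal (exp (- d * 1) / d)"
    using nn_integral_has_integral_lebesgue[OF _ h2] by (simp add: nn_integral_completion ennreal_mult' ennreal_indicator mult.commute)
  have "(\<integral>\<^sup>+t. ennreal (exp (\<mu> * t) * duhamel_kernel t) * indicator {0<..} t \<partial>lborel)
    \<le> (\<integral>\<^sup>+t. 2 * (ennreal (t powr (-3/4)) * indicator {0..1} t) + 2 * (ennreal (exp (- d * t)) * indicator {1..} t) \<partial>lborel)"
  proof (rule nn_integral_mono)
    fix t :: real
    have p2: "(1/2) powr (-3/4) \<le> (2::real)"
    proof -
      have "(1/2) powr (-3/4) = (2::real) powr (3/4)" by (simp add: powr_minus powr_divide)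
      also have "\<dots> \<le> 2 powr 1" by (rule powr_mono) auto
      finally show ?thesis by simp
    qed
    have m: "exp (\<mu> * t) * duhamel_kernel t = exp (- d * t) * (1 - exp (- t)) powr (-3/4)"
    proof -
      have "exp (\<mu> * t) * exp (- t) = exp (- d * t)" by (simp add: mult_exp_exp d_def algebra_simps)
      then show ?thesis by (simp only: duhamel_kernel_def mult.assoc[symmetric])
    qed
    show "ennreal (exp (\<mu> * t) * duhamel_kernel t) * indicator {0<..} t \<le> 2 * (ennreal (t powr (-3/4)) * indicator {0..1} t) + 2 * (ennreal (exp (- d * t)) * indicator {1..} t)"
    proof (cases "t > 0")
      case t: True
      show ?thesis
      proof (cases "t \<le> 1")
        case True
        have "exp (- t) \<le> 1 / (1 + t)"
          using exp_ge_add_one_self[of t] t by (simp add: exp_minus divide_inverse le_imp_inverse_le)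
        also have "\<dots> \<le> 1 - t / 2"
        proof -
          have "t * t \<le> t * 1" using t True by (intro mult_left_mono) auto
          then have "1 \<le> (1 - t / 2) * (1 + t)" by (simp add: algebra_simps)
          then show ?thesis using t by (simp add: pos_divide_le_eq)
        qed
        finally have "t / 2 \<le> 1 - exp (- t)" by simp
        then have "(1 - exp (- t)) powr (-3/4) \<le> (t * (1/2)) powr (-3/4)" using t by (intro powr_mono2') auto
        also have "\<dots> = t powr (-3/4) * (1/2) powr (-3/4)" using t by (subst powr_mult) auto
        also have "\<dots> \<le> t powr (-3/4) * 2" by (intro mult_left_mono p2) auto
        finally have "exp (- d * t) * (1 - exp (- t)) powr (-3/4) \<le> 1 * (t powr (-3/4) * 2)"
          using d t by (intro mult_mono) auto
        then have "ennreal (exp (\<mu> * t) * duhamel_kernel t) \<le> 2 * ennreal (t powr (-3/4))"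
          unfolding m by (simp add: ennreal_mult'[symmetric] ennreal_leI mult.commute flip: ennreal_numeral)
        then show ?thesis using t True by (intro add_increasing2) auto
      next
        case False
        have "1 + 1 \<le> exp (1::real)" by (rule exp_ge_add_one_self)
        also have "\<dots> \<le> exp t" using False by simp
        finally have "exp (- t) \<le> 1/2" by (simp add: exp_minus field_simps)
        then have "(1 - exp (- t)) powr (-3/4) \<le> (1/2) powr (-3/4)" by (intro powr_mono2') auto
        also note p2
        finally have "exp (- d * t) * (1 - exp (- t)) powr (-3/4) \<le> exp (- d * t) * 2"
          by (intro mult_left_mono) auto
        then have "ennreal (exp (\<mu> * t) * duhamel_kernel t) \<le> 2 * ennreal (exp (- d * t))"
          unfolding m by (simp add: ennreal_mult'[symmetric] ennreal_leI mult.commute flip: ennreal_numeral)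
        then show ?thesis using t False by (intro add_increasing) auto
      qed
    qed simp
  qed
  also have "\<dots> = 2 * ennreal 4 + 2 * ennreal (exp (- d * 1) / d)"
    by (subst nn_integral_add, measurable, subst nn_integral_cmult, measurable, subst nn_integral_cmult, measurable)
       (simp only: i1 i2)
  also have "\<dots> < \<infinity>" by (simp add: ennreal_mult_less_top)
  finally show ?thesis .
qed

text \<open>Splitting exp(-\<mu> s) as exp(-\<mu> t) exp(\<mu> (t - s)) leaves a function of t - s
  alone. The forcing rate exp(-\<mu> s) is thus reproduced with a constant independent of
  \<open>t\<close>.\<close>

lemma duhamel_kernel_convolution:
  "(\<integral>\<^sup>+s. ennreal (duhamel_kernel (t - s) * exp (- \<mu> * s)) * indicator {0..<t} s \<partial>lborel)
    \<le> ennreal (exp (- \<mu> * t)) * (\<integral>\<^sup>+t. ennreal (exp (\<mu> * t) * duhamel_kernel t) * indicator {0<..} t \<partial>lborel)"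
proof -
  have "(\<integral>\<^sup>+s. ennreal (duhamel_kernel (t - s) * exp (- \<mu> * s)) * indicator {0..<t} s \<partial>lborel)
    \<le> (\<integral>\<^sup>+s. ennreal (exp (- \<mu> * t)) * (ennreal (exp (\<mu> * (t - s)) * duhamel_kernel (t - s)) * indicator {0<..} (t - s)) \<partial>lborel)"
  proof (rule nn_integral_mono)
    fix s
    have "duhamel_kernel (t - s) * exp (- \<mu> * s) = exp (- \<mu> * t) * (exp (\<mu> * (t - s)) * duhamel_kernel (t - s))"
    proof -
      have "exp (- \<mu> * s) = exp (- \<mu> * t) * exp (\<mu> * (t - s))" by (simp add: mult_exp_exp algebra_simps)
      then show ?thesis by (simp only: mult.commute mult.left_commute)
    qed
    then have "ennreal (duhamel_kernel (t - s) * exp (- \<mu> * s)) = ennreal (exp (- \<mu> * t)) * ennreal (exp (\<mu> * (t - s)) * duhamel_kernel (t - s))"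
      by (simp only: ennreal_mult'[OF exp_ge_zero])
    moreover have "indicator {0..<t} s \<le> (indicator {0<..} (t - s) :: ennreal)" by (simp add: indicator_def)
    ultimately show "ennreal (duhamel_kernel (t - s) * exp (- \<mu> * s)) * indicator {0..<t} s \<le> ennreal (exp (- \<mu> * t)) * (ennreal (exp (\<mu> * (t - s)) * duhamel_kernel (t - s)) * indicator {0<..} (t - s))"
      unfolding mult.assoc[symmetric] by (simp only: mult_left_mono zero_le)
  qed
  also have "\<dots> = ennreal (exp (- \<mu> * t)) * (\<integral>\<^sup>+s. ennreal (exp (\<mu> * (t - s)) * duhamel_kernel (t - s)) * indicator {0<..} (t - s) \<partial>lborel)"
    by (rule nn_integral_cmult) measurable
  also have "(\<integral>\<^sup>+s. ennreal (exp (\<mu> * (t - s)) * duhamel_kernel (t - s)) * indicator {0<..} (t - s) \<partial>lborel) = (\<integral>\<^sup>+t. ennreal (exp (\<mu> * t) * duhamel_kernel t) * indicator {0<..} t \<partial>lborel)"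
    using nn_integral_real_affine[of "\<lambda>t. ennreal (exp (\<mu> * t) * duhamel_kernel t) * indicator {0<..} t" "-1" t] by simp
  finally show ?thesis .
qed

section \<open>Bootstrap\<close>

lemma wL2_first_moment_le:
  assumes f: "f \<in> wL2"
  shows "(\<integral>y. sqrt (1 + (norm y)\<^sup>2) * \<bar>f y\<bar> \<partial>lborel) \<le> sqrt (enn2real (decay_int 2)) * wnorm f"
proof -
  have [measurable]: "f \<in> borel_measurable borel" using f by (auto simp: wL2_def)
  define d where "d = enn2real (decay_int 2)"
  have d: "decay_int 2 = ennreal d" "d \<ge> 0" using decay_int_finite[of 2] by (auto simp: d_def)
  have eq: "(\<integral>\<^sup>+y. ennreal (sqrt (1 + (norm y)\<^sup>2) * \<bar>f y\<bar>) \<partial>lborel) = (\<integral>\<^sup>+y. ennreal ((1 + (norm y)\<^sup>2) powr (1/2) * \<bar>f y\<bar>) \<partial>lborel)"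
    by (intro nn_integral_cong) (simp add: powr_half_sqrt add_nonneg_nonneg)
  have "(\<integral>\<^sup>+y. ennreal (sqrt (1 + (norm y)\<^sup>2) * \<bar>f y\<bar>) \<partial>lborel)\<^sup>2 \<le> decay_int (3 - 1) * W f"
    unfolding eq by (rule moment_bound) measurable
  also have "\<dots> = (ennreal (sqrt d * wnorm f))\<^sup>2"
    using d f by (simp add: wnorm_square ennreal_mult'[symmetric] ennreal_power power_mult_distrib)
  finally have le: "(\<integral>\<^sup>+y. ennreal (sqrt (1 + (norm y)\<^sup>2) * \<bar>f y\<bar>) \<partial>lborel) \<le> ennreal (sqrt d * wnorm f)"
    using d by (intro ennreal_square_le) auto
  have "(\<integral>y. sqrt (1 + (norm y)\<^sup>2) * \<bar>f y\<bar> \<partial>lborel) = enn2real (\<integral>\<^sup>+y. ennreal (sqrt (1 + (norm y)\<^sup>2) * \<bar>f y\<bar>) \<partial>lborel)"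
  proof (rule integral_eq_nn_integral)
    show "(\<lambda>y. sqrt (1 + (norm y)\<^sup>2) * \<bar>f y\<bar>) \<in> borel_measurable lborel" by measurable
    show "AE y in lborel. 0 \<le> sqrt (1 + (norm y)\<^sup>2) * \<bar>f y\<bar>"
      by (intro AE_I2 mult_nonneg_nonneg real_sqrt_ge_zero add_nonneg_nonneg) auto
  qed
  also have "\<dots> \<le> sqrt d * wnorm f"
    using le d(2) by (intro enn2real_leI mult_nonneg_nonneg wnorm_nonneg real_sqrt_ge_zero)
  finally show ?thesis by (simp only: d_def)
qed

lemma wL2_moments_le:
  assumes f: "f \<in> wL2"
  shows "\<bar>\<integral>y. f y \<partial>lborel\<bar> \<le> sqrt (enn2real (decay_int 2)) * wnorm f"
    and "\<bar>\<integral>y. (d \<bullet> y) * f y \<partial>lborel\<bar> \<le> norm d * (sqrt (enn2real (decay_int 2)) * wnorm f)"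
proof -
  have af: "(\<lambda>y. \<bar>f y\<bar>) \<in> wL2" using f by (auto simp: wL2_def)
  have i: "integrable lborel (\<lambda>y. sqrt (1 + (norm y)\<^sup>2) * \<bar>f y\<bar>)" by (rule wL2_moment1_integrable[OF af])
  have "norm (\<integral>y. f y \<partial>lborel) \<le> (\<integral>y. sqrt (1 + (norm y)\<^sup>2) * \<bar>f y\<bar> \<partial>lborel)"
  proof (rule Bochner_Integration.integral_norm_bound_integral[OF wL2_integrable[OF f] i])
    fix y show "norm (f y) \<le> sqrt (1 + (norm y)\<^sup>2) * \<bar>f y\<bar>"
      using mult_right_mono[OF le_sqrt_1_norm(1)[of y], of "\<bar>f y\<bar>"] by simp
  qed
  with wL2_first_moment_le[OF f] show "\<bar>\<integral>y. f y \<partial>lborel\<bar> \<le> sqrt (enn2real (decay_int 2)) * wnorm f" by simp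
  have "norm (\<integral>y. (d \<bullet> y) * f y \<partial>lborel) \<le> (\<integral>y. norm d * (sqrt (1 + (norm y)\<^sup>2) * \<bar>f y\<bar>) \<partial>lborel)"
  proof (rule Bochner_Integration.integral_norm_bound_integral[OF wL2_moment_integrable[OF f]])
    fix y :: "real^2"
    have "\<bar>d \<bullet> y\<bar> \<le> norm d * norm y" by (rule Cauchy_Schwarz_ineq2)
    also have "\<dots> \<le> norm d * sqrt (1 + (norm y)\<^sup>2)" by (intro mult_left_mono le_sqrt_1_norm) auto
    finally show "norm ((d \<bullet> y) * f y) \<le> norm d * (sqrt (1 + (norm y)\<^sup>2) * \<bar>f y\<bar>)"
      by (simp add: abs_mult mult_right_mono flip: mult.assoc)
  qed (use i in simp)
  also have "\<dots> \<le> norm d * (sqrt (enn2real (decay_int 2)) * wnorm f)"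
    using wL2_first_moment_le[OF f] by (simp add: mult_left_mono)
  finally show "\<bar>\<integral>y. (d \<bullet> y) * f y \<partial>lborel\<bar> \<le> norm d * (sqrt (enn2real (decay_int 2)) * wnorm f)" by simp
qed

lemma wnorm_gaussian_le:
  obtains N where "N > 0" "wnorm G \<le> N" "\<And>c. wnorm (momG c) \<le> N * norm c"
proof -
  obtain T where T: "T > 0" "\<And>x. \<bar>G x\<bar> \<le> T * gauss_tail x" "\<And>c x. \<bar>momG c x\<bar> \<le> T * norm c * gauss_tail x"
    "\<And>x h. norm h \<le> 1 \<Longrightarrow> \<bar>G (x + h) - G x + 1/2 * momG h x\<bar> \<le> T * (norm h)\<^sup>2 * gauss_tail x"
    using G_taylor by blast
  have le: "wnorm f \<le> k * wnorm gauss_tail" if "k \<ge> 0" "\<And>x. \<bar>f x\<bar> \<le> k * gauss_tail x" for f k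
  proof (rule wnorm_le)
    have "W f \<le> W (\<lambda>x. k * gauss_tail x)" by (intro W_mono order_trans[OF that(2) abs_ge_self])
    also have "\<dots> = ennreal ((k * wnorm gauss_tail)\<^sup>2)"
      using W_cmult[of gauss_tail k] by (simp add: wnorm_square[OF gauss_tail_wL2] ennreal_mult'[symmetric] power_mult_distrib)
    finally show "W f \<le> ennreal ((k * wnorm gauss_tail)\<^sup>2)" .
  qed (use that in simp)
  show thesis
  \<comment> \<open>The summand 1 gives strict positivity directly.\<close>
  proof (rule that[of "T * wnorm gauss_tail + 1"])
    show "wnorm G \<le> T * wnorm gauss_tail + 1" using le[of T G] T by simp
    show "wnorm (momG c) \<le> (T * wnorm gauss_tail + 1) * norm c" for c
    proof -
      have "wnorm (momG c) \<le> T * norm c * wnorm gauss_tail" using le[of "T * norm c" "momG c"] T by simp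
      moreover have "(T * wnorm gauss_tail + 1) * norm c = T * norm c * wnorm gauss_tail + norm c" by (simp add: algebra_simps)
      ultimately show ?thesis using norm_ge_zero[of c] by linarith
    qed
  qed (use T in \<open>simp add: add_nonneg_pos\<close>)
qed

text \<open>The equation enters only through an upper bound on the Duhamel term, which also covers the junk
  value \<open>0\<close> of a divergent time integral.\<close>

definition mild_evolution :: "(real^2 \<Rightarrow> real) \<Rightarrow> (real \<Rightarrow> real^2 \<Rightarrow> real) \<Rightarrow> bool" where
  "mild_evolution w0 u \<longleftrightarrow> (\<forall>s\<ge>0. u s \<in> wL2) \<and>
     (\<forall>t\<ge>0. ((\<lambda>s. wnorm (\<lambda>\<xi>. u s \<xi> - u t \<xi>)) \<longlongrightarrow> 0) (at t within {0..})) \<and>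
     (\<forall>t\<ge>0. AE \<xi> in lborel.
        ennreal \<bar>u t \<xi> - (if t = 0 then w0 \<xi> else heat_conv (1 - (exp (- t / 2))\<^sup>2) (exp (- t / 2)) w0 \<xi>)\<bar>
        \<le> (\<integral>\<^sup>+s. ennreal \<bar>indicator {0..<t} s * duhamel t u s \<xi>\<bar> \<partial>lborel))"

text \<open>The target 2 \<open>C0\<close> r exp(-\<mu> t) for the remainder is linear in
  \<open>r\<close>. The linear part of the evolution uses one half of it, and the Duhamel term,
  quadratic in \<open>r\<close>, strictly less than the other half.\<close>

lemma evolution_decay:
  fixes \<mu> :: real
  assumes \<mu>: "1/2 < \<mu>" "\<mu> < 1"
  obtains r C where "r > 0" "C > 0"
    "\<And>w0 u t. w0 \<in> wL2 \<Longrightarrow> wnorm w0 \<le> r \<Longrightarrow> mild_evolution w0 u \<Longrightarrow> t \<ge> 0 \<Longrightarrow>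
      wnorm (\<lambda>\<xi>. u t \<xi> - (\<integral>y. w0 y \<partial>lborel) * G \<xi>
          + 1/2 * (- (\<integral>y. y $ 1 * w0 y \<partial>lborel) * \<xi> $ 1 + - (\<integral>y. y $ 2 * w0 y \<partial>lborel) * \<xi> $ 2) * G \<xi> * exp (- t / 2))
         \<le> C * exp (- \<mu> * t)"
proof -
  obtain C1' where C1': "C1' < \<infinity>"
    "\<And>e f. 0 < e \<Longrightarrow> e < 1 \<Longrightarrow> f \<in> wL2 \<Longrightarrow> (\<integral>y. f y \<partial>lborel) = 0 \<Longrightarrow> (\<And>c. (\<integral>y. (c \<bullet> y) * f y \<partial>lborel) = 0) \<Longrightarrow>
      W (heat_conv (1 - e\<^sup>2) e f) \<le> C1' * ennreal (e powr (4 * \<mu>)) * W f"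
    using heat_conv_bound[OF \<mu>] by blast
  define C1 where "C1 = enn2real C1'"
  have C1: "C1' = ennreal C1" "C1 \<ge> 0" using C1'(1) by (auto simp: C1_def)
  obtain C2' where C2': "C2' < \<infinity>"
    "\<And>e f g. 0 < e \<Longrightarrow> e < 1 \<Longrightarrow> f \<in> wL2 \<Longrightarrow> g \<in> wL2 \<Longrightarrow>
      W (\<lambda>\<xi>. e * div_heat (1 - e\<^sup>2) e (\<lambda>y. flux f g y + flux g f y) \<xi>)
      \<le> C2' * ennreal (e ^ 4 / ((1 - e\<^sup>2) * sqrt (1 - e\<^sup>2))) * W f * W g"
    using div_heat_bound by blast
  define C2 where "C2 = enn2real C2'"
  have C2: "C2' = ennreal C2" "C2 \<ge> 0" using C2'(1) by (auto simp: C2_def)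
  obtain N where N: "N > 0" "wnorm G \<le> N" "\<And>c. wnorm (momG c) \<le> N * norm c"
    using wnorm_gaussian_le by blast
  define \<kappa> where "\<kappa> = sqrt (enn2real (decay_int 2))"
  have \<kappa>: "\<kappa> \<ge> 0" by (simp add: \<kappa>_def)
  define Kc where "Kc = enn2real (\<integral>\<^sup>+t. ennreal (exp (\<mu> * t) * duhamel_kernel t) * indicator {0<..} t \<partial>lborel)"
  have Kc: "(\<integral>\<^sup>+t. ennreal (exp (\<mu> * t) * duhamel_kernel t) * indicator {0<..} t \<partial>lborel) = ennreal Kc" "Kc \<ge> 0"
    using duhamel_kernel_integral_finite[OF \<mu>(2)] by (auto simp: Kc_def)
  \<comment> \<open>1 + 2 \<kappa> N bounds the initial remainder relative to \<open>r\<close>. The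
    summand 1 in the other factor covers time 0, and sqrt(C1) the positive times.\<close>
  define C0 where "C0 = (1 + sqrt C1) * (1 + 2 * \<kappa> * N)"
  have C0: "C0 > 0" "1 + 2 * \<kappa> * N \<le> C0" "sqrt C1 * (1 + 2 * \<kappa> * N) \<le> C0"
  proof -
    have p: "1 \<le> 1 + 2 * \<kappa> * N" using \<kappa> N(1) by simp
    have s1: "0 \<le> sqrt C1" using C1(2) by simp
    have "C0 = (1 + 2 * \<kappa> * N) + sqrt C1 * (1 + 2 * \<kappa> * N)" by (simp add: C0_def algebra_simps)
    moreover have "0 \<le> sqrt C1 * (1 + 2 * \<kappa> * N)" using p s1 by (intro mult_nonneg_nonneg) auto
    ultimately show "C0 > 0" "1 + 2 * \<kappa> * N \<le> C0" "sqrt C1 * (1 + 2 * \<kappa> * N) \<le> C0" using p by linarith+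
  qed
  \<comment> \<open>One number bounding the Gaussian part, its first-moment component and the
    remainder, all relative to \<open>r\<close>.\<close>
  define m0 where "m0 = 2 * \<kappa> * N + 2 * C0"
  have m0: "m0 > 0" "2 * \<kappa> * N \<le> m0" "\<kappa> * N \<le> m0" "2 * C0 \<le> m0"
    using \<kappa> N(1) C0(1) by (auto simp: m0_def add_nonneg_pos)
  \<comment> \<open>The three quadratic terms enter with weights 1/2, 1/2 and 1, whence 2. Adding 1
    to sqrt(C2) keeps the constant positive.\<close>
  define \<Lambda> where "\<Lambda> = 2 * (sqrt C2 + 1) * m0\<^sup>2"
  have \<Lambda>: "\<Lambda> > 0" using C2(2) m0(1) by (auto simp: \<Lambda>_def intro!: mult_pos_pos add_nonneg_pos)
  define X0 where "X0 = \<Lambda> * Kc + 1"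
  \<comment> \<open>Chosen so that \<Lambda> Kc r stays below C0/2.\<close>
  define r where "r = C0 / (2 * X0)"
  have den: "X0 > 0" using \<Lambda> Kc(2) by (simp add: X0_def add_nonneg_pos)
  have r: "r > 0" using C0(1) den by (simp add: r_def)
  have rK: "\<Lambda> * r\<^sup>2 * Kc < C0 * r"
  proof -
    have "\<Lambda> * Kc * r < X0 * r" using r by (simp add: X0_def)
    also have "\<dots> = C0 / 2" using den by (simp add: r_def)
    also have "\<dots> < C0" using C0 by simp
    finally have "\<Lambda> * Kc * r * r < C0 * r" using r by (intro mult_strict_right_mono)
    then show ?thesis by (simp add: power2_eq_square ac_simps)
  qed
  show thesis
  proof (rule that[of r "2 * C0 * r"])
    show "r > 0" "2 * C0 * r > 0" using r C0 by auto
    fix w0 :: "real^2 \<Rightarrow> real" and u and t :: real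
    assume w0: "w0 \<in> wL2" "wnorm w0 \<le> r" and me: "mild_evolution w0 u" and t: "t \<ge> 0"
    have u: "u s \<in> wL2" and cont: "((\<lambda>r. wnorm (\<lambda>\<xi>. u r \<xi> - u s \<xi>)) \<longlongrightarrow> 0) (at s within {0..})"
      and eqn: "AE \<xi> in lborel.
         ennreal \<bar>u s \<xi> - (if s = 0 then w0 \<xi> else heat_conv (1 - (exp (- s / 2))\<^sup>2) (exp (- s / 2)) w0 \<xi>)\<bar>
         \<le> (\<integral>\<^sup>+q. ennreal \<bar>indicator {0..<s} q * duhamel s u q \<xi>\<bar> \<partial>lborel)" if "s \<ge> 0" for s
      using me that unfolding mild_evolution_def by blast+
    note [measurable] = wL2_measurable[OF w0(1)]
    define A where "A = (\<integral>y. w0 y \<partial>lborel)"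
    define m where "m i = (\<integral>y. y $ i * w0 y \<partial>lborel)" for i :: 2
    \<comment> \<open>The factor 1/2 compensates the variance in
      \<open>integral_momG_moment\<close>. The sign is opposite to that of the B's in the statement,
      which are minus the moments.\<close>
    define c where "c = (\<chi> i. m i / 2)"
    have mi: "m i = (\<integral>y. (axis i 1 \<bullet> y) * w0 y \<partial>lborel)" for i by (simp add: m_def inner_axis')
    have md: "(\<integral>y. (d \<bullet> y) * w0 y \<partial>lborel) = 2 * (d \<bullet> c)" for d
    proof -
      have i: "integrable lborel (\<lambda>y. y $ i * w0 y)" for i
        using wL2_moment_integrable[OF w0(1), of "axis i 1"] by (simp add: inner_axis')
      have "(\<lambda>y. (d \<bullet> y) * w0 y) = (\<lambda>y. d $ 1 * (y $ 1 * w0 y) + d $ 2 * (y $ 2 * w0 y))"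
        by (rule ext) (simp add: inner_plane algebra_simps)
      then show ?thesis using i by (simp add: inner_plane c_def m_def)
    qed
    have kr: "\<kappa> * wnorm w0 \<le> \<kappa> * r" using w0(2) \<kappa> by (rule mult_left_mono)
    have Ab: "\<bar>A\<bar> \<le> \<kappa> * r" using wL2_moments_le(1)[OF w0(1)] kr by (simp add: A_def \<kappa>_def)
    have cb: "norm c \<le> \<kappa> * r"
    proof -
      have "\<bar>m i\<bar> \<le> \<kappa> * r" for i
        using wL2_moments_le(2)[OF w0(1), of "axis i 1"] kr unfolding mi \<kappa>_def by simp
      then have "\<bar>c $ i\<bar> \<le> \<kappa> * r / 2" for i by (simp add: c_def)
      then have "(\<Sum>i\<in>UNIV. \<bar>c $ i\<bar>) \<le> \<kappa> * r / 2 + \<kappa> * r / 2" unfolding sum_2 by (intro add_mono)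
      then show ?thesis using norm_le_l1_cart[of c] by simp
    qed
    define P where "P s \<xi> = A * G \<xi> + momG (exp (- s / 2) *\<^sub>R c) \<xi>" for s \<xi>
    define R where "R s \<xi> = u s \<xi> - P s \<xi>" for s \<xi>
    have PX: "P s \<in> wL2" for s unfolding P_def[abs_def] by (intro wL2_add wL2_cmult G_wL2 momG_wL2)
    have RX: "R s \<in> wL2" if "s \<ge> 0" for s unfolding R_def[abs_def] by (intro wL2_diff u PX that)
    have AG: "wnorm (\<lambda>\<xi>. A * G \<xi>) \<le> \<kappa> * r * N"
      using N(2) Ab \<kappa> r unfolding wnorm_cmult[OF G_wL2] by (intro mult_mono) auto
    have lGb: "wnorm (momG (exp (- s / 2) *\<^sub>R c)) \<le> \<kappa> * N * r * exp (- s / 2)" for s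
    proof -
      have "wnorm (momG (exp (- s / 2) *\<^sub>R c)) \<le> N * (exp (- s / 2) * norm c)" using N(3)[of "exp (- s / 2) *\<^sub>R c"] by simp
      also have "\<dots> \<le> N * (exp (- s / 2) * (\<kappa> * r))" using N(1) cb by (intro mult_left_mono) auto
      finally show ?thesis by (simp add: ac_simps)
    qed
    have Pb: "wnorm (P s) \<le> 2 * \<kappa> * N * r" if "s \<ge> 0" for s
    proof -
      have "wnorm (P s) \<le> wnorm (\<lambda>\<xi>. A * G \<xi>) + wnorm (momG (exp (- s / 2) *\<^sub>R c))"
        unfolding P_def[abs_def] by (intro wnorm_triangle wL2_cmult G_wL2 momG_wL2)
      also have "\<dots> \<le> \<kappa> * r * N + \<kappa> * N * r * 1"
        using that \<kappa> N(1) r by (intro add_mono AG order_trans[OF lGb] mult_left_mono) auto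
      finally show ?thesis by (simp add: mult.commute mult.left_commute)
    qed
    define R0 where "R0 \<xi> = w0 \<xi> - P 0 \<xi>" for \<xi>
    have R0X: "R0 \<in> wL2" unfolding R0_def[abs_def] by (intro wL2_diff w0 PX)
    note [measurable] = wL2_measurable[OF R0X]
    have R0b: "wnorm R0 \<le> (1 + 2 * \<kappa> * N) * r"
    proof -
      have "wnorm R0 \<le> wnorm w0 + wnorm (\<lambda>\<xi>. (-1) * P 0 \<xi>)"
        using wnorm_triangle[OF w0(1) wL2_cmult[OF PX, of "-1" 0]] by (simp add: R0_def[abs_def])
      also have "\<dots> \<le> r + 2 * \<kappa> * N * r" using w0(2) Pb[of 0] unfolding wnorm_cmult[OF PX] by simp
      finally show ?thesis by (simp add: algebra_simps)
    qed
    have i0: "integrable lborel w0" "integrable lborel G" "integrable lborel (momG d)" for d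
      by (intro wL2_integrable w0 G_wL2 momG_wL2)+
    have R0m: "(\<integral>y. R0 y \<partial>lborel) = 0"
      unfolding R0_def P_def using i0 by (simp add: A_def integral_G integral_momG)
    have R0m1: "(\<integral>y. (d \<bullet> y) * R0 y \<partial>lborel) = 0" for d
    proof -
      have i: "integrable lborel (\<lambda>y. (d \<bullet> y) * w0 y)" "integrable lborel (\<lambda>y. (d \<bullet> y) * G y)" "integrable lborel (\<lambda>y. (d \<bullet> y) * momG c y)"
        by (intro wL2_moment_integrable w0 G_wL2 momG_wL2)+
      have "(\<lambda>y. (d \<bullet> y) * R0 y) = (\<lambda>y. (d \<bullet> y) * w0 y - A * ((d \<bullet> y) * G y) - (d \<bullet> y) * momG c y)"
        by (rule ext) (simp add: R0_def P_def algebra_simps)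
      moreover have "(\<integral>y. (d \<bullet> y) * G y \<partial>lborel) = 0" using integral_momG[of d] by (simp add: momG_def)
      ultimately show ?thesis using i by (simp add: md integral_momG_moment)
    qed
    define lin where "lin t \<xi> = (if t = 0 then w0 \<xi> else heat_conv (1 - (exp (- t / 2))\<^sup>2) (exp (- t / 2)) w0 \<xi>) - P t \<xi>" for t \<xi>
    have linb: "W (lin t) \<le> ennreal ((C0 * r * exp (- \<mu> * t))\<^sup>2)" if t: "t \<ge> 0" for t
    proof (cases "t = 0")
      case True
      have "W (lin 0) = W R0" by (simp add: lin_def R0_def)
      also have "\<dots> = ennreal ((wnorm R0)\<^sup>2)" by (rule wnorm_square[OF R0X])
      also have "\<dots> \<le> ennreal ((C0 * r)\<^sup>2)"
        using order_trans[OF R0b mult_right_mono[OF C0(2)]] r by (intro ennreal_leI power_mono) auto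
      finally show ?thesis using True by simp
    next
      case False
      define e where "e = exp (- t / 2)"
      have e: "0 < e" "e < 1" using False t by (auto simp: e_def)
      have a: "1 - e\<^sup>2 > 0" using e by (simp add: power_less_one_iff)
      \<comment> \<open>The Gaussian part consists of eigenfunctions, so it is exactly the linear
        evolution of its initial value. What remains starts from data with vanishing mean and first
        moments.\<close>
      have "lin t \<xi> = heat_conv (1 - e\<^sup>2) e R0 \<xi>" for \<xi>
      proof -
        have w: "w0 = (\<lambda>y. R0 y + (A * G y + 1 * momG c y))" by (rule ext) (simp add: R0_def P_def)
        have "heat_conv (1 - e\<^sup>2) e w0 \<xi> = heat_conv (1 - e\<^sup>2) e R0 \<xi> + (A * G \<xi> + 1 * (e * momG c \<xi>))"
          by (subst w, subst heat_conv_add[OF wL2_integrable[OF R0X] wL2_integrable a], intro wL2_add wL2_cmult G_wL2 momG_wL2,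
              subst heat_conv_add[OF wL2_integrable wL2_integrable a], intro wL2_cmult G_wL2, intro wL2_cmult momG_wL2)
             (simp only: heat_conv_cmult heat_conv_G[OF e] heat_conv_momG[OF e])
        then show ?thesis using False by (simp add: lin_def P_def momG_def e_def)
      qed
      then have "lin t = heat_conv (1 - e\<^sup>2) e R0" by (rule ext)
      then have "W (lin t) \<le> C1' * ennreal (e powr (4 * \<mu>)) * W R0"
        using C1'(2)[OF e R0X R0m R0m1] by simp
      also have "\<dots> = ennreal (C1 * e powr (4 * \<mu>) * (wnorm R0)\<^sup>2)"
        using C1 by (simp add: wnorm_square[OF R0X] ennreal_mult'[symmetric])
      also have "\<dots> \<le> ennreal ((C0 * r * exp (- \<mu> * t))\<^sup>2)"
      proof (rule ennreal_leI)
        have "C1 * e powr (4 * \<mu>) * (wnorm R0)\<^sup>2 = (sqrt C1 * wnorm R0 * exp (- \<mu> * t))\<^sup>2"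
          using C1(2) by (simp add: power_mult_distrib e_def powr_def exp_of_nat_mult[symmetric] ac_simps)
        also have "\<dots> \<le> (C0 * r * exp (- \<mu> * t))\<^sup>2"
        proof (intro power_mono mult_right_mono)
          have "sqrt C1 * wnorm R0 \<le> sqrt C1 * ((1 + 2 * \<kappa> * N) * r)" using R0b C1(2) by (intro mult_left_mono) auto
          also have "\<dots> \<le> C0 * r" using mult_right_mono[OF C0(3), of r] r by (simp add: mult.assoc)
          finally show "sqrt C1 * wnorm R0 \<le> C0 * r" .
        qed (use C1(2) in auto)
        finally show "C1 * e powr (4 * \<mu>) * (wnorm R0)\<^sup>2 \<le> (C0 * r * exp (- \<mu> * t))\<^sup>2" .
      qed
      finally show ?thesis .
    qed
    \<comment> \<open>A weak bound at all earlier times gives a strict bound now. At time 0 the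
      hypothesis is empty, so the start of the bootstrap is included.\<close>
    have step: "wnorm (R t) < 2 * C0 * r * exp (- \<mu> * t)"
      if t: "t \<ge> 0" and prev: "\<And>s. 0 \<le> s \<Longrightarrow> s < t \<Longrightarrow> wnorm (R s) \<le> 2 * C0 * r * exp (- \<mu> * s)" for t
    proof -
      define H where "H s \<xi> = indicator {0..<t} s * duhamel t u s \<xi>" for s \<xi>
      define q where "q s = indicator {0..<t} s * (\<Lambda> * r\<^sup>2 * (duhamel_kernel (t - s) * exp (- \<mu> * s)))" for s :: real
      have Hm: "(\<lambda>(s, \<xi>). H s \<xi>) \<in> borel_measurable (borel \<Otimes>\<^sub>M borel)"
        unfolding H_def using u cont by (rule duhamel_measurable)
      have HW: "W (H s) \<le> ennreal ((q s)\<^sup>2)" for s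
      proof (cases "s \<in> {0..<t}")
        case False
        then show ?thesis by (simp add: H_def wint_def)
      next
        case True
        then have s: "0 \<le> s" "s < t" by auto
        define e where "e = exp (- (t - s) / 2)"
        have e: "0 < e" "e < 1" using s by (auto simp: e_def)
        define a where "a = 1 - e\<^sup>2"
        have a: "a > 0" using e by (simp add: a_def power_less_one_iff)
        define k where "k = duhamel_kernel (t - s)"
        have k: "k > 0" using s by (simp add: k_def duhamel_kernel_pos)
        have k2: "e ^ 4 / (a * sqrt a) = k\<^sup>2"
        proof -
          have e2: "e\<^sup>2 = exp (- (t - s))" by (simp add: e_def power2_eq_square exp_add[symmetric])
          have "k\<^sup>2 = (e\<^sup>2)\<^sup>2 * ((a powr (-3/4)) * (a powr (-3/4)))"
          proof -
            have "k = e\<^sup>2 * a powr (-3/4)" by (simp only: k_def duhamel_kernel_def e2 a_def)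
            then show ?thesis by (simp only: power_mult_distrib power2_eq_square[of "a powr (-3/4)"])
          qed
          also have "(a powr (-3/4)) * (a powr (-3/4)) = a powr (- (3/2))" by (simp add: powr_add[symmetric])
          also have "\<dots> = 1 / (a powr (1 + 1/2))" by (simp add: powr_minus_divide)
          also have "a powr (1 + 1/2) = a * sqrt a" using a unfolding powr_add by (simp add: powr_half_sqrt)
          finally show ?thesis by (simp flip: power_mult)
        qed
        \<comment> \<open>Symmetrised because only the sum of both orders has mean zero; on equal
          arguments this doubles the flux, hence the factors 1/2 below.\<close>
        define B where "B f g \<xi> = e * div_heat a e (\<lambda>y. flux f g y + flux g f y) \<xi>" for f g \<xi>
        have Bb: "W (B f g) \<le> ennreal ((sqrt C2 * k * wnorm f * wnorm g)\<^sup>2)" if "f \<in> wL2" "g \<in> wL2" for f g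
        proof -
          have "W (B f g) \<le> C2' * ennreal (e ^ 4 / (a * sqrt a)) * W f * W g"
            unfolding B_def[abs_def] a_def by (rule C2'(2)[OF e that])
          also have "\<dots> = ennreal ((sqrt C2 * k * wnorm f * wnorm g)\<^sup>2)"
            unfolding k2 C2(1) wnorm_square[OF that(1)] wnorm_square[OF that(2)] using C2(2)
            by (simp add: ennreal_mult'[symmetric] power_mult_distrib)
          finally show ?thesis .
        qed
        have Bm[measurable]: "B f g \<in> borel_measurable borel" if "f \<in> wL2" "g \<in> wL2" for f g
          using wL2_measurable[OF that(1)] wL2_measurable[OF that(2)] unfolding B_def by measurable
        define l where "l = momG (exp (- s / 2) *\<^sub>R c)"
        have lX: "l \<in> wL2" by (simp add: l_def momG_wL2)
        have RsX: "R s \<in> wL2" using RX s by simp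
        note [measurable] = wL2_measurable[OF lX] wL2_measurable[OF RsX] wL2_measurable[OF PX]
        have dd: "B f g \<xi> = e * (div_heat a e (flux f g) \<xi> + div_heat a e (flux g f) \<xi>)" if "f \<in> wL2" "g \<in> wL2" for f g \<xi>
          unfolding B_def by (subst div_heat_add[OF flux_integrable[OF that] flux_integrable[OF that(2,1)] a]) simp
        \<comment> \<open>The two slow contributions, from (G, G) and from \<open>G\<close> with its
          derivative, drop out. The survivor is quadratic in \<open>l\<close> and of order
          exp(-s).\<close>
        have PP: "div_heat a e (flux (P s) (P s)) \<xi> = div_heat a e (flux l l) \<xi>" for \<xi>
        proof -
          have P: "P s = (\<lambda>y. A * G y + 1 * l y)" by (simp add: P_def[abs_def] l_def)
          have "div_heat a e (flux (P s) (P s)) \<xi> = A * A * div_heat a e (flux G G) \<xi> + A * (div_heat a e (flux G l) \<xi> + div_heat a e (flux l G) \<xi>) + div_heat a e (flux l l) \<xi>"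
            unfolding P
            by (subst div_heat_flux_add[OF a wL2_cmult[OF G_wL2] wL2_cmult[OF lX] wL2_cmult[OF G_wL2] wL2_cmult[OF lX]])
               (simp only: div_heat_flux_cmult[OF wL2_measurable[OF G_wL2]] div_heat_flux_cmult[OF wL2_measurable[OF lX]], simp add: algebra_simps)
          then show ?thesis
            using div_heat_G_G[OF e, of \<xi>] div_heat_G_momG[OF e, of "exp (- s / 2) *\<^sub>R c" \<xi>] by (simp add: a_def l_def)
        qed
        have us: "u s = (\<lambda>y. P s y + R s y)" by (simp add: R_def)
        have Heq: "H s = (\<lambda>\<xi>. (1/2 * B l l \<xi> + 1/2 * B (R s) (R s) \<xi>) + B (P s) (R s) \<xi>)"
        proof (rule ext)
          fix \<xi>
          have "H s \<xi> = e * div_heat a e (flux (u s) (u s)) \<xi>" using s by (simp add: H_def duhamel_def e_def a_def)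
          also have "\<dots> = e * (div_heat a e (flux l l) \<xi> + div_heat a e (flux (P s) (R s)) \<xi> + div_heat a e (flux (R s) (P s)) \<xi> + div_heat a e (flux (R s) (R s)) \<xi>)"
            unfolding us by (subst div_heat_flux_add[OF a PX RsX PX RsX]) (simp add: PP)
          also have "\<dots> = (1/2 * B l l \<xi> + 1/2 * B (R s) (R s) \<xi>) + B (P s) (R s) \<xi>"
            by (simp only: dd[OF lX lX] dd[OF RsX RsX] dd[OF PX RsX]) (simp add: algebra_simps)
          finally show "H s \<xi> = \<dots>" .
        qed
        define \<beta> where "\<beta> = sqrt C2 * k"
        have \<beta>: "\<beta> \<ge> 0" using C2 k by (simp add: \<beta>_def)
        have half: "W (\<lambda>\<xi>. 1/2 * B f f \<xi>) \<le> ennreal ((1/2 * \<beta> * wnorm f * wnorm f)\<^sup>2)" if "f \<in> wL2" for f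
        proof -
          have "W (\<lambda>\<xi>. 1/2 * B f f \<xi>) = ennreal ((1/2)\<^sup>2) * W (B f f)" by (rule W_cmult[OF Bm[OF that that]])
          also have "\<dots> \<le> ennreal ((1/2)\<^sup>2) * ennreal ((\<beta> * wnorm f * wnorm f)\<^sup>2)"
            unfolding \<beta>_def by (intro mult_left_mono Bb that) auto
          also have "\<dots> = ennreal ((1/2)\<^sup>2 * (\<beta> * wnorm f * wnorm f)\<^sup>2)"
            by (rule ennreal_mult'[symmetric]) simp
          also have "(1/2)\<^sup>2 * (\<beta> * wnorm f * wnorm f)\<^sup>2 = (1/2 * \<beta> * wnorm f * wnorm f)\<^sup>2"
            by (simp only: power_mult_distrib[symmetric] mult.assoc)
          finally show ?thesis .
        qed
        have "W (H s) \<le> ennreal (((1/2 * \<beta> * wnorm l * wnorm l + 1/2 * \<beta> * wnorm (R s) * wnorm (R s)) + \<beta> * wnorm (P s) * wnorm (R s))\<^sup>2)"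
          unfolding Heq
        proof (intro wint_triangle half lX RsX)
          show "W (B (P s) (R s)) \<le> ennreal ((\<beta> * wnorm (P s) * wnorm (R s))\<^sup>2)" unfolding \<beta>_def by (intro Bb PX RsX)
          show "B (P s) (R s) \<in> borel_measurable borel" by (intro Bm PX RsX)
          have [measurable]: "B l l \<in> borel_measurable borel" "B (R s) (R s) \<in> borel_measurable borel" by (intro Bm lX RsX)+
          show "(\<lambda>x. 1/2 * B l l x + 1/2 * B (R s) (R s) x) \<in> borel_measurable borel"
            "(\<lambda>x. 1/2 * B l l x) \<in> borel_measurable borel" "(\<lambda>x. 1/2 * B (R s) (R s) x) \<in> borel_measurable borel" by measurable
        qed (use \<beta> in \<open>auto intro!: add_nonneg_nonneg mult_nonneg_nonneg\<close>)
        also have "\<dots> \<le> ennreal ((q s)\<^sup>2)"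
        proof (intro ennreal_leI power_mono)
          define E where "E = exp (- \<mu> * s)"
          have E: "0 < E" "E \<le> 1" using s \<mu> by (auto simp: E_def)
          \<comment> \<open>exp(-s) \<le> exp(-\<mu> s): the interaction of the derivative part with
            itself decays fast enough.\<close>
          have h: "exp (- s / 2) * exp (- s / 2) \<le> E"
            using s \<mu> by (simp add: E_def exp_add[symmetric] mult_right_le_one_le mult_left_le_one_le)
          have r0: "r \<ge> 0" using r by simp
          have l1: "wnorm l * wnorm l \<le> (m0 * r)\<^sup>2 * E"
          proof -
            have "wnorm l \<le> m0 * r * exp (- s / 2)"
              unfolding l_def by (rule order_trans[OF lGb[of s] mult_right_mono[OF mult_right_mono[OF m0(3) r0]]]) simp
            then have "wnorm l * wnorm l \<le> (m0 * r * exp (- s / 2)) * (m0 * r * exp (- s / 2))"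
              using m0(1) r0 by (intro mult_mono) auto
            also have "\<dots> = (m0 * r)\<^sup>2 * (exp (- s / 2) * exp (- s / 2))" by (simp add: power2_eq_square)
            also have "\<dots> \<le> (m0 * r)\<^sup>2 * E" using h by (intro mult_left_mono) auto
            finally show ?thesis .
          qed
          have R1: "wnorm (R s) \<le> m0 * r * E"
          proof -
            have "2 * C0 * r * exp (- \<mu> * s) \<le> m0 * r * E"
              using m0(4) r0 E unfolding E_def by (intro mult_right_mono) auto
            then show ?thesis using prev[OF s] by linarith
          qed
          have R2: "wnorm (R s) * wnorm (R s) \<le> (m0 * r)\<^sup>2 * E"
          proof -
            have "wnorm (R s) * wnorm (R s) \<le> (m0 * r * E) * (m0 * r * 1)"
            proof (intro mult_mono R1)
              have "m0 * r * E \<le> m0 * r * 1" using E m0(1) r0 by (intro mult_left_mono) auto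
              then show "wnorm (R s) \<le> m0 * r * 1" using R1 by linarith
            qed (use m0(1) r0 E in auto)
            then show ?thesis by (simp add: power2_eq_square ac_simps)
          qed
          have P1: "wnorm (P s) \<le> m0 * r" using order_trans[OF Pb[OF s(1)] mult_right_mono[OF m0(2) r0]] .
          have R3: "wnorm (P s) * wnorm (R s) \<le> (m0 * r)\<^sup>2 * E"
          proof -
            have "wnorm (P s) * wnorm (R s) \<le> (m0 * r) * (m0 * r * E)"
              using m0(1) r0 by (intro mult_mono P1 R1) auto
            then show ?thesis by (simp add: power2_eq_square ac_simps)
          qed
          have "(1/2 * \<beta> * wnorm l * wnorm l + 1/2 * \<beta> * wnorm (R s) * wnorm (R s)) + \<beta> * wnorm (P s) * wnorm (R s)
            = 1/2 * \<beta> * (wnorm l * wnorm l) + 1/2 * \<beta> * (wnorm (R s) * wnorm (R s)) + \<beta> * (wnorm (P s) * wnorm (R s))" by (simp add: mult.assoc)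
          also have "\<dots> \<le> 1/2 * \<beta> * ((m0 * r)\<^sup>2 * E) + 1/2 * \<beta> * ((m0 * r)\<^sup>2 * E) + \<beta> * ((m0 * r)\<^sup>2 * E)"
            using \<beta> by (intro add_mono mult_left_mono l1 R2 R3) auto
          also have "\<dots> = 2 * sqrt C2 * m0\<^sup>2 * (r\<^sup>2 * k * E)" by (simp add: \<beta>_def power_mult_distrib)
          also have "\<dots> \<le> \<Lambda> * (r\<^sup>2 * k * E)" unfolding \<Lambda>_def using k E m0(1) by (intro mult_right_mono) auto
          also have "\<dots> = q s" using s by (simp add: q_def k_def E_def mult.assoc)
          finally show "(1/2 * \<beta> * wnorm l * wnorm l + 1/2 * \<beta> * wnorm (R s) * wnorm (R s)) + \<beta> * wnorm (P s) * wnorm (R s) \<le> q s" .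
        qed (use \<beta> in \<open>auto intro!: add_nonneg_nonneg mult_nonneg_nonneg\<close>)
        finally show ?thesis .
      qed
      define Q where "Q = \<Lambda> * r\<^sup>2 * (exp (- \<mu> * t) * Kc)"
      have Qn: "Q \<ge> 0" using \<Lambda> Kc(2) by (simp add: Q_def)
      have qi: "(\<integral>\<^sup>+s. ennreal (q s) \<partial>lborel) \<le> ennreal Q"
      proof -
        have "(\<integral>\<^sup>+s. ennreal (q s) \<partial>lborel) = (\<integral>\<^sup>+s. ennreal (\<Lambda> * r\<^sup>2) * (ennreal (duhamel_kernel (t - s) * exp (- \<mu> * s)) * indicator {0..<t} s) \<partial>lborel)"
          using \<Lambda> by (intro nn_integral_cong) (auto simp: q_def indicator_def ennreal_mult'[symmetric])
        also have "\<dots> = ennreal (\<Lambda> * r\<^sup>2) * (\<integral>\<^sup>+s. ennreal (duhamel_kernel (t - s) * exp (- \<mu> * s)) * indicator {0..<t} s \<partial>lborel)"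
          by (rule nn_integral_cmult) measurable
        also have "\<dots> \<le> ennreal (\<Lambda> * r\<^sup>2) * (ennreal (exp (- \<mu> * t)) * ennreal Kc)"
          using duhamel_kernel_convolution[of t \<mu>] unfolding Kc(1) by (intro mult_left_mono) auto
        also have "\<dots> = ennreal Q" using \<Lambda> Kc(2) by (simp add: Q_def ennreal_mult'[symmetric])
        finally show ?thesis .
      qed
      have WJ: "wint (\<lambda>\<xi>. \<integral>\<^sup>+s. ennreal \<bar>H s \<xi>\<bar> \<partial>lborel) \<le> (ennreal Q)\<^sup>2"
      proof (rule wint_time_integral[OF Hm _ _ _ HW qi])
        show "q \<in> borel_measurable borel" unfolding q_def by measurable
        show "q s \<ge> 0" for s using \<Lambda> duhamel_kernel_pos[of "t - s"] by (auto simp: q_def indicator_def)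
        show "H s \<xi> = 0" if "q s = 0" for s \<xi>
          using that \<Lambda> r duhamel_kernel_pos[of "t - s"] by (auto simp: q_def H_def indicator_def split: if_splits)
      qed
      note [measurable] = wL2_measurable[OF RX[OF t]] wL2_measurable[OF PX]
      have [measurable]: "lin t \<in> borel_measurable borel" unfolding lin_def by (cases "t = 0") (simp_all, measurable)
      \<comment> \<open>The Gaussian part cancels in the difference, which is exactly the deviation
        from linear evolution bounded by the equation.\<close>
      have "W (\<lambda>\<xi>. R t \<xi> - lin t \<xi>) \<le> wint (\<lambda>\<xi>. \<integral>\<^sup>+s. ennreal \<bar>H s \<xi>\<bar> \<partial>lborel)"
      proof (rule wint_mono_AE)
        have "R t \<xi> - lin t \<xi> = u t \<xi> - (if t = 0 then w0 \<xi> else heat_conv (1 - (exp (- t / 2))\<^sup>2) (exp (- t / 2)) w0 \<xi>)" for \<xi>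
          by (simp add: R_def lin_def)
        then show "AE \<xi> in lborel. ennreal \<bar>R t \<xi> - lin t \<xi>\<bar> \<le> (\<integral>\<^sup>+s. ennreal \<bar>H s \<xi>\<bar> \<partial>lborel)"
          using eqn[OF t] by (simp only: H_def)
      qed
      also note WJ
      also have "(ennreal Q)\<^sup>2 = ennreal (Q\<^sup>2)" using Qn by (simp add: ennreal_power)
      finally have dW: "W (\<lambda>\<xi>. R t \<xi> - lin t \<xi>) \<le> ennreal (Q\<^sup>2)" .
      have linm: "lin t \<in> borel_measurable borel" and dm: "(\<lambda>\<xi>. R t \<xi> - lin t \<xi>) \<in> borel_measurable borel" by measurable
      have "W (\<lambda>\<xi>. lin t \<xi> + (R t \<xi> - lin t \<xi>)) \<le> ennreal ((C0 * r * exp (- \<mu> * t) + Q)\<^sup>2)"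
        by (rule wint_triangle[OF linm dm linb[OF t] _ dW Qn]) (use C0(1) r in auto)
      then have "wnorm (R t) \<le> C0 * r * exp (- \<mu> * t) + Q"
        using C0(1) r Qn by (intro wnorm_le) auto
      also have "\<dots> = (C0 * r + \<Lambda> * r\<^sup>2 * Kc) * exp (- \<mu> * t)" by (simp add: Q_def algebra_simps)
      also have "\<dots> < (C0 * r + C0 * r) * exp (- \<mu> * t)" using rK by (intro mult_strict_right_mono) auto
      finally show ?thesis by simp
    qed
    define z where "z t = exp (\<mu> * t) * wnorm (R t)" for t
    have Rc: "continuous_on {0..} (\<lambda>t. wnorm (R t))"
      unfolding continuous_on_def
    proof
      fix t :: real assume t: "t \<in> {0..}"
      \<comment> \<open>In the Gaussian part only the coefficient exp(-s/2) depends on time, so its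
        variation is a scalar multiple of one fixed function.\<close>
      have "\<bar>wnorm (R s) - wnorm (R t)\<bar> \<le> wnorm (\<lambda>\<xi>. u s \<xi> - u t \<xi>) + \<bar>exp (- s / 2) - exp (- t / 2)\<bar> * wnorm (momG c)" if "s \<ge> 0" for s
      proof -
        have "\<bar>wnorm (R s) - wnorm (R t)\<bar> \<le> wnorm (\<lambda>\<xi>. R s \<xi> - R t \<xi>)"
          using that t by (intro wnorm_diff_triangle RX) auto
        also have "(\<lambda>\<xi>. R s \<xi> - R t \<xi>) = (\<lambda>\<xi>. (u s \<xi> - u t \<xi>) + (exp (- t / 2) - exp (- s / 2)) * momG c \<xi>)"
          by (rule ext) (simp add: R_def P_def momG_def algebra_simps)
        also have "wnorm \<dots> \<le> wnorm (\<lambda>\<xi>. u s \<xi> - u t \<xi>) + wnorm (\<lambda>\<xi>. (exp (- t / 2) - exp (- s / 2)) * momG c \<xi>)"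
          using that t by (intro wnorm_triangle wL2_diff wL2_cmult momG_wL2 u) auto
        finally show ?thesis by (simp add: wnorm_cmult[OF momG_wL2] abs_minus_commute)
      qed
      then have ev: "\<forall>\<^sub>F s in at t within {0..}. norm (wnorm (R s) - wnorm (R t)) \<le> wnorm (\<lambda>\<xi>. u s \<xi> - u t \<xi>) + \<bar>exp (- s / 2) - exp (- t / 2)\<bar> * wnorm (momG c)"
        by (auto simp: eventually_at_filter)
      have "((\<lambda>s. wnorm (\<lambda>\<xi>. u s \<xi> - u t \<xi>) + \<bar>exp (- s / 2) - exp (- t / 2)\<bar> * wnorm (momG c)) \<longlongrightarrow> 0 + \<bar>exp (- t / 2) - exp (- t / 2)\<bar> * wnorm (momG c)) (at t within {0..})"
        using t by (intro tendsto_intros cont) auto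
      then have "((\<lambda>s. wnorm (R s) - wnorm (R t)) \<longlongrightarrow> 0) (at t within {0..})"
        by (intro Lim_null_comparison[OF ev]) simp
      then show "((\<lambda>t. wnorm (R t)) \<longlongrightarrow> wnorm (R t)) (at t within {0..})"
        by (simp add: LIM_zero_iff)
    qed
    have zc: "continuous_on {0..} z" unfolding z_def by (intro continuous_intros Rc)
    have zless: "z t < 2 * C0 * r" if t0: "t \<ge> 0" for t
    proof (rule ccontr)
      assume "\<not> z t < 2 * C0 * r"
      \<comment> \<open>Times violating the strict bound. Continuity makes the set closed, so it
        would have a first element; there the bound holds at all earlier times, and
        \<open>step\<close> contradicts membership.\<close>
      define S where "S = {0..} \<inter> z -` {2 * C0 * r..}"
      have tS: "t \<in> S" using t0 \<open>\<not> z t < 2 * C0 * r\<close> by (simp add: S_def)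
      have cl: "closed S" unfolding S_def by (rule continuous_closed_preimage[OF zc]) auto
      have bd: "bdd_below S" by (rule bdd_belowI[of _ 0]) (simp add: S_def)
      define T where "T = Inf S"
      have TS: "T \<in> S" unfolding T_def using closed_contains_Inf[OF _ bd cl] tS by auto
      have T0: "T \<ge> 0" "2 * C0 * r \<le> z T" using TS by (auto simp: S_def)
      have "wnorm (R T) < 2 * C0 * r * exp (- \<mu> * T)"
      proof (rule step[OF T0(1)])
        fix s assume s: "0 \<le> s" "s < T"
        have "s \<notin> S" using cInf_lower[OF _ bd, of s] s by (auto simp: T_def)
        then have "exp (\<mu> * s) * wnorm (R s) \<le> 2 * C0 * r" using s by (simp add: S_def z_def)
        then have "exp (- \<mu> * s) * (exp (\<mu> * s) * wnorm (R s)) \<le> exp (- \<mu> * s) * (2 * C0 * r)" by (intro mult_left_mono) auto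
        then show "wnorm (R s) \<le> 2 * C0 * r * exp (- \<mu> * s)"
          by (simp add: mult.assoc[symmetric] exp_add[symmetric]) (simp add: ac_simps)
      qed
      then have "exp (\<mu> * T) * wnorm (R T) < exp (\<mu> * T) * (2 * C0 * r * exp (- \<mu> * T))" by (intro mult_strict_left_mono) auto
      also have "\<dots> = 2 * C0 * r * (exp (\<mu> * T) * exp (- \<mu> * T))" by simp
      also have "exp (\<mu> * T) * exp (- \<mu> * T) = 1" by (simp add: exp_add[symmetric])
      finally show False using T0(2) by (simp add: z_def)
    qed
    have "wnorm (R t) < 2 * C0 * r * exp (- \<mu> * t)"
    proof (rule step[OF t])
      fix s assume s: "0 \<le> s" "s < t"
      have "exp (\<mu> * s) * wnorm (R s) \<le> 2 * C0 * r" using zless[OF s(1)] by (simp add: z_def)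
      then have "exp (- \<mu> * s) * (exp (\<mu> * s) * wnorm (R s)) \<le> exp (- \<mu> * s) * (2 * C0 * r)" by (intro mult_left_mono) auto
      then show "wnorm (R s) \<le> 2 * C0 * r * exp (- \<mu> * s)"
        by (simp add: mult.assoc[symmetric] exp_add[symmetric]) (simp add: ac_simps)
    qed
    moreover have "R t = (\<lambda>\<xi>. u t \<xi> - (\<integral>y. w0 y \<partial>lborel) * G \<xi>
        + 1/2 * (- (\<integral>y. y $ 1 * w0 y \<partial>lborel) * \<xi> $ 1 + - (\<integral>y. y $ 2 * w0 y \<partial>lborel) * \<xi> $ 2) * G \<xi> * exp (- t / 2))"
      by (rule ext) (simp add: R_def P_def A_def momG_def c_def m_def inner_plane algebra_simps)
    ultimately show "wnorm (\<lambda>\<xi>. u t \<xi> - (\<integral>y. w0 y \<partial>lborel) * G \<xi>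
          + 1/2 * (- (\<integral>y. y $ 1 * w0 y \<partial>lborel) * \<xi> $ 1 + - (\<integral>y. y $ 2 * w0 y \<partial>lborel) * \<xi> $ 2) * G \<xi> * exp (- t / 2))
         \<le> 2 * C0 * r * exp (- \<mu> * t)" by simp
  qed
qed

section \<open>From the integral equation to Borel representatives\<close>

lemma measurable_lebesgue_borel:
  "f \<in> borel_measurable borel \<Longrightarrow> f \<in> borel_measurable (lebesgue :: 'a::euclidean_space measure)"
  by (rule measurable_completion) simp

lemma L2_lebesgue_measurable: "f \<in> L2 m \<Longrightarrow> f \<in> borel_measurable lebesgue"
  by (simp add: L2_def)

lemma integral_lebesgue_representative:
  fixes f g k :: "real^2 \<Rightarrow> real"
  assumes f: "f \<in> borel_measurable lebesgue" and g: "g \<in> borel_measurable borel"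
    and k: "k \<in> borel_measurable borel" and ae: "AE x in lborel. f x = g x"
  shows "(LINT x|lebesgue. k x * f x) = (\<integral>x. k x * g x \<partial>lborel)"
proof -
  note [measurable] = f measurable_lebesgue_borel[OF g] measurable_lebesgue_borel[OF k]
  have "(LINT x|lebesgue. k x * f x) = (LINT x|lebesgue. k x * g x)"
  proof (rule integral_cong_AE)
    show "(\<lambda>x. k x * f x) \<in> borel_measurable lebesgue" "(\<lambda>x. k x * g x) \<in> borel_measurable lebesgue" by measurable
  qed (use AE_completion[OF ae] in \<open>eventually_elim, simp\<close>)
  also have "\<dots> = (\<integral>x. k x * g x \<partial>lborel)" using g k by (intro integral_completion) simp
  finally show ?thesis .
qed

text \<open>The divergence is sensitive to null sets, but for positive times the semigroup already
  produces the same function from both representatives, so it can be applied after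
  smoothing.\<close>

lemma divergence_semigroup_representative:
  assumes f: "f \<in> borel_measurable lebesgue" and g: "g \<in> wL2" and ae: "AE x in lborel. f x = g x" and t: "t > 0"
  shows "divergence (semigroup_L t (\<lambda>\<eta>. f \<eta> *\<^sub>R biot_savart f \<eta>)) \<xi>
    = div_heat (1 - (exp (- t / 2))\<^sup>2) (exp (- t / 2)) (flux g g) \<xi>"
proof -
  note [measurable] = wL2_measurable[OF g]
  have bs: "biot_savart f = biot_savart g"
    by (rule ext, rule biot_savart_cong[OF f _ ae]) measurable
  have m: "(\<lambda>\<eta>. f \<eta> *\<^sub>R biot_savart f \<eta>) \<in> borel_measurable lebesgue"
    unfolding bs by (intro borel_measurable_scaleR f measurable_lebesgue_borel) measurable
  have ae2: "AE \<eta> in lborel. f \<eta> *\<^sub>R biot_savart f \<eta> = flux g g \<eta>"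
    using ae by eventually_elim (simp add: bs flux_def)
  have a: "0 < 1 - (exp (- t / 2))\<^sup>2" "1 - (exp (- t / 2))\<^sup>2 \<le> 1"
    using t by (auto simp: power_less_one_iff)
  have "semigroup_L t (\<lambda>\<eta>. f \<eta> *\<^sub>R biot_savart f \<eta>)
     = (\<lambda>\<xi>. \<integral>y. heat (1 - (exp (- t / 2))\<^sup>2) (\<xi> - exp (- t / 2) *\<^sub>R y) *\<^sub>R flux g g y \<partial>lborel)"
    by (rule ext, rule semigroup_L_eq[OF t m _ ae2]) measurable
  then show ?thesis
    using divergence_heat_convolution[OF flux_integrable[OF g g] a] by simp
qed

theorem theorem4p5:
  fixes \<mu> :: real
  assumes "1 / 2 < \<mu>" and "\<mu> < 1"
  shows "\<exists>r\<^sub>2>0. \<exists>C>0. \<forall>w0 \<in> L2 3. norm_L2 3 w0 \<le> r\<^sub>2 \<longrightarrow>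
    (\<forall>w. vorticity_solution 3 w0 w \<longrightarrow>
      (let A = LINT \<xi>|lebesgue. w0 \<xi>;
           B\<^sub>1 = - (LINT \<xi>|lebesgue. \<xi> $ 1 * w0 \<xi>);
           B\<^sub>2 = - (LINT \<xi>|lebesgue. \<xi> $ 2 * w0 \<xi>)
       in \<forall>\<tau>\<ge>0.
         norm_L2 3 (\<lambda>\<xi>. w \<tau> \<xi> - A * G \<xi>
           + 1 / 2 * (B\<^sub>1 * \<xi> $ 1 + B\<^sub>2 * \<xi> $ 2) * G \<xi> * exp (- \<tau> / 2))
         \<le> C * exp (- \<mu> * \<tau>)))"
proof -
  obtain r C where rC: "r > 0" "C > 0" and decay:
    "\<And>w0 u t. w0 \<in> wL2 \<Longrightarrow> wnorm w0 \<le> r \<Longrightarrow> mild_evolution w0 u \<Longrightarrow> t \<ge> 0 \<Longrightarrow>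
      wnorm (\<lambda>\<xi>. u t \<xi> - (\<integral>y. w0 y \<partial>lborel) * G \<xi>
          + 1/2 * (- (\<integral>y. y $ 1 * w0 y \<partial>lborel) * \<xi> $ 1 + - (\<integral>y. y $ 2 * w0 y \<partial>lborel) * \<xi> $ 2) * G \<xi> * exp (- t / 2))
         \<le> C * exp (- \<mu> * t)"
    using evolution_decay[OF assms] by blast
  have main: "norm_L2 3 (\<lambda>\<xi>. w \<tau> \<xi> - (LINT \<xi>|lebesgue. w0 \<xi>) * G \<xi>
           + 1 / 2 * (- (LINT \<xi>|lebesgue. \<xi> $ 1 * w0 \<xi>) * \<xi> $ 1 + - (LINT \<xi>|lebesgue. \<xi> $ 2 * w0 \<xi>) * \<xi> $ 2) * G \<xi> * exp (- \<tau> / 2))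
         \<le> C * exp (- \<mu> * \<tau>)"
    if w0: "w0 \<in> L2 3" "norm_L2 3 w0 \<le> r" and sol: "vorticity_solution 3 w0 w" and \<tau>: "\<tau> \<ge> 0" for w0 w \<tau>
  proof -
    note w0m = L2_lebesgue_measurable[OF w0(1)]
    obtain v0 where v0: "v0 \<in> wL2" "AE x in lborel. w0 x = v0 x"
      using L2_borel_representative[OF w0(1)] by blast
    note v0m[measurable] = wL2_measurable[OF v0(1)]
    have wL: "w s \<in> L2 3" if "s \<ge> 0" for s using sol that by (simp add: vorticity_solution_def)
    have wm: "w s \<in> borel_measurable lebesgue" if "s \<ge> 0" for s using L2_lebesgue_measurable[OF wL[OF that]] .
    \<comment> \<open>Chosen independently for each time; \<open>duhamel_measurable\<close> supplies
      the joint measurability needed despite this choice.\<close>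
    obtain u where u: "\<And>s. s \<ge> 0 \<Longrightarrow> u s \<in> wL2 \<and> (AE x in lborel. w s x = u s x)"
      using L2_borel_representative[OF wL] by (metis (no_types))
    have um: "u s \<in> borel_measurable borel" if "s \<ge> 0" for s using wL2_measurable u that by blast
    have n0: "wnorm v0 \<le> r"
      using norm_L2_cong[OF w0m v0m v0(2)] norm_L2_borel[OF v0m] w0(2) by simp
    have cont: "((\<lambda>s. wnorm (\<lambda>\<xi>. u s \<xi> - u t \<xi>)) \<longlongrightarrow> 0) (at t within {0..})" if t: "t \<ge> 0" for t
    proof -
      have "norm_L2 3 (\<lambda>\<xi>. w s \<xi> - w t \<xi>) = wnorm (\<lambda>\<xi>. u s \<xi> - u t \<xi>)" if s: "s \<ge> 0" for s
      proof -
        have m: "(\<lambda>\<xi>. u s \<xi> - u t \<xi>) \<in> borel_measurable borel" using um[OF s] um[OF t] by measurable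
        have "AE x in lborel. w s x - w t x = u s x - u t x"
          using conjunct2[OF u[OF s]] conjunct2[OF u[OF t]] by eventually_elim simp
        then show ?thesis
          using norm_L2_cong[of "\<lambda>\<xi>. w s \<xi> - w t \<xi>" "\<lambda>\<xi>. u s \<xi> - u t \<xi>"] wm[OF s] wm[OF t] m norm_L2_borel[OF m] by simp
      qed
      then have "\<forall>\<^sub>F s in at t within {0..}. norm_L2 3 (\<lambda>\<xi>. w s \<xi> - w t \<xi>) = wnorm (\<lambda>\<xi>. u s \<xi> - u t \<xi>)"
        by (auto simp: eventually_at_filter)
      moreover have "((\<lambda>s. norm_L2 3 (\<lambda>\<xi>. w s \<xi> - w t \<xi>)) \<longlongrightarrow> 0) (at t within {0..})"
        using sol t by (simp add: vorticity_solution_def)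
      ultimately show ?thesis by (rule Lim_transform_eventually[rotated])
    qed
    have eqn: "AE \<xi> in lborel.
         ennreal \<bar>u t \<xi> - (if t = 0 then v0 \<xi> else heat_conv (1 - (exp (- t / 2))\<^sup>2) (exp (- t / 2)) v0 \<xi>)\<bar>
         \<le> (\<integral>\<^sup>+s. ennreal \<bar>indicator {0..<t} s * duhamel t u s \<xi>\<bar> \<partial>lborel)" if t: "t \<ge> 0" for t
    proof -
      define J where "J \<xi> = (LINT s:{0..t}|lebesgue. exp (- (t - s) / 2) *
             divergence (semigroup_L (t - s) (\<lambda>\<eta>. w s \<eta> *\<^sub>R biot_savart (w s) \<eta>)) \<xi>)" for \<xi>
      have "AE \<xi> in lebesgue. w t \<xi> = semigroup_L t w0 \<xi> - J \<xi>"
        using sol t by (simp add: vorticity_solution_def J_def)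
      then have e1: "AE \<xi> in lborel. w t \<xi> = semigroup_L t w0 \<xi> - J \<xi>" by (simp add: AE_completion_iff)
      have e2: "AE \<xi> in lborel. semigroup_L t w0 \<xi> = (if t = 0 then v0 \<xi> else heat_conv (1 - (exp (- t / 2))\<^sup>2) (exp (- t / 2)) v0 \<xi>)"
      proof (cases "t = 0")
        case True
        then show ?thesis using v0(2) by (simp add: semigroup_L_def)
      next
        case False
        then have "t > 0" using t by simp
        from semigroup_L_eq[OF this w0m v0m v0(2)] False show ?thesis by (simp add: heat_conv_def)
      qed
      have e3: "ennreal \<bar>J \<xi>\<bar> \<le> (\<integral>\<^sup>+s. ennreal \<bar>indicator {0..<t} s * duhamel t u s \<xi>\<bar> \<partial>lborel)" for \<xi>
      proof -
        let ?j = "\<lambda>s. indicator {0..t} s *\<^sub>R (exp (- (t - s) / 2) *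
             divergence (semigroup_L (t - s) (\<lambda>\<eta>. w s \<eta> *\<^sub>R biot_savart (w s) \<eta>)) \<xi>)"
        have "ennreal (norm (J \<xi>)) \<le> (\<integral>\<^sup>+s. ennreal (norm (?j s)) \<partial>lebesgue)"
          unfolding J_def set_lebesgue_integral_def
        proof (cases "integrable lebesgue ?j")
          case True
          then show "ennreal (norm (LINT s|lebesgue. ?j s)) \<le> (\<integral>\<^sup>+s. ennreal (norm (?j s)) \<partial>lebesgue)"
            by (rule integral_norm_bound_ennreal)
        qed (simp add: not_integrable_integral_eq)
        also have "\<dots> = (\<integral>\<^sup>+s. ennreal (norm (?j s)) \<partial>lborel)" by (rule nn_integral_completion)
        also have "\<dots> = (\<integral>\<^sup>+s. ennreal \<bar>indicator {0..<t} s * duhamel t u s \<xi>\<bar> \<partial>lborel)"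
        proof (rule nn_integral_cong_AE)
          \<comment> \<open>The closed interval of the equation and the half-open one differ only in
            the endpoint s = t, where the semigroup is the identity and the divergence carries no
            information.\<close>
          show "AE s in lborel. ennreal (norm (?j s)) = ennreal \<bar>indicator {0..<t} s * duhamel t u s \<xi>\<bar>"
            using AE_lborel_singleton[of t]
          proof eventually_elim
            case (elim s)
            show ?case
            proof (cases "s \<in> {0..<t}")
              case True
              then have s: "s \<ge> 0" "t - s > 0" by auto
              have "?j s = duhamel t u s \<xi>"
                using divergence_semigroup_representative[OF wm[OF s(1)] conjunct1[OF u[OF s(1)]] conjunct2[OF u[OF s(1)]] s(2)] s
                by (simp add: duhamel_def)
              then show ?thesis using True by simp
            qed (use elim in \<open>auto simp: indicator_def\<close>)
          qed
        qed
        finally show ?thesis by simp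
      qed
      show ?thesis using e1 e2 conjunct2[OF u[OF t]]
      proof eventually_elim
        case (elim \<xi>)
        then have "u t \<xi> - (if t = 0 then v0 \<xi> else heat_conv (1 - (exp (- t / 2))\<^sup>2) (exp (- t / 2)) v0 \<xi>) = - J \<xi>" by linarith
        then show ?case using e3[of \<xi>] by (simp only: abs_minus_cancel)
      qed
    qed
    have me: "mild_evolution v0 u"
      unfolding mild_evolution_def using conjunct1[OF u] cont eqn by blast
    have mom: "(LINT \<xi>|lebesgue. w0 \<xi>) = (\<integral>y. v0 y \<partial>lborel)" "(LINT \<xi>|lebesgue. \<xi> $ i * w0 \<xi>) = (\<integral>y. y $ i * v0 y \<partial>lborel)" for i
      using integral_lebesgue_representative[OF w0m v0m _ v0(2), of "\<lambda>_. 1"]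
        integral_lebesgue_representative[OF w0m v0m _ v0(2), of "\<lambda>\<xi>. \<xi> $ i"] by simp_all
    define b where "b \<xi> = 1 / 2 * (- (LINT \<xi>|lebesgue. \<xi> $ 1 * w0 \<xi>) * \<xi> $ 1 + - (LINT \<xi>|lebesgue. \<xi> $ 2 * w0 \<xi>) * \<xi> $ 2) * G \<xi> * exp (- \<tau> / 2)" for \<xi>
    have bm[measurable]: "b \<in> borel_measurable borel" unfolding b_def by measurable
    have m: "(\<lambda>\<xi>. u \<tau> \<xi> - (LINT \<xi>|lebesgue. w0 \<xi>) * G \<xi> + b \<xi>) \<in> borel_measurable borel"
      using um[OF \<tau>] by measurable
    have "norm_L2 3 (\<lambda>\<xi>. w \<tau> \<xi> - (LINT \<xi>|lebesgue. w0 \<xi>) * G \<xi> + b \<xi>) = norm_L2 3 (\<lambda>\<xi>. u \<tau> \<xi> - (LINT \<xi>|lebesgue. w0 \<xi>) * G \<xi> + b \<xi>)"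
    proof (rule norm_L2_cong[OF _ m])
      note [measurable] = wm[OF \<tau>] measurable_lebesgue_borel[OF bm] measurable_lebesgue_borel[OF G_measurable]
      show "(\<lambda>\<xi>. w \<tau> \<xi> - (LINT \<xi>|lebesgue. w0 \<xi>) * G \<xi> + b \<xi>) \<in> borel_measurable lebesgue" by measurable
      show "AE \<xi> in lborel. w \<tau> \<xi> - (LINT \<xi>|lebesgue. w0 \<xi>) * G \<xi> + b \<xi> = u \<tau> \<xi> - (LINT \<xi>|lebesgue. w0 \<xi>) * G \<xi> + b \<xi>"
        using conjunct2[OF u[OF \<tau>]] by eventually_elim simp
    qed
    also have "\<dots> = wnorm (\<lambda>\<xi>. u \<tau> \<xi> - (LINT \<xi>|lebesgue. w0 \<xi>) * G \<xi> + b \<xi>)" by (rule norm_L2_borel[OF m])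
    also have "\<dots> \<le> C * exp (- \<mu> * \<tau>)"
      unfolding b_def mom by (rule decay[OF v0(1) n0 me \<tau>])
    finally show ?thesis unfolding b_def .
  qed
  show ?thesis
    unfolding Let_def using rC main by (intro exI[of _ r] conjI exI[of _ C] ballI impI allI) auto
qed

end
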